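(* Let $R$ be a hereditary ring. Then $R$ has the stacked bases property, and every finitely presented $R$-module $M$ has a decomposition \[M\cong \Bigl(\bigoplus_{1\leq j\leq m}R/I_j\Bigr)\oplus\Bigl(\bigoplus_{1\leq i\leq p}\bigl(\bigoplus_{1\leq k\leq n_i}J_{i,k}e_i\bigr)\Bigr)\] where $I_1\supseteq\dots\supseteq I_m$ are proper invertible ideals of $R$, $\{e_1,\dots,e_p\}$ is a family of nonzero orthogonal idempotents of $R$, $n_1<\dots<n_p$ is a strictly increasing sequence of integers $>0$, and for each $i$, $1\leq i\leq p$, $J_{i,1},\dots,J_{i,n_i}$ are invertible ideals of the ring $Re_i$.
   Context: All rings are commutative with identity. A ring is hereditary if every ideal is projective, and semihereditary if every finitely generated ideal is projective. An ideal is invertible if it is invertible as a fractional ideal in the total ring of fractions. For an idempotent $e$, $Re$ is regarded as a ring with identity $e$. Empty direct sums ($m=0$ or $p=0$) are allowed. A semihereditary ring $R$ has the stacked bases property if for each finitely presented $R$-module $M$ and each presentation $0\to H\to F\to M\to 0$ with $F$ a finitely generated free module (regard $H$ as a submodule of $F$), there exist finitely generated ideals $J_1,\dots,J_n$ of $R$ and invertible ideals $I_1\supseteq\dots\supseteq I_m$ of $R$, with $m\le n$, and an isomorphism $F\cong J_1\oplus\dots\oplus J_n$ which maps $H$ onto $I_1J_1\oplus\dots\oplus I_mJ_m$. *)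

theory Defs
  imports "HOL-Algebra.Module" "HOL-Algebra.QuotRing" "HOL-Algebra.Ideal_Product"
begin

text \<open>
  Modules are \<open>module\<close> records in the sense of the locale \<^locale>\<open>module\<close>. Their inherited
  fields \<open>mult\<close> and \<open>one\<close> play no role in that locale, nor in any definition below, and are
  filled in arbitrarily.
\<close>

definition module_homs ::
    "('a, 'r) ring_scheme \<Rightarrow> ('a, 'm, 'x) module_scheme \<Rightarrow> ('a, 'k, 'y) module_scheme
      \<Rightarrow> ('m \<Rightarrow> 'k) set" where
  "module_homs R M N =
    {f \<in> carrier M \<rightarrow> carrier N.
      (\<forall>x\<in>carrier M. \<forall>y\<in>carrier M. f (x \<oplus>\<^bsub>M\<^esub> y) = f x \<oplus>\<^bsub>N\<^esub> f y) \<and>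
      (\<forall>a\<in>carrier R. \<forall>x\<in>carrier M. f (a \<odot>\<^bsub>M\<^esub> x) = a \<odot>\<^bsub>N\<^esub> f x)}"

definition module_iso ::
    "('a, 'r) ring_scheme \<Rightarrow> ('a, 'm, 'x) module_scheme \<Rightarrow> ('a, 'k, 'y) module_scheme
      \<Rightarrow> ('m \<Rightarrow> 'k) set" where
  "module_iso R M N = {f \<in> module_homs R M N. bij_betw f (carrier M) (carrier N)}"

definition module_isomorphic ::
    "('a, 'r) ring_scheme \<Rightarrow> ('a, 'm, 'x) module_scheme \<Rightarrow> ('a, 'k, 'y) module_scheme \<Rightarrow> bool"
  where "module_isomorphic R M N \<longleftrightarrow> module_iso R M N \<noteq> {}"

definition direct_sum :: "'i set \<Rightarrow> ('i \<Rightarrow> ('a, 'm, 'x) module_scheme) \<Rightarrow> ('a, 'i \<Rightarrow> 'm) module" where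
  "direct_sum S M =
    \<lparr>carrier = {x \<in> \<Pi>\<^sub>E i\<in>S. carrier (M i). finite {i \<in> S. x i \<noteq> \<zero>\<^bsub>M i\<^esub>}},
     mult = (\<lambda>x y. \<lambda>i\<in>S. x i \<otimes>\<^bsub>M i\<^esub> y i),
     one = (\<lambda>i\<in>S. \<one>\<^bsub>M i\<^esub>),
     zero = (\<lambda>i\<in>S. \<zero>\<^bsub>M i\<^esub>),
     add = (\<lambda>x y. \<lambda>i\<in>S. x i \<oplus>\<^bsub>M i\<^esub> y i),
     smult = (\<lambda>a x. \<lambda>i\<in>S. a \<odot>\<^bsub>M i\<^esub> x i)\<rparr>"

definition direct_sum2 ::
    "('a, 'm, 'x) module_scheme \<Rightarrow> ('a, 'k, 'y) module_scheme \<Rightarrow> ('a, 'm \<times> 'k) module" where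
  "direct_sum2 M N =
    \<lparr>carrier = carrier M \<times> carrier N,
     mult = (\<lambda>(x, y) (x', y'). (x \<otimes>\<^bsub>M\<^esub> x', y \<otimes>\<^bsub>N\<^esub> y')),
     one = (\<one>\<^bsub>M\<^esub>, \<one>\<^bsub>N\<^esub>),
     zero = (\<zero>\<^bsub>M\<^esub>, \<zero>\<^bsub>N\<^esub>),
     add = (\<lambda>(x, y) (x', y'). (x \<oplus>\<^bsub>M\<^esub> x', y \<oplus>\<^bsub>N\<^esub> y')),
     smult = (\<lambda>a (x, y). (a \<odot>\<^bsub>M\<^esub> x, a \<odot>\<^bsub>N\<^esub> y))\<rparr>"

definition ideal_module :: "('a, 'r) ring_scheme \<Rightarrow> 'a set \<Rightarrow> ('a, 'a) module" where
  "ideal_module R I =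
    \<lparr>carrier = I, mult = mult R, one = \<one>\<^bsub>R\<^esub>, zero = \<zero>\<^bsub>R\<^esub>, add = add R, smult = mult R\<rparr>"

definition quotient_module :: "('a, 'r) ring_scheme \<Rightarrow> 'a set \<Rightarrow> ('a, 'a set) module" where
  "quotient_module R I =
    \<lparr>carrier = carrier (R Quot I), mult = mult (R Quot I), one = \<one>\<^bsub>R Quot I\<^esub>,
     zero = \<zero>\<^bsub>R Quot I\<^esub>, add = add (R Quot I),
     smult = (\<lambda>a X. (I +>\<^bsub>R\<^esub> a) \<otimes>\<^bsub>R Quot I\<^esub> X)\<rparr>"

definition free_module :: "('a, 'r) ring_scheme \<Rightarrow> 'i set \<Rightarrow> ('a, 'i \<Rightarrow> 'a) module" where
  "free_module R S = direct_sum S (\<lambda>_. ideal_module R (carrier R))"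

definition fg_free :: "('a, 'r) ring_scheme \<Rightarrow> ('a, 'm, 'x) module_scheme \<Rightarrow> bool" where
  "fg_free R F \<longleftrightarrow> (\<exists>k::nat. module_isomorphic R F (free_module R {1..k}))"

definition finitely_presented :: "('a, 'r) ring_scheme \<Rightarrow> ('a, 'm, 'x) module_scheme \<Rightarrow> bool" where
  "finitely_presented R M \<longleftrightarrow>
    (\<exists>(l::nat) (k::nat).
      \<exists>f \<in> module_homs R (free_module R {1..l}) (free_module R {1..k}).
      \<exists>g \<in> module_homs R (free_module R {1..k}) M.
        f ` carrier (free_module R {1..l}) = a_kernel (free_module R {1..k}) M g \<and>
        g ` carrier (free_module R {1..k}) = carrier M)"

text \<open>
  Projective means isomorphic to a direct summand of a free module. The basis \<open>S\<close> may be
  taken inside the type of the elements of \<open>P\<close>, since the epimorphism onto a projective module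
  \<open>P\<close> from the free module on \<^term>\<open>carrier P\<close> splits.
\<close>

definition projective :: "('a, 'r) ring_scheme \<Rightarrow> ('a, 'm, 'x) module_scheme \<Rightarrow> bool" where
  "projective R P \<longleftrightarrow>
    (\<exists>(S :: 'm set) A B.
      submodule A R (free_module R S) \<and> submodule B R (free_module R S) \<and>
      A <+>\<^bsub>free_module R S\<^esub> B = carrier (free_module R S) \<and>
      A \<inter> B = {\<zero>\<^bsub>free_module R S\<^esub>} \<and>
      module_isomorphic R P (free_module R S\<lparr>carrier := A\<rparr>))"

definition fg_ideal :: "('a, 'r) ring_scheme \<Rightarrow> 'a set \<Rightarrow> bool" where
  "fg_ideal R J \<longleftrightarrow> (\<exists>S. finite S \<and> S \<subseteq> carrier R \<and> J = genideal R S)"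

definition hereditary :: "('a, 'r) ring_scheme \<Rightarrow> bool" where
  "hereditary R \<longleftrightarrow> cring R \<and> (\<forall>I. ideal I R \<longrightarrow> projective R (ideal_module R I))"

definition semihereditary :: "('a, 'r) ring_scheme \<Rightarrow> bool" where
  "semihereditary R \<longleftrightarrow> cring R \<and> (\<forall>I. fg_ideal R I \<longrightarrow> projective R (ideal_module R I))"

definition regular_elements :: "('a, 'r) ring_scheme \<Rightarrow> 'a set" where
  "regular_elements R = {s \<in> carrier R. \<forall>a\<in>carrier R. a \<otimes>\<^bsub>R\<^esub> s = \<zero>\<^bsub>R\<^esub> \<longrightarrow> a = \<zero>\<^bsub>R\<^esub>}"

definition frac_rel :: "('a, 'r) ring_scheme \<Rightarrow> (('a \<times> 'a) \<times> ('a \<times> 'a)) set" where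
  "frac_rel R =
    {((a, s), (b, t)). a \<in> carrier R \<and> b \<in> carrier R \<and>
      s \<in> regular_elements R \<and> t \<in> regular_elements R \<and> a \<otimes>\<^bsub>R\<^esub> t = b \<otimes>\<^bsub>R\<^esub> s}"

definition fraction :: "('a, 'r) ring_scheme \<Rightarrow> 'a \<Rightarrow> 'a \<Rightarrow> ('a \<times> 'a) set" where
  "fraction R a s = frac_rel R `` {(a, s)}"

definition total_fractions :: "('a, 'r) ring_scheme \<Rightarrow> ('a \<times> 'a) set ring" where
  "total_fractions R =
    \<lparr>carrier = (carrier R \<times> regular_elements R) // frac_rel R,
     mult = (\<lambda>X Y. \<Union>(a, s)\<in>X. \<Union>(b, t)\<in>Y. fraction R (a \<otimes>\<^bsub>R\<^esub> b) (s \<otimes>\<^bsub>R\<^esub> t)),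
     one = fraction R \<one>\<^bsub>R\<^esub> \<one>\<^bsub>R\<^esub>,
     zero = fraction R \<zero>\<^bsub>R\<^esub> \<one>\<^bsub>R\<^esub>,
     add = (\<lambda>X Y. \<Union>(a, s)\<in>X. \<Union>(b, t)\<in>Y.
              fraction R ((a \<otimes>\<^bsub>R\<^esub> t) \<oplus>\<^bsub>R\<^esub> (b \<otimes>\<^bsub>R\<^esub> s)) (s \<otimes>\<^bsub>R\<^esub> t))\<rparr>"

definition frac_embed :: "('a, 'r) ring_scheme \<Rightarrow> 'a \<Rightarrow> ('a \<times> 'a) set" where
  "frac_embed R a = fraction R a \<one>\<^bsub>R\<^esub>"

definition fractional_ideal :: "('a, 'r) ring_scheme \<Rightarrow> ('a \<times> 'a) set set \<Rightarrow> bool" where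
  "fractional_ideal R N \<longleftrightarrow>
    additive_subgroup N (total_fractions R) \<and>
    (\<forall>a\<in>carrier R. \<forall>x\<in>N. frac_embed R a \<otimes>\<^bsub>total_fractions R\<^esub> x \<in> N) \<and>
    (\<exists>d\<in>regular_elements R. \<forall>x\<in>N.
      frac_embed R d \<otimes>\<^bsub>total_fractions R\<^esub> x \<in> frac_embed R ` carrier R)"

definition invertible_ideal :: "('a, 'r) ring_scheme \<Rightarrow> 'a set \<Rightarrow> bool" where
  "invertible_ideal R I \<longleftrightarrow> ideal I R \<and>
    (\<exists>N. fractional_ideal R N \<and>
      (frac_embed R ` I) \<cdot>\<^bsub>total_fractions R\<^esub> N = frac_embed R ` carrier R)"

definition idem_ring :: "('a, 'r) ring_scheme \<Rightarrow> 'a \<Rightarrow> ('a, 'r) ring_scheme" where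
  "idem_ring R e = R\<lparr>carrier := carrier R #>\<^bsub>R\<^esub> e, one := e\<rparr>"

text \<open>
  Quantification over types being unavailable, the element types of the modules \<open>F\<close> and \<open>M\<close>
  are parameters; a result with free type variables there covers all modules.
  The set in the last line is the submodule
  \<open>I\<^sub>1 J\<^sub>1 \<oplus> \<dots> \<oplus> I\<^sub>m J\<^sub>m\<close> of \<open>J\<^sub>1 \<oplus> \<dots> \<oplus> J\<^sub>n\<close>.
\<close>

definition stacked_bases_property ::
    "'f itself \<Rightarrow> 'm itself \<Rightarrow> ('a, 'r) ring_scheme \<Rightarrow> bool" where
  "stacked_bases_property TF TM R \<longleftrightarrow> semihereditary R \<and>
    (\<forall>(M :: ('a, 'm) module) (F :: ('a, 'f) module) H \<pi>.
      module R M \<and> finitely_presented R M \<and> module R F \<and> fg_free R F \<and>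
      submodule H R F \<and> \<pi> \<in> module_homs R F M \<and> \<pi> ` carrier F = carrier M \<and>
      a_kernel F M \<pi> = H \<longrightarrow>
      (\<exists>(n::nat) (m::nat) J I \<phi>.
        m \<le> n \<and> (\<forall>j\<in>{1..n}. fg_ideal R (J j)) \<and>
        (\<forall>j\<in>{1..m}. invertible_ideal R (I j)) \<and>
        (\<forall>i\<in>{1..m}. \<forall>j\<in>{1..m}. i \<le> j \<longrightarrow> I j \<subseteq> I i) \<and>
        \<phi> \<in> module_iso R F (direct_sum {1..n} (\<lambda>j. ideal_module R (J j))) \<and>
        \<phi> ` H = {x \<in> carrier (direct_sum {1..n} (\<lambda>j. ideal_module R (J j))).
                   \<forall>j\<in>{1..n}. x j \<in> (if j \<le> m then I j \<cdot>\<^bsub>R\<^esub> J j else {\<zero>\<^bsub>R\<^esub>})}))"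

end

theory Submission
  imports "HOL.Modules" Defs "HOL-Library.Function_Algebras" "HOL-Library.Product_Plus"
    "HOL-Library.Infinite_Set"
begin

text \<open>
  Over a hereditary ring every annihilator of an element is generated by an idempotent, and every
  ideal containing a regular element \<open>d\<close> is invertible. The latter makes \<open>R/dR\<close> a ring in
  which each element has a power generated by the next one, so unimodular rows and matrices
  modulo \<open>d\<close> can be shortened by elementary operations, using idempotents modulo \<open>d\<close>.

  Let \<open>H\<close> be a finitely generated submodule of a free module. Its purification splits off, so
  assume \<open>d G \<subseteq> H \<subseteq> G\<close> with \<open>d\<close> regular. Let \<open>I\<close> be the ideal generated by \<open>d\<close> and all values of
  functionals on \<open>H\<close>. Since \<open>I\<close> is invertible, \<open>H = I H\<^sub>1\<close> where \<open>H\<^sub>1 = (H : I)\<close>, and the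
  values of functionals on \<open>H\<^sub>1\<close> are unimodular modulo \<open>d\<close> on the support of \<open>G\<close>; hence there is a
  single functional \<open>f\<close> with \<open>f(H\<^sub>1) = f(G)\<close>. A section of \<open>f\<close> with values in \<open>H\<^sub>1\<close> splits
  \<open>f(G)\<close> off \<open>G\<close> and \<open>I f(G)\<close> off \<open>H\<close>, and one continues with the kernel of \<open>f\<close>.

  In the resulting decompositions the supports of the ideals decrease. So the torsion
  part is a sum of modules \<open>J/IJ\<close>, which are cyclic because \<open>J\<close> can be made coprime to \<open>d\<close>, and the
  differences of consecutive supports are the idempotents of the torsion-free part.
\<close>

section \<open>Prime ideals and regular elements\<close>

text \<open>A hereditary ring may have infinitely many idempotents (every countable von Neumann
  regular ring is hereditary), so it need not be a finite product of Dedekind domains, and the rank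
  of a projective module varies over the spectrum. Hence supports: the idempotent with the same
  annihilator as an element. Filling up its complement turns a finitely generated ideal into one
  that contains a regular element, and only such ideals are invertible.

  Finiteness is recovered modulo a regular \<open>d\<close>: the ideals containing \<open>d\<close>
  are finitely generated, and I -> (dR : I) is an inclusion-reversing involution on them, so they
  satisfy both chain conditions. Zero sets in the spectrum of R/dR are thus open and closed, and
  choices made prime by prime are glued along idempotents.

  The section of f exists because f(G) is finitely generated, hence projective; f(G) need not be
  free, which is why the ideals J_j appear. The content ideal can only shrink on the kernel of f,
  since functionals on a summand extend to the whole module; this gives the chain of the
  I_j.\<close>

lemma module_mult: "Modules.module ((*) :: 'a::comm_ring_1 \<Rightarrow> 'a \<Rightarrow> 'a)"
  by standard (auto simp: algebra_simps)

abbreviation rideal :: "'a::comm_ring_1 set \<Rightarrow> bool" where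
  "rideal \<equiv> Modules.module.subspace (*)"

abbreviation rspan :: "'a::comm_ring_1 set \<Rightarrow> 'a set" where
  "rspan \<equiv> Modules.module.span (*)"

lemmas rideal_def = Modules.module.subspace_def[OF module_mult]
lemmas rideal_0 = Modules.module.subspace_0[OF module_mult]
lemmas rideal_add = Modules.module.subspace_add[OF module_mult]
lemmas rideal_diff = Modules.module.subspace_diff[OF module_mult]
lemmas rideal_neg = Modules.module.subspace_neg[OF module_mult]
lemmas rideal_mult = Modules.module.subspace_scale[OF module_mult]
lemmas rideal_sum = Modules.module.subspace_sum[OF module_mult]
lemmas rideal_span = Modules.module.subspace_span[OF module_mult]

lemma rideal_mult_right: "rideal I \<Longrightarrow> x \<in> I \<Longrightarrow> x * c \<in> I"
  using rideal_mult[of I x c] by (simp add: mult.commute)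

lemma rideal_principal: "rideal {c * a | c. True}"
  unfolding rideal_def
proof (intro conjI ballI allI)
  show "0 \<in> {c * a | c. True}" by (intro CollectI exI[of _ 0]) simp
  show "x + y \<in> {c * a | c. True}" if "x \<in> {c * a | c. True}" "y \<in> {c * a | c. True}" for x y
    using that by (auto simp flip: distrib_right)
  show "k * x \<in> {c * a | c. True}" if "x \<in> {c * a | c. True}" for k x
    using that by (auto simp flip: mult.assoc)
qed

lemma rideal_adjoin:
  assumes W: "rideal W"
  shows "rideal {w + c * x | w c. w \<in> W}"
  unfolding rideal_def
proof (intro conjI ballI allI)
  have "0 = 0 + 0 * x" by simp
  then show "0 \<in> {w + c * x | w c. w \<in> W}" using rideal_0[OF W] by blast
next
  fix y z assume "y \<in> {w + c * x | w c. w \<in> W}" "z \<in> {w + c * x | w c. w \<in> W}"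
  then obtain m c m' c' where "y = m + c * x" "z = m' + c' * x" "m \<in> W" "m' \<in> W" by blast
  then have "y + z = (m + m') + (c + c') * x" "m + m' \<in> W"
    using rideal_add[OF W] by (auto simp: algebra_simps)
  then show "y + z \<in> {w + c * x | w c. w \<in> W}" by blast
next
  fix k y assume "y \<in> {w + c * x | w c. w \<in> W}"
  then obtain m c where "y = m + c * x" "m \<in> W" by blast
  then have "k * y = k * m + (k * c) * x" "k * m \<in> W"
    using rideal_mult[OF W, of m k] by (simp_all add: algebra_simps)
  then show "k * y \<in> {w + c * x | w c. w \<in> W}" by blast
qed

lemma rideal_adjoin_mem:
  assumes "rideal W"
  shows "w \<in> W \<Longrightarrow> w \<in> {w + c * x | w c. w \<in> W}" and "x \<in> {w + c * x | w c. w \<in> W}"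
proof -
  show "w \<in> {w + c * x | w c. w \<in> W}" if "w \<in> W"
    using that by (intro CollectI exI[of _ w] exI[of _ 0]) simp
  show "x \<in> {w + c * x | w c. w \<in> W}"
    using rideal_0[OF assms] by (intro CollectI exI[of _ 0] exI[of _ 1]) simp
qed

definition prime_rideal :: "'a::comm_ring_1 set \<Rightarrow> bool" where
  "prime_rideal P \<longleftrightarrow> rideal P \<and> 1 \<notin> P \<and> (\<forall>x y. x * y \<in> P \<longrightarrow> x \<in> P \<or> y \<in> P)"

text \<open>Unimodularity is tested on prime ideals: an ideal that lies in none of them contains 1.
  The prime is a maximal member among the proper ideals above \<open>A\<close>.\<close>

lemma prime_rideal_exists:
  fixes A :: "'a::comm_ring_1 set"
  assumes A: "rideal A" "1 \<notin> A"
  shows "\<exists>P. prime_rideal P \<and> A \<subseteq> P"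
proof -
  let ?S = "{I. rideal I \<and> A \<subseteq> I \<and> 1 \<notin> I}"
  have "\<exists>M\<in>?S. \<forall>X\<in>?S. M \<subseteq> X \<longrightarrow> X = M"
  proof (rule subset_Zorn_nonempty)
    show "?S \<noteq> {}" using A by blast
    fix C assume ne: "C \<noteq> {}" and ch: "subset.chain ?S C"
    then obtain I0 where I0: "I0 \<in> C" by blast
    have C: "\<And>I. I \<in> C \<Longrightarrow> rideal I \<and> A \<subseteq> I \<and> 1 \<notin> I"
      using ch by (auto simp: subset_chain_def)
    have "x + y \<in> \<Union>C" if xy: "x \<in> \<Union>C" "y \<in> \<Union>C" for x y
    proof -
      obtain I J where IJ: "I \<in> C" "x \<in> I" "J \<in> C" "y \<in> J" using xy by blast
      then have "I \<subseteq> J \<or> J \<subseteq> I" using ch by (auto simp: subset_chain_def)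
      then obtain K where "K \<in> C" "x \<in> K" "y \<in> K" using IJ by blast
      then show ?thesis using rideal_add[of K x y] C by blast
    qed
    moreover have "c * x \<in> \<Union>C" if "x \<in> \<Union>C" for c x
      using that C rideal_mult by blast
    moreover have "0 \<in> \<Union>C" using I0 C rideal_0 by blast
    ultimately have "rideal (\<Union>C)" by (simp add: rideal_def)
    then show "\<Union>C \<in> ?S" using C I0 by blast
  qed
  then obtain M where MS: "M \<in> ?S" and mx: "\<forall>X\<in>?S. M \<subseteq> X \<longrightarrow> X = M" ..
  from MS have M: "rideal M" "A \<subseteq> M" "1 \<notin> M" by simp_all
  have max: "X = M" if "rideal X" "A \<subseteq> X" "1 \<notin> X" "M \<subseteq> X" for X
    using mx that by simp
  \<comment> \<open>Maximality: adjoining any outside element to \<open>M\<close> gives the whole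
    ring. Multiplying two such equations contradicts \<open>x * y\<close> being in
    \<open>M\<close>.\<close>
  have comax: "\<exists>m c. m \<in> M \<and> 1 = m + c * x" if x: "x \<notin> M" for x
  proof (rule ccontr)
    assume no: "\<not> ?thesis"
    let ?X = "{m + c * x | m c. m \<in> M}"
    have "rideal ?X" by (rule rideal_adjoin[OF M(1)])
    moreover have "M \<subseteq> ?X" "x \<in> ?X" using rideal_adjoin_mem[OF M(1)] by blast+
    moreover have "1 \<notin> ?X" using no by blast
    ultimately have "x \<in> M" using max[of ?X] M(2) by blast
    then show False using x by blast
  qed
  have "x \<in> M \<or> y \<in> M" if xy: "x * y \<in> M" for x y
  proof (rule ccontr)
    assume "\<not> ?thesis"
    then obtain m c m' c' where m: "m \<in> M" "1 = m + c * x" "m' \<in> M" "1 = m' + c' * y"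
      using comax by meson
    have "1 = (m + c * x) * (m' + c' * y)" using m by simp
    also have "\<dots> = (m' + c' * y) * m + (c * x) * m' + (c * c') * (x * y)"
      by (simp add: algebra_simps)
    also have "\<dots> \<in> M"
      by (intro rideal_add[OF M(1)] rideal_mult[OF M(1)] m xy)
    finally show False using M by blast
  qed
  then have "prime_rideal M" using M by (simp add: prime_rideal_def)
  then show ?thesis using M by blast
qed

section \<open>Regular elements and supports\<close>

definition nzd :: "'a::comm_ring_1 \<Rightarrow> bool" where
  "nzd d \<longleftrightarrow> (\<forall>r. r * d = 0 \<longrightarrow> r = 0)"

lemma nzdD: "nzd d \<Longrightarrow> r * d = 0 \<Longrightarrow> r = 0"
  unfolding nzd_def by blast

lemma nzd_cancel: "nzd d \<Longrightarrow> d * x = d * y \<Longrightarrow> x = y"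
  unfolding nzd_def by (metis eq_iff_diff_eq_0 mult.commute right_diff_distrib)

text \<open>\<open>p\<close> is the idempotent with the same annihilator as \<open>a\<close>: the
  converse inclusion follows from \<open>p * a = a\<close>. So \<open>a\<close> and \<open>p\<close>
  generate isomorphic ideals.\<close>

definition is_supp :: "'a::comm_ring_1 \<Rightarrow> 'a \<Rightarrow> bool" where
  "is_supp p a \<longleftrightarrow> p * p = p \<and> p * a = a \<and> (\<forall>r. r * a = 0 \<longrightarrow> r * p = 0)"

text \<open>The dual basis formula with denominators cleared: x is the sum of the a_i (b_i / d) x,
  which can be checked after multiplication by the regular \<open>d\<close>.\<close>

lemma dual_expand:
  fixes d :: "'a::comm_ring_1"
  assumes "nzd d" "(\<Sum>i<N. a i * b i) = d" "\<And>i. i < N \<Longrightarrow> b i * x = d * t i"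
  shows "x = (\<Sum>i<N. a i * t i)"
proof (rule nzd_cancel[OF assms(1)])
  have "d * x = (\<Sum>i<N. a i * b i) * x" using assms(2) by simp
  also have "\<dots> = (\<Sum>i<N. a i * (b i * x))" by (simp add: sum_distrib_right mult.assoc)
  also have "\<dots> = (\<Sum>i<N. a i * (d * t i))" using assms(3) by simp
  also have "\<dots> = d * (\<Sum>i<N. a i * t i)" by (simp add: sum_distrib_left algebra_simps)
  finally show "d * x = d * (\<Sum>i<N. a i * t i)" .
qed

text \<open>
  The ring under consideration is the corner \<open>e T\<close> of the ring \<open>T\<close> formed by a whole type. A regular
  element of \<open>e T\<close> is completed by \<open>1 - e\<close> to one of \<open>T\<close>, so that ideals of \<open>T\<close> containing it
  contain \<open>1 - e\<close>.
\<close>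

locale corner =
  fixes e :: "'a::comm_ring_1"
  assumes e_idem: "e * e = e"
begin

definition regular :: "'a \<Rightarrow> bool" where
  "regular d \<longleftrightarrow> nzd d \<and> (1 - e) * d = 1 - e"

lemma regular_nzd: "regular d \<Longrightarrow> nzd d" by (simp add: regular_def)

lemma regular_1: "regular 1" by (simp add: regular_def nzd_def)

lemma regular_mult:
  assumes c: "regular c" and d: "regular d"
  shows "regular (c * d)"
proof -
  have "r = 0" if "r * (c * d) = 0" for r
  proof -
    have "(r * c) * d = 0" using that by (simp add: mult.assoc)
    then show ?thesis using c d nzdD unfolding regular_def by blast
  qed
  moreover have "(1 - e) * (c * d) = 1 - e"
    using c d by (simp add: regular_def flip: mult.assoc)
  ultimately show ?thesis unfolding regular_def nzd_def by blast
qed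

text \<open>\<open>a\<close> is faithful where \<open>p\<close> is 1, and the summand
  \<open>1 - p\<close> is faithful where \<open>p\<close> is 0. This is the way to get a regular
  element out of any element that has a support.\<close>

lemma regular_supp:
  assumes "is_supp p a" "e * p = p"
  shows "regular (a + (1 - p))"
proof -
  have "r = 0" if r: "r * (a + (1 - p)) = 0" for r
  proof -
    have pq: "p * p = p" "p * a = a" using assms(1) by (simp_all add: is_supp_def)
    have "p * (r * (a + (1 - p))) = r * (p * a) + r * p - r * (p * p)"
      by (simp add: algebra_simps)
    then have "r * a = p * (r * (a + (1 - p)))" using pq by simp
    then have "r * a = 0" using r by simp
    then have "r * p = 0" using assms(1) by (simp add: is_supp_def)
    then show "r = 0" using r \<open>r * a = 0\<close> by (simp add: algebra_simps)
  qed
  moreover have "e * a = a" using assms unfolding is_supp_def by (metis mult.assoc)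
  then have "(1 - e) * (a + (1 - p)) = 1 - e"
    using assms(2) by (simp add: left_diff_distrib right_diff_distrib distrib_left)
  ultimately show ?thesis unfolding regular_def nzd_def by blast
qed

end

text \<open>The two consequences of heredity on which everything up to the embedding rests.
  \<open>inv\<close> expresses invertibility without fractions: the \<open>b i / d\<close> lie in
  the inverse of the ideal, and the sum of the \<open>a i * (b i / d)\<close> is 1.\<close>

locale hereditary_corner = corner +
  assumes pp: "e * a = a \<Longrightarrow> \<exists>p. e * p = p \<and> is_supp p a"
    and inv: "rideal I \<Longrightarrow> d \<in> I \<Longrightarrow> regular d \<Longrightarrow>
      \<exists>(N::nat) a b. (\<forall>i<N. a i \<in> I) \<and> (\<forall>i<N. \<forall>x\<in>I. d dvd b i * x) \<and> (\<Sum>i<N. a i * b i) = d"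
begin

lemma invE:
  assumes "rideal I" "d \<in> I" "regular d"
  obtains N :: nat and a b where "\<And>i. i < N \<Longrightarrow> a i \<in> I"
    "\<And>i x. i < N \<Longrightarrow> x \<in> I \<Longrightarrow> d dvd b i * x" "(\<Sum>i<N. a i * b i) = d"
proof -
  obtain N :: nat and a b where "(\<forall>i<N. a i \<in> I) \<and> (\<forall>i<N. \<forall>x\<in>I. d dvd b i * x) \<and> (\<Sum>i<N. a i * b i) = d"
    using inv[OF assms] by (elim exE)
  then show ?thesis using that[of N a b] by simp
qed

text \<open>
  The ideals \<open>(dT : a\<^sup>nT + dT)\<close> increase, and their union is finitely generated; by duality the
  ideals \<open>a\<^sup>nT + dT\<close> become stationary.
\<close>

lemma pi_regular:
  assumes d: "regular d"
  shows "\<exists>n x. d dvd a ^ n - a ^ Suc n * x"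
proof -
  define B where "B n = {b. d dvd b * a ^ n}" for n
  note nz = regular_nzd[OF d]
  have B: "rideal (B n)" for n
    by (auto simp: rideal_def B_def algebra_simps dvd_mult)
  have mono: "B m \<subseteq> B n" if "m \<le> n" for m n
  proof
    fix b assume "b \<in> B m"
    then have "d dvd (b * a ^ m) * a ^ (n - m)" by (simp add: B_def)
    also have "(b * a ^ m) * a ^ (n - m) = b * a ^ n"
      using that by (simp add: mult.assoc flip: power_add)
    finally show "b \<in> B n" by (simp add: B_def)
  qed
  have U: "rideal (\<Union>n. B n)"
    unfolding rideal_def
  proof (intro conjI ballI allI)
    show "0 \<in> (\<Union>n. B n)" by (auto simp: B_def)
    fix x y assume "x \<in> (\<Union>n. B n)" "y \<in> (\<Union>n. B n)"
    then obtain m n where "x \<in> B m" "y \<in> B n" by blast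
    then have "x \<in> B (max m n)" "y \<in> B (max m n)"
      using mono[of m "max m n"] mono[of n "max m n"] by auto
    then show "x + y \<in> (\<Union>n. B n)" using rideal_add[OF B] by blast
  next
    fix c x assume "x \<in> (\<Union>n. B n)"
    then show "c * x \<in> (\<Union>n. B n)" using rideal_mult[OF B] by blast
  qed
  have dU: "d \<in> (\<Union>n. B n)" by (auto simp: B_def)
  obtain N :: nat and u v where uv: "\<And>i. i < N \<Longrightarrow> u i \<in> (\<Union>n. B n)"
      "\<And>i x. i < N \<Longrightarrow> x \<in> (\<Union>n. B n) \<Longrightarrow> d dvd v i * x" "(\<Sum>i<N. u i * v i) = d"
    by (rule invE[OF U dU d]) blast
  \<comment> \<open>The union has finitely many generators, so they already lie in one member
    \<open>B n\<close>; the sum of the indices serves as a common upper bound.\<close>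
  from uv(1) have "\<forall>i\<in>{..<N}. \<exists>k. u i \<in> B k" by simp
  from bchoice[OF this] obtain k where k: "\<And>i. i < N \<Longrightarrow> u i \<in> B (k i)" by auto
  define n where "n = (\<Sum>i<N. k i)"
  have un: "u i \<in> B n" if "i < N" for i
    using k[OF that] mono[of "k i" n] that member_le_sum[of i "{..<N}" k] by (auto simp: n_def)
  have stab: "B m \<subseteq> B n" for m
  proof
    fix x assume "x \<in> B m"
    then have "\<forall>i<N. \<exists>t. v i * x = d * t" using uv(2) by (blast elim: dvdE)
    then obtain t where "\<And>i. i < N \<Longrightarrow> v i * x = d * t i" by metis
    from dual_expand[OF nz uv(3) this] have "x = (\<Sum>i<N. u i * t i)" by blast
    then show "x \<in> B n" using un by (auto intro!: rideal_sum[OF B] rideal_mult_right[OF B])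
  qed
  define A where "A = {w + c * d | w c. w \<in> {c * a ^ Suc n | c. True}}"
  have A: "rideal A" unfolding A_def by (intro rideal_adjoin rideal_principal)
  have "a ^ Suc n \<in> {c * a ^ Suc n | c. True}" by (intro CollectI exI[of _ 1]) simp
  then have aA: "a ^ Suc n \<in> A" unfolding A_def by (rule rideal_adjoin_mem(1)[OF rideal_principal])
  have dA: "d \<in> A" unfolding A_def by (rule rideal_adjoin_mem(2)[OF rideal_principal])
  obtain M :: nat and u' v' where uv': "\<And>i. i < M \<Longrightarrow> u' i \<in> A"
      "\<And>i x. i < M \<Longrightarrow> x \<in> A \<Longrightarrow> d dvd v' i * x" "(\<Sum>i<M. u' i * v' i) = d"
    by (rule invE[OF A dA d]) blast
  \<comment> \<open>\<open>v' i\<close> kills \<open>a ^ Suc n\<close> modulo \<open>d\<close>, so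
    it lies in \<open>B (Suc n)\<close> and, by stationarity, in \<open>B n\<close>. Thus it also
    kills \<open>a ^ n\<close>, and the dual expansion writes \<open>a ^ n\<close> in terms of the
    generators of \<open>A\<close>.\<close>
  have "v' i \<in> B n" if "i < M" for i
    using uv'(2)[OF that aA] stab[of "Suc n"] unfolding B_def by blast
  then have "\<forall>i<M. \<exists>t. v' i * a ^ n = d * t" by (auto simp: B_def elim: dvdE)
  then obtain t where "\<And>i. i < M \<Longrightarrow> v' i * a ^ n = d * t i" by metis
  from dual_expand[OF nz uv'(3) this] have "a ^ n = (\<Sum>i<M. u' i * t i)" by blast
  then have "a ^ n \<in> A" using uv'(1) by (auto intro!: rideal_sum[OF A] rideal_mult_right[OF A])
  then obtain x y where "a ^ n = x * a ^ Suc n + y * d" unfolding A_def by blast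
  then have "a ^ n - a ^ Suc n * x = d * y" by (simp add: algebra_simps)
  then show ?thesis by (metis dvd_triv_left)
qed

text \<open>Modulo \<open>d\<close> the zero set of \<open>a\<close> is open as well as closed.
  Since a^m = a^m (a x)^k modulo \<open>d\<close> for every k, the element
  \<open>(a * x) ^ m\<close> is idempotent modulo \<open>d\<close> and generates the same ideal
  there as \<open>a ^ m\<close>.\<close>

lemma idem_mod:
  assumes d: "regular d"
  shows "\<exists>q. d dvd q * q - q \<and> (\<forall>P. prime_rideal P \<longrightarrow> d \<in> P \<longrightarrow> (a \<in> P \<longleftrightarrow> q \<in> P))"
proof -
  obtain n x where "d dvd a ^ n - a ^ Suc n * x" using pi_regular[OF d] by blast
  \<comment> \<open>The exponent is raised by one to be positive, so that \<open>q\<close> is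
    visibly a multiple of \<open>a\<close>.\<close>
  then have "d dvd (a ^ n - a ^ Suc n * x) * a" by simp
  then have nx: "d dvd a ^ Suc n - a ^ Suc n * (a * x)" by (simp add: algebra_simps)
  define m where "m = Suc n"
  have step: "d dvd a ^ m - a ^ m * (a * x) ^ k" for k
  proof (induction k)
    case (Suc k)
    have "a ^ m - a ^ m * (a * x) ^ Suc k
        = (a ^ m - a ^ m * (a * x) ^ k) + (a ^ m - a ^ m * (a * x)) * (a * x) ^ k"
      by (simp add: algebra_simps)
    then show ?case using Suc nx unfolding m_def[symmetric] by (metis dvd_add dvd_mult2)
  qed simp
  define q where "q = (a * x) ^ m"
  have qa: "d dvd a ^ m - a ^ m * q" using step unfolding q_def .
  have "q * q - q = - (a ^ m - a ^ m * q) * x ^ m"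
    by (simp add: q_def power_mult_distrib algebra_simps)
  then have "d dvd q * q - q" using qa by (metis dvd_minus_iff dvd_mult2)
  moreover have "a \<in> P \<longleftrightarrow> q \<in> P" if P: "prime_rideal P" "d \<in> P" for P
  proof
    have idl: "rideal P" using P by (simp add: prime_rideal_def)
    { assume "a \<in> P"
      moreover have "q = (a ^ n * x ^ m) * a"
        by (simp add: q_def m_def power_mult_distrib algebra_simps)
      ultimately show "q \<in> P" using rideal_mult[OF idl] by metis }
    assume q: "q \<in> P"
    obtain c where c: "a ^ m - a ^ m * q = d * c" using qa by blast
    have "a ^ m = c * d + a ^ m * q" using c by (simp add: algebra_simps)
    then have "a ^ m \<in> P" using rideal_add[OF idl] rideal_mult[OF idl] P q by metis
    then show "a \<in> P"
    proof (induction m)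
      case 0 then show ?case using P by (simp add: prime_rideal_def)
    next
      case (Suc m) then show ?case using P by (auto simp: prime_rideal_def)
    qed
  qed
  ultimately show ?thesis by blast
qed


text \<open>A new row is added with a coefficient that vanishes where the combination so far is
  nonzero and is nonzero where it vanishes, so nothing can cancel. The normalisation
  \<open>r 0 = 1\<close> makes the result an elementary operation on row 0: the old row can be
  recovered from the new one and the others.\<close>

lemma prime_avoid:
  fixes v :: "nat \<Rightarrow> nat \<Rightarrow> 'a"
  assumes d: "regular d"
  shows "\<exists>r. r 0 = 1 \<and> (\<forall>P. prime_rideal P \<longrightarrow> d \<in> P \<longrightarrow>
    (\<forall>i<n. (\<Sum>j\<le>m. r j * v j i) \<in> P) \<longrightarrow> (\<forall>j\<le>m. \<forall>i<n. v j i \<in> P))"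
proof (induction m)
  case 0
  show ?case by (rule exI[of _ "\<lambda>_. 1"]) simp
next
  case (Suc m)
  then obtain r where r0: "r 0 = 1" and r: "\<forall>P. prime_rideal P \<longrightarrow> d \<in> P \<longrightarrow>
      (\<forall>i<n. (\<Sum>j\<le>m. r j * v j i) \<in> P) \<longrightarrow> (\<forall>j\<le>m. \<forall>i<n. v j i \<in> P)" by blast
  define w where "w i = (\<Sum>j\<le>m. r j * v j i)" for i
  have "\<forall>i. \<exists>q. d dvd q * q - q \<and> (\<forall>P. prime_rideal P \<longrightarrow> d \<in> P \<longrightarrow> (w i \<in> P \<longleftrightarrow> q \<in> P))"
    using idem_mod[OF d] by (rule allI)
  from choice[OF this] obtain q where q: "\<And>i. d dvd q i * q i - q i"
      "\<And>i P. prime_rideal P \<Longrightarrow> d \<in> P \<Longrightarrow> w i \<in> P \<longleftrightarrow> q i \<in> P"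
    by auto
  \<comment> \<open>A product of idempotents modulo \<open>d\<close>: it lies in \<open>P\<close> as
    soon as one entry \<open>w i\<close> does not, and stays outside \<open>P\<close> if all of them
    are in \<open>P\<close>.\<close>
  define z where "z = (\<Prod>i<n. 1 - q i)"
  define r' where "r' = r(Suc m := z)"
  have z_in: "z \<in> P" if P: "prime_rideal P" "d \<in> P" and i: "i < n" "w i \<notin> P" for P i
  proof -
    have idl: "rideal P" using P by (simp add: prime_rideal_def)
    obtain c where "q i * q i - q i = d * c" using q(1) by blast
    then have "q i * (1 - q i) = - c * d" by (simp add: algebra_simps)
    then have "q i * (1 - q i) \<in> P" using rideal_mult[OF idl P(2), of "- c"] by simp
    then have "1 - q i \<in> P" using P q(2)[of P i] i by (auto simp: prime_rideal_def)
    moreover have "z = (\<Prod>i\<in>{..<n} - {i}. 1 - q i) * (1 - q i)"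
      unfolding z_def using i by (subst prod.remove[of _ i]) (auto simp: mult.commute)
    ultimately show ?thesis using rideal_mult[OF idl] by simp
  qed
  have z_notin: "z \<notin> P" if P: "prime_rideal P" "d \<in> P" and w: "\<forall>i<n. w i \<in> P" for P
  proof -
    have idl: "rideal P" using P by (simp add: prime_rideal_def)
    have f: "1 - q i \<notin> P" if "i < n" for i
    proof
      assume "1 - q i \<in> P"
      then have "(1 - q i) + q i \<in> P" using rideal_add[OF idl] q(2)[OF P] w that by blast
      then show False using P by (simp add: prime_rideal_def)
    qed
    have "(\<Prod>i<k. 1 - q i) \<notin> P" if "k \<le> n" for k
      using that
    proof (induction k)
      case 0 then show ?case using P by (simp add: prime_rideal_def)
    next
      case (Suc k)
      then show ?case using f[of k] P by (auto simp: prime_rideal_def)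
    qed
    then show ?thesis by (simp add: z_def)
  qed
  have sum': "(\<Sum>j\<le>Suc m. r' j * v j i) = w i + z * v (Suc m) i" for i
    by (simp add: r'_def w_def)
  have "v j i \<in> P" if P: "prime_rideal P" "d \<in> P" and a: "\<forall>i<n. (\<Sum>j\<le>Suc m. r' j * v j i) \<in> P"
    and ji: "j \<le> Suc m" "i < n" for P j i
  proof -
    have idl: "rideal P" using P by (simp add: prime_rideal_def)
    have b: "w i + z * v (Suc m) i \<in> P" if "i < n" for i using a that by (simp only: sum')
    have nz: "z \<notin> P"
    proof
      assume "z \<in> P"
      then have "(w i + z * v (Suc m) i) - z * v (Suc m) i \<in> P" if "i < n" for i
        by (intro rideal_diff[OF idl] b that rideal_mult_right[OF idl])
      then have "\<forall>i<n. w i \<in> P" by simp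
      then show False using z_notin P \<open>z \<in> P\<close> by blast
    qed
    then have wP: "\<forall>i<n. w i \<in> P" using z_in P by blast
    then have "(w i + z * v (Suc m) i) - w i \<in> P"
      using b ji by (intro rideal_diff[OF idl]) auto
    then have "v (Suc m) i \<in> P" using P nz by (auto simp: prime_rideal_def)
    then show ?thesis using r[rule_format, OF P, of j i] wP ji by (cases "j = Suc m") (auto simp: w_def)
  qed
  moreover have "r' 0 = 1" by (simp add: r'_def r0)
  ultimately show ?case by blast
qed

text \<open>Rows are combined first, then columns. In the applications rows belong to elements and
  columns to functionals, so the outcome is one functional and one element whose pairing generates
  \<open>p\<close> modulo \<open>d\<close>; \<open>c 0 = 1\<close> lets the remaining coordinates
  describe the kernel of that functional.\<close>

lemma bilinear_unimodular:
  fixes M :: "nat \<Rightarrow> nat \<Rightarrow> 'a"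
  assumes d: "regular d" and p: "p * p = p"
    and pM: "\<And>j i. j \<le> m \<Longrightarrow> i \<le> n \<Longrightarrow> p * M j i = M j i"
    and prime: "\<And>P. prime_rideal P \<Longrightarrow> d \<in> P \<Longrightarrow> (\<forall>j\<le>m. \<forall>i\<le>n. M j i \<in> P) \<Longrightarrow> p \<in> P"
  shows "\<exists>r c u t. c 0 = 1 \<and> (\<Sum>j\<le>m. \<Sum>i\<le>n. r j * c i * M j i) * u = p + d * t"
proof -
  obtain r where r: "\<And>P. prime_rideal P \<Longrightarrow> d \<in> P \<Longrightarrow>
      (\<forall>i<Suc n. (\<Sum>j\<le>m. r j * M j i) \<in> P) \<Longrightarrow> (\<forall>j\<le>m. \<forall>i<Suc n. M j i \<in> P)"
    using prime_avoid[OF d, where n = "Suc n" and m = m and v = M] by blast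
  define w where "w i = (\<Sum>j\<le>m. r j * M j i)" for i
  \<comment> \<open>Adding \<open>1 - p\<close> to one entry removes the support from the problem:
    \<open>w'\<close> is to be unimodular modulo \<open>d\<close> on the whole ring. As
    \<open>c 0 = 1\<close>, the addition enters \<open>s\<close> unchanged, and a factor
    \<open>p\<close> removes it again.\<close>
  define w' where "w' i = (if i = 0 then w 0 + (1 - p) else w i)" for i :: nat
  obtain c where c0: "c 0 = 1" and c: "\<And>P. prime_rideal P \<Longrightarrow> d \<in> P \<Longrightarrow>
      (\<forall>i<Suc 0. (\<Sum>j\<le>n. c j * w' j) \<in> P) \<Longrightarrow> (\<forall>j\<le>n. \<forall>i<Suc 0. w' j \<in> P)"
    using prime_avoid[OF d, where n = "Suc 0" and m = n and v = "\<lambda>j i. w' j"] by auto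
  have pw: "p * w i = w i" if "i \<le> n" for i
    using pM that by (simp add: w_def sum_distrib_left mult.left_commute[of p])
  define s where "s = (\<Sum>i\<le>n. c i * w' i)"
  have s: "s = (\<Sum>i\<le>n. c i * w i) + (1 - p)"
    unfolding s_def by (subst (1 2) sum.atMost_shift) (simp add: w'_def c0)
  define A where "A = {w + c * d | w c. w \<in> {c * s | c. True}}"
  have A: "rideal A" unfolding A_def by (intro rideal_adjoin rideal_principal)
  have "1 \<in> A"
  proof (rule ccontr)
    assume "1 \<notin> A"
    then obtain P where P: "prime_rideal P" "A \<subseteq> P" using prime_rideal_exists[OF A] by blast
    have idl: "rideal P" using P by (simp add: prime_rideal_def)
    have "s \<in> {c * s | c. True}" by (intro CollectI exI[of _ 1]) simp
    then have "s \<in> A" unfolding A_def by (rule rideal_adjoin_mem(1)[OF rideal_principal])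
    moreover have "d \<in> A" unfolding A_def by (rule rideal_adjoin_mem(2)[OF rideal_principal])
    ultimately have sP: "s \<in> P" and dP: "d \<in> P" using P(2) by blast+
    have w': "w' i \<in> P" if "i \<le> n" for i
      using c[OF P(1) dP] sP that by (simp add: s_def)
    \<comment> \<open>A prime contains \<open>p\<close> or \<open>1 - p\<close>. In the first case
      it contains \<open>w 0\<close>, hence \<open>1 - p\<close> too; in the second all
      \<open>w i\<close>, hence all entries of \<open>M\<close>, hence \<open>p\<close> too.\<close>
    have "p \<notin> P"
    proof
      assume pP: "p \<in> P"
      have "p * w 0 = w 0" by (simp add: pw)
      then have "w 0 \<in> P" using rideal_mult_right[OF idl pP, of "w 0"] by simp
      then have "(w' 0 - w 0) + p \<in> P" using w'[of 0] pP by (intro rideal_add rideal_diff idl) auto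
      then show False using P by (simp add: w'_def prime_rideal_def)
    qed
    moreover have "p * (1 - p) = 0" using p by (simp add: right_diff_distrib)
    ultimately have p1: "1 - p \<in> P" using P rideal_0[OF idl] by (metis prime_rideal_def)
    have "w i \<in> P" if i: "i \<le> n" for i
    proof (cases "i = 0")
      case True
      have "w' 0 - (1 - p) \<in> P" using rideal_diff[OF idl _ p1] w'[of 0] by blast
      then show ?thesis using True by (simp add: w'_def)
    qed (use w'[OF i] in \<open>simp add: w'_def\<close>)
    then have "\<forall>j\<le>m. \<forall>i<Suc n. M j i \<in> P" using r[OF P(1) dP] by (auto simp: w_def)
    then show False using prime[OF P(1) dP] \<open>p \<notin> P\<close> by auto
  qed
  then obtain x y where "1 = x * s + y * d" unfolding A_def by blast
  then have xy: "1 = s * x + d * y" by (simp add: mult.commute)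
  have ps: "p * s = (\<Sum>i\<le>n. c i * w i)"
    using pw p by (simp add: s distrib_left right_diff_distrib sum_distrib_left mult.left_commute[of p])
  have E: "(\<Sum>j\<le>m. \<Sum>i\<le>n. r j * c i * M j i) = (\<Sum>i\<le>n. c i * w i)"
    by (subst sum.swap) (simp add: w_def sum_distrib_left mult_ac)
  have "(\<Sum>j\<le>m. \<Sum>i\<le>n. r j * c i * M j i) * x = (p * s) * x" by (simp only: E ps)
  also have "\<dots> = p * (s * x + d * y) + d * (- p * y)" by (simp add: algebra_simps)
  finally have "(\<Sum>j\<le>m. \<Sum>i\<le>n. r j * c i * M j i) * x = p * (s * x + d * y) + d * (- p * y)" .
  then have "(\<Sum>j\<le>m. \<Sum>i\<le>n. r j * c i * M j i) * x = p + d * (- p * y)"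
    using xy by simp
  then show ?thesis using c0 by blast
qed

end

section \<open>Linear maps and dual bases\<close>

text \<open>Linearity is required only on \<open>G\<close>: submodules are sets within one type, and
  a total function has arbitrary values outside.\<close>

definition lin_on :: "('a::comm_ring_1 \<Rightarrow> 'v::ab_group_add \<Rightarrow> 'v) \<Rightarrow> ('a \<Rightarrow> 'w::ab_group_add \<Rightarrow> 'w)
    \<Rightarrow> 'v set \<Rightarrow> ('v \<Rightarrow> 'w) \<Rightarrow> bool" where
  "lin_on s t G f \<longleftrightarrow> (\<forall>x\<in>G. \<forall>y\<in>G. f (x + y) = f x + f y) \<and> (\<forall>c. \<forall>x\<in>G. f (s c x) = t c (f x))"

lemma lin_onI:
  "(\<And>x y. x \<in> G \<Longrightarrow> y \<in> G \<Longrightarrow> f (x + y) = f x + f y) \<Longrightarrow>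
   (\<And>c x. x \<in> G \<Longrightarrow> f (s c x) = t c (f x)) \<Longrightarrow> lin_on s t G f"
  by (simp add: lin_on_def)

lemma lin_on_add: "lin_on s t G f \<Longrightarrow> x \<in> G \<Longrightarrow> y \<in> G \<Longrightarrow> f (x + y) = f x + f y"
  and lin_on_scale: "lin_on s t G f \<Longrightarrow> x \<in> G \<Longrightarrow> f (s c x) = t c (f x)"
  by (simp_all add: lin_on_def)

lemma lin_on_subset: "lin_on s t G f \<Longrightarrow> K \<subseteq> G \<Longrightarrow> lin_on s t K f"
  unfolding lin_on_def by blast

lemma lin_on_comp:
  "lin_on s t G f \<Longrightarrow> lin_on t u K g \<Longrightarrow> (\<And>x. x \<in> G \<Longrightarrow> f x \<in> K) \<Longrightarrow> lin_on s u G (\<lambda>x. g (f x))"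
  by (auto simp: lin_on_def)

definition fin_gen :: "('a::comm_ring_1 \<Rightarrow> 'v::ab_group_add \<Rightarrow> 'v) \<Rightarrow> 'v set \<Rightarrow> bool" where
  "fin_gen s G \<longleftrightarrow> (\<exists>S. finite S \<and> G = Modules.module.span s S)"

text \<open>A finite dual basis, the working form of finitely generated and projective. It is a list
  so that the bases of two summands can simply be appended.\<close>

definition dual_list ::
    "('a::comm_ring_1 \<Rightarrow> 'v::ab_group_add \<Rightarrow> 'v) \<Rightarrow> 'v set \<Rightarrow> (('v \<Rightarrow> 'a) \<times> 'v) list \<Rightarrow> bool" where
  "dual_list s G L \<longleftrightarrow> (\<forall>(h, g)\<in>set L. g \<in> G \<and> lin_on s (*) G h) \<and>
    (\<forall>y\<in>G. y = (\<Sum>(h, g)\<leftarrow>L. s (h y) g))"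

lemma (in Modules.module) fin_gen_subspace: "fin_gen scale G \<Longrightarrow> subspace G"
  by (auto simp: fin_gen_def)

lemma (in Modules.module) lin_on_id: "lin_on scale scale G (\<lambda>x. x)"
  by (simp add: lin_on_def)

lemma (in module_pair) lin_on_diff_fun:
  "lin_on s1 s2 G f \<Longrightarrow> lin_on s1 s2 G g \<Longrightarrow> lin_on s1 s2 G (\<lambda>x. f x - g x)"
  and lin_on_add_fun:
  "lin_on s1 s2 G f \<Longrightarrow> lin_on s1 s2 G g \<Longrightarrow> lin_on s1 s2 G (\<lambda>x. f x + g x)"
  and lin_on_scale_fun:
  "lin_on s1 s2 G f \<Longrightarrow> lin_on s1 s2 G (\<lambda>x. s2 c (f x))"
  and lin_on_zero_fun: "lin_on s1 s2 G (\<lambda>x. 0)"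
  by (auto simp: lin_on_def m2.scale_right_diff_distrib m2.scale_right_distrib mult.commute)

lemma (in module_pair) lin_on_scale_vec:
  "lin_on s1 (*) G f \<Longrightarrow> lin_on s1 s2 G (\<lambda>x. s2 (f x) v)"
  by (auto simp: lin_on_def m2.scale_left_distrib)

lemma (in module_pair) lin_on_sum_fun:
  "(\<And>i. i \<in> A \<Longrightarrow> lin_on s1 s2 G (f i)) \<Longrightarrow> lin_on s1 s2 G (\<lambda>x. \<Sum>i\<in>A. f i x)"
  by (induction A rule: infinite_finite_induct) (auto intro: lin_on_zero_fun lin_on_add_fun)

lemma (in module_pair) lin_on_sum_list:
  "(\<And>h g. (h, g) \<in> set L \<Longrightarrow> lin_on s1 (*) G h) \<Longrightarrow>
    lin_on s1 s2 G (\<lambda>x. \<Sum>(h, g)\<leftarrow>L. s2 (h x) (k g))"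
proof (induction L)
  case Nil
  show ?case by (simp add: lin_on_zero_fun)
next
  case (Cons hg L)
  obtain h g where hg: "hg = (h, g)" by fastforce
  have "lin_on s1 s2 G (\<lambda>x. s2 (h x) (k g))" using Cons.prems[of h g] hg by (simp add: lin_on_scale_vec)
  moreover have "lin_on s1 s2 G (\<lambda>x. \<Sum>(h, g)\<leftarrow>L. s2 (h x) (k g))"
    using Cons.prems by (intro Cons.IH) (meson list.set_intros(2))
  ultimately have "lin_on s1 s2 G (\<lambda>x. s2 (h x) (k g) + (\<Sum>(h, g)\<leftarrow>L. s2 (h x) (k g)))"
    by (rule lin_on_add_fun)
  then show ?case by (simp add: hg)
qed

section \<open>Images, kernels and lifts of linear maps\<close>

context module_pair
begin

context
  fixes G f
  assumes sub: "m1.subspace G" and lin: "lin_on s1 s2 G f"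
begin

lemma lin_on_0: "f 0 = 0"
  using lin_on_scale[OF lin m1.subspace_0[OF sub], of 0] by simp

lemma lin_on_neg: "x \<in> G \<Longrightarrow> f (- x) = - f x"
  using lin_on_scale[OF lin, of x "- 1"] by simp

lemma lin_on_diff: "x \<in> G \<Longrightarrow> y \<in> G \<Longrightarrow> f (x - y) = f x - f y"
  using lin_on_add[OF lin, of x "- y"] m1.subspace_neg[OF sub] by (simp add: lin_on_neg)

lemma lin_on_sum: "(\<And>i. i \<in> A \<Longrightarrow> g i \<in> G) \<Longrightarrow> f (\<Sum>i\<in>A. g i) = (\<Sum>i\<in>A. f (g i))"
  by (induction A rule: infinite_finite_induct)
    (simp_all add: lin_on_0 lin_on_add[OF lin] m1.subspace_sum[OF sub])

lemma subspace_image: "m2.subspace (f ` G)"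
  unfolding m2.subspace_def
proof (intro conjI ballI allI)
  show "0 \<in> f ` G" using lin_on_0 m1.subspace_0[OF sub] by (metis imageI)
  fix y z assume "y \<in> f ` G" "z \<in> f ` G"
  then obtain u v where "u \<in> G" "v \<in> G" "y = f u" "z = f v" by blast
  then show "y + z \<in> f ` G"
    using lin_on_add[OF lin, of u v] m1.subspace_add[OF sub, of u v] by (metis imageI)
next
  fix c y assume "y \<in> f ` G"
  then obtain u where "u \<in> G" "y = f u" by blast
  then show "s2 c y \<in> f ` G"
    using lin_on_scale[OF lin, of u c] m1.subspace_scale[OF sub, of u c] by (metis imageI)
qed

lemma subspace_kernel: "m1.subspace {x \<in> G. f x = 0}"
  by (auto simp: m1.subspace_def lin_on_0 lin_on_add[OF lin] lin_on_scale[OF lin]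
      m1.subspace_0[OF sub] m1.subspace_add[OF sub] m1.subspace_scale[OF sub])

lemma fin_gen_image:
  assumes "fin_gen s1 G"
  shows "fin_gen s2 (f ` G)"
proof -
  obtain S where S: "finite S" "G = m1.span S" using assms by (auto simp: fin_gen_def)
  have SG: "S \<subseteq> G" using S m1.span_superset by blast
  have "f x \<in> m2.span (f ` S)" if "x \<in> m1.span S" for x
  proof -
    have "x \<in> G \<and> f x \<in> m2.span (f ` S)"
      using that
    proof (induction rule: m1.span_induct_alt)
      case base
      show ?case using m1.subspace_0[OF sub] lin_on_0 m2.span_zero by simp
    next
      case (step c x y)
      then have x: "x \<in> G" using SG by blast
      have "s2 c (f x) + f y \<in> m2.span (f ` S)"
        using step by (intro m2.span_add m2.span_scale m2.span_base[of "f x"]) auto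
      then show ?case using step x
        by (simp add: lin_on_add[OF lin] lin_on_scale[OF lin] m1.subspace_add[OF sub]
            m1.subspace_scale[OF sub])
    qed
    then show ?thesis ..
  qed
  then have "f ` G \<subseteq> m2.span (f ` S)" using S by blast
  moreover have "m2.span (f ` S) \<subseteq> f ` G"
    using SG by (intro m2.span_minimal subspace_image) auto
  ultimately have "f ` G = m2.span (f ` S)" by blast
  then show ?thesis using S unfolding fin_gen_def by blast
qed

text \<open>Projectivity in use: lift each dual basis element \<open>g\<close> to some
  \<open>k g\<close> in \<open>G\<close> and send c to the sum of the h(c) k(g). Purification
  applies this to a summand \<open>C\<close> of the image.\<close>

lemma lift_exists:
  assumes C: "dual_list s2 C L" "C \<subseteq> f ` G"
  shows "\<exists>l. lin_on s2 s1 C l \<and> (\<forall>c\<in>C. l c \<in> G \<and> f (l c) = c)"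
proof -
  interpret r: module_pair s2 s1 by (intro module_pair.intro m1.module_axioms m2.module_axioms)
  define k where "k = inv_into G f"
  have k: "k g \<in> G" "f (k g) = g" if "g \<in> C" for g
    using that C(2) by (auto simp: k_def intro: inv_into_into f_inv_into_f)
  define l where "l c = (\<Sum>(h, g)\<leftarrow>L. s1 (h c) (k g))" for c
  have "lin_on s2 s1 C l"
    unfolding l_def using C(1) by (intro r.lin_on_sum_list) (auto simp: dual_list_def)
  moreover have "l c \<in> G \<and> f (l c) = c" if c: "c \<in> C" for c
  proof -
    \<comment> \<open>Stated for arbitrary lists with entries in \<open>C\<close>, since the dual
      basis property of \<open>L\<close> does not pass to its tail.\<close>
    have "(\<Sum>(h, g)\<leftarrow>L'. s1 (h c) (k g)) \<in> G \<and>
        f (\<Sum>(h, g)\<leftarrow>L'. s1 (h c) (k g)) = (\<Sum>(h, g)\<leftarrow>L'. s2 (h c) g)"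
      if "\<forall>(h, g)\<in>set L'. g \<in> C" for L'
      using that
    proof (induction L')
      case Nil
      show ?case using m1.subspace_0[OF sub] lin_on_0 by simp
    next
      case (Cons hg L')
      obtain h g where hg: "hg = (h, g)" by fastforce
      then have "k g \<in> G" "f (k g) = g" using Cons k by auto
      then show ?case using Cons hg
        by (auto simp: lin_on_add[OF lin] lin_on_scale[OF lin] m1.subspace_add[OF sub]
            m1.subspace_scale[OF sub])
    qed
    from this[of L] C c show ?thesis by (auto simp: dual_list_def l_def)
  qed
  ultimately show ?thesis by blast
qed

end

end

text \<open>\<open>x - s (f x)\<close> and \<open>s (f x)\<close> are the components of
  \<open>x\<close> in two summands; the functionals of either dual basis are composed with the
  projection onto their summand.\<close>

lemma (in Modules.module) dual_list_append:
  assumes G: "subspace G" and f: "lin_on scale t G f" and sub: "\<And>x. x \<in> G \<Longrightarrow> s (f x) \<in> G"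
    and t: "Modules.module t" and s: "lin_on t scale (f ` G) s"
    and K: "K \<subseteq> G" "\<And>x. x \<in> G \<Longrightarrow> x - s (f x) \<in> K" "dual_list scale K L"
    and J: "dual_list t (f ` G) L'"
  shows "\<exists>L. dual_list scale G L"
proof -
  interpret T: Modules.module t by (rule t)
  interpret st: module_pair scale t by (intro module_pair.intro module_axioms t)
  interpret ts: module_pair t scale by (intro module_pair.intro module_axioms t)
  interpret ss: module_pair scale scale by (intro module_pair.intro module_axioms)
  have sf: "lin_on scale scale G (\<lambda>x. s (f x))" by (rule lin_on_comp[OF f s]) auto
  then have pr: "lin_on scale scale G (\<lambda>x. x - s (f x))"
    by (intro ss.lin_on_diff_fun lin_on_id)
  have Js: "T.subspace (f ` G)" by (rule st.subspace_image[OF G f])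
  define L1 where "L1 = map (\<lambda>(h, g). (\<lambda>x. h (x - s (f x)), g)) L"
  define L2 where "L2 = map (\<lambda>(h, g). (\<lambda>x. h (f x), s g)) L'"
  have "(\<Sum>(h, g)\<leftarrow>L1. scale (h y) g) = y - s (f y)" if "y \<in> G" for y
  proof -
    have "(\<Sum>(h, g)\<leftarrow>L1. scale (h y) g) = (\<Sum>(h, g)\<leftarrow>L. scale (h (y - s (f y))) g)"
      unfolding L1_def map_map by (rule arg_cong[of _ _ sum_list]) (auto simp: comp_def)
    also have "\<dots> = y - s (f y)" using K(2)[OF that] K(3) by (simp add: dual_list_def)
    finally show ?thesis .
  qed
  moreover have "(\<Sum>(h, g)\<leftarrow>L2. scale (h y) g) = s (f y)" if "y \<in> G" for y
  proof -
    have e1: "(\<Sum>(h, g)\<leftarrow>L2. scale (h y) g) = (\<Sum>(h, g)\<leftarrow>L'. scale (h (f y)) (s g))"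
      unfolding L2_def map_map by (rule arg_cong[of _ _ sum_list]) (auto simp: comp_def)
    have gen: "(\<Sum>(h, g)\<leftarrow>M. t (h (f y)) g) \<in> f ` G \<and>
        s (\<Sum>(h, g)\<leftarrow>M. t (h (f y)) g) = (\<Sum>(h, g)\<leftarrow>M. scale (h (f y)) (s g))"
      if "\<forall>(h, g)\<in>set M. g \<in> f ` G" for M :: "(('c \<Rightarrow> 'a) \<times> 'c) list"
      using that
    proof (induction M)
      case Nil
      show ?case using T.subspace_0[OF Js] ts.lin_on_0[OF Js s] by simp
    next
      case (Cons hg M)
      obtain h g where hg: "hg = (h, g)" by fastforce
      then have "g \<in> f ` G" using Cons by auto
      then have "t (h (f y)) g \<in> f ` G" "s (t (h (f y)) g) = scale (h (f y)) (s g)"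
        using T.subspace_scale[OF Js] lin_on_scale[OF s] by blast+
      then show ?case using Cons hg T.subspace_add[OF Js] lin_on_add[OF s] by auto
    qed
    have "\<forall>(h, g)\<in>set L'. g \<in> f ` G" using J by (auto simp: dual_list_def)
    then have e2: "s (\<Sum>(h, g)\<leftarrow>L'. t (h (f y)) g) = (\<Sum>(h, g)\<leftarrow>L'. scale (h (f y)) (s g))"
      using gen by blast
    have "f y = (\<Sum>(h, g)\<leftarrow>L'. t (h (f y)) g)" using J that unfolding dual_list_def by blast
    then show ?thesis using e1 e2 by metis
  qed
  moreover have "g \<in> G \<and> lin_on scale (*) G h" if "(h, g) \<in> set (L1 @ L2)" for h g
    using that K J sub
    by (auto simp: L1_def L2_def dual_list_def intro!: lin_on_comp[OF pr] lin_on_comp[OF f])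
  ultimately have "dual_list scale G (L1 @ L2)" by (auto simp: dual_list_def)
  then show ?thesis ..
qed

section \<open>Finitely generated ideals of the corner\<close>

context hereditary_corner
begin

text \<open>A further generator \<open>z\<close> is cut down to \<open>z - p * z\<close>, which
  lives outside the support \<open>p\<close> reached so far. Orthogonality prevents cancellation, so
  the sum of the elements has the sum of the idempotents as its support.\<close>

lemma fin_gen_full_support:
  assumes "fin_gen (*) J" and "\<And>x. x \<in> J \<Longrightarrow> e * x = x"
  shows "\<exists>a\<in>J. \<exists>p. e * p = p \<and> is_supp p a \<and> (\<forall>x\<in>J. p * x = x)"
proof -
  obtain S where S: "finite S" "J = rspan S" using assms by (auto simp: fin_gen_def)
  have SJ: "S \<subseteq> J" unfolding S by (rule Modules.module.span_superset[OF module_mult])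
  have J: "rideal J" unfolding S by (rule rideal_span)
  have "\<exists>a\<in>J. \<exists>p. e * p = p \<and> is_supp p a \<and> (\<forall>x\<in>S. p * x = x)"
    using S(1) SJ
  proof (induction S)
    case empty
    then show ?case
      using rideal_0[OF J] by (intro bexI[of _ 0] exI[of _ 0]) (auto simp: is_supp_def)
  next
    case (insert z S)
    then obtain a p where ap: "a \<in> J" "e * p = p" "is_supp p a" and pS: "\<And>x. x \<in> S \<Longrightarrow> p * x = x"
      by blast
    have pp': "p * p = p" "p * a = a" and pr: "\<And>r. r * a = 0 \<Longrightarrow> r * p = 0"
      using ap by (auto simp: is_supp_def)
    define z' where "z' = z - p * z"
    have ez: "e * z = z" using insert assms by blast
    have "e * z' = e * z - (e * p) * z" by (simp add: z'_def algebra_simps)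
    then have "e * z' = z'" using ez ap by (simp add: z'_def)
    then obtain q where q: "e * q = q" "is_supp q z'" using pp by blast
    then have qq: "q * q = q" "q * z' = z'" and qr: "\<And>r. r * z' = 0 \<Longrightarrow> r * q = 0"
      by (auto simp: is_supp_def)
    have pz': "p * z' = 0" using pp'(1) by (simp add: z'_def right_diff_distrib flip: mult.assoc)
    then have pq: "p * q = 0" by (rule qr)
    have qa: "q * a = 0" using pp' pq by (metis mult.assoc mult.commute mult_zero_left)
    have qx: "q * (p * x) = 0" for x using pq by (metis mult.assoc mult.commute mult_zero_left)
    have "(p + q) * (p + q) = p + q" using pp' qq pq by (simp add: algebra_simps)
    moreover have "(p + q) * (a + z') = a + z'" using pp' qq pz' qa by (simp add: algebra_simps)
    moreover have "r * (p + q) = 0" if r: "r * (a + z') = 0" for r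
    proof -
      have "r * a = p * (r * (a + z')) - r * (p * z') + r * a - r * (p * a)"
        by (simp add: algebra_simps)
      then have ra: "r * a = 0" using r pz' pp' by simp
      then have "r * z' = 0" using r by (simp add: distrib_left)
      then show ?thesis using pr[OF ra] qr by (simp add: distrib_left)
    qed
    ultimately have "is_supp (p + q) (a + z')" by (auto simp: is_supp_def)
    moreover have "a + z' \<in> J" using ap insert rideal_mult[OF J, of z p]
      unfolding z'_def by (intro rideal_add[OF J] rideal_diff[OF J]) auto
    moreover have "e * (p + q) = p + q" using ap q by (simp add: distrib_left)
    moreover have "(p + q) * x = x" if x: "x \<in> insert z S" for x
    proof (cases "x = z")
      case True
      have "(p + q) * z = p * z + q * (p * z) + q * z'" by (simp add: z'_def algebra_simps)
      then show ?thesis using True qx qq by (simp add: z'_def)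
    next
      case False
      then have "p * x = x" using x pS by blast
      then show ?thesis using qx[of x] by (simp add: distrib_right)
    qed
    ultimately show ?case by blast
  qed
  then obtain a p where ap: "a \<in> J" "e * p = p" "is_supp p a" and pS: "\<And>x. x \<in> S \<Longrightarrow> p * x = x"
    by blast
  have "rideal {x. p * x = x}" by (auto simp: rideal_def distrib_left mult.left_commute[of p])
  then have "rspan S \<subseteq> {x. p * x = x}"
    using pS by (intro Modules.module.span_minimal[OF module_mult]) auto
  then show ?thesis using ap S by blast
qed

text \<open>\<open>J\<close> itself may consist of zero divisors, but J + (1 - p)T contains a
  regular element. Multiplication by the elements \<open>v i / d\<close> of its inverse gives
  functionals on \<open>J\<close>, dual to the \<open>p * u i\<close>.\<close>

lemma fin_gen_ideal_dual:
  assumes "fin_gen (*) J" and "\<And>x. x \<in> J \<Longrightarrow> e * x = x"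
  shows "\<exists>L. dual_list (*) J L"
proof -
  have J: "rideal J" using assms(1) by (rule module.fin_gen_subspace[OF module_mult])
  obtain a p where a: "a \<in> J" and ep: "e * p = p" and supp: "is_supp p a"
    and pJ: "\<And>x. x \<in> J \<Longrightarrow> p * x = x"
    using fin_gen_full_support[OF assms] by blast
  have pp: "p * p = p" using supp by (simp add: is_supp_def)
  define I where "I = {x. p * x \<in> J}"
  define d where "d = a + (1 - p)"
  have d: "regular d" unfolding d_def by (rule regular_supp[OF supp ep])
  have I: "rideal I"
    using rideal_0[OF J] rideal_add[OF J] rideal_mult[OF J]
    by (auto simp: rideal_def I_def distrib_left mult.left_commute[of p])
  have "p * d = a" using pp pJ[OF a] by (simp add: d_def distrib_left right_diff_distrib)
  then have dI: "d \<in> I" using a by (simp add: I_def)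
  obtain N :: nat and u v where uv: "\<And>i. i < N \<Longrightarrow> u i \<in> I"
      "\<And>i x. i < N \<Longrightarrow> x \<in> I \<Longrightarrow> d dvd v i * x" "(\<Sum>i<N. u i * v i) = d"
    by (rule invE[OF I dI d]) blast
  \<comment> \<open>Division by \<open>d\<close>: the quotient is unique because \<open>d\<close> is
    regular, which is also why \<open>h i\<close> is linear.\<close>
  define h where "h i x = (SOME t. v i * x = d * t)" for i x
  have h: "v i * x = d * h i x" if "i < N" "x \<in> J" for i x
  proof -
    have "x \<in> I" using that pJ by (simp add: I_def)
    then show ?thesis unfolding h_def using uv(2)[OF that(1)] by (metis (mono_tags) dvdE someI_ex)
  qed
  have hl: "lin_on (*) (*) J (h i)" if "i < N" for i
  proof (rule lin_onI)
    fix x y assume xy: "x \<in> J" "y \<in> J"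
    have "d * h i (x + y) = d * (h i x + h i y)"
      using h[OF that] xy rideal_add[OF J xy] by (simp add: distrib_left flip: h[OF that])
    then show "h i (x + y) = h i x + h i y" by (rule nzd_cancel[OF regular_nzd[OF d]])
  next
    fix c x assume x: "x \<in> J"
    have "d * h i (c * x) = v i * (c * x)" using h[OF that] rideal_mult[OF J x] by simp
    also have "\<dots> = d * (c * h i x)" using h[OF that x] by (simp add: mult.left_commute)
    finally show "h i (c * x) = c * h i x" by (rule nzd_cancel[OF regular_nzd[OF d]])
  qed
  define L where "L = map (\<lambda>i. (h i, p * u i)) [0..<N]"
  have "y = (\<Sum>(h, g)\<leftarrow>L. h y * g)" if y: "y \<in> J" for y
  proof -
    have "y = (\<Sum>i<N. u i * h i y)"
      by (rule dual_expand[OF regular_nzd[OF d] uv(3)]) (rule h[OF _ y])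
    then have "p * y = p * (\<Sum>i<N. u i * h i y)" by simp
    also have "\<dots> = (\<Sum>i<N. h i y * (p * u i))" by (simp add: sum_distrib_left mult_ac)
    finally have "p * y = (\<Sum>i<N. h i y * (p * u i))" .
    moreover have "(\<Sum>(h, g)\<leftarrow>L. h y * g) = (\<Sum>i<N. h i y * (p * u i))"
      by (simp add: L_def comp_def interv_sum_list_conv_sum_set_nat atLeast0LessThan)
    ultimately show ?thesis using pJ[OF y] by simp
  qed
  moreover have "\<forall>(h, g)\<in>set L. g \<in> J \<and> lin_on (*) (*) J h"
    using uv(1) hl by (auto simp: L_def I_def)
  ultimately have "dual_list (*) J L" by (simp add: dual_list_def)
  then show ?thesis ..
qed

end

section \<open>Purification\<close>

locale hereditary_corner_module = hereditary_corner e + Modules.module scale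
  for e :: "'a::comm_ring_1" and scale :: "'a \<Rightarrow> 'v::ab_group_add \<Rightarrow> 'v" (infixr \<open>*s\<close> 75)
begin

abbreviation functional :: "'v set \<Rightarrow> ('v \<Rightarrow> 'a) \<Rightarrow> bool" where
  "functional \<equiv> lin_on scale (*)"

lemma pair_VR: "module_pair scale ((*) :: 'a \<Rightarrow> 'a \<Rightarrow> 'a)"
  and pair_RV: "module_pair ((*) :: 'a \<Rightarrow> 'a \<Rightarrow> 'a) scale"
  and pair_VV: "module_pair scale scale"
  by (intro module_pair.intro module_axioms module_mult)+

lemmas functional_0 = module_pair.lin_on_0[OF pair_VR]
lemmas functional_diff = module_pair.lin_on_diff[OF pair_VR]
lemmas functional_sum = module_pair.lin_on_sum[OF pair_VR]

text \<open>An embedding of \<open>G\<close> into a free module of rank \<open>n\<close> over the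
  corner, kept as a family of functionals because the inductions remove one of them at a
  time.\<close>

definition coords :: "nat \<Rightarrow> (nat \<Rightarrow> 'v \<Rightarrow> 'a) \<Rightarrow> 'v set \<Rightarrow> bool" where
  "coords n x G \<longleftrightarrow> (\<forall>j<n. functional G (x j) \<and> (\<forall>g\<in>G. e * x j g = x j g)) \<and>
    (\<forall>g\<in>G. (\<forall>j<n. x j g = 0) \<longrightarrow> g = 0)"

lemma coordsD:
  assumes "coords n x G"
  shows "\<And>j. j < n \<Longrightarrow> functional G (x j)"
    and "\<And>j g. j < n \<Longrightarrow> g \<in> G \<Longrightarrow> e * x j g = x j g"
    and "\<And>g. g \<in> G \<Longrightarrow> (\<And>j. j < n \<Longrightarrow> x j g = 0) \<Longrightarrow> g = 0"
  using assms by (auto simp: coords_def)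

lemma coords_subset: "coords n x G \<Longrightarrow> K \<subseteq> G \<Longrightarrow> coords n x K"
  unfolding coords_def using lin_on_subset[of scale "(*)" G _ K] by blast

text \<open>The number of coordinates goes down by one although \<open>K\<close> need not lie in the
  kernel of coordinate 0: \<open>K\<close> may be the kernel of another functional that determines
  coordinate 0 together with the rest.\<close>

lemma coords_shift:
  assumes c: "coords (Suc n) x G" and K: "K \<subseteq> G"
    and 0: "\<And>y. y \<in> K \<Longrightarrow> (\<And>j. j < n \<Longrightarrow> x (Suc j) y = 0) \<Longrightarrow> x 0 y = 0"
  shows "coords n (\<lambda>j. x (Suc j)) K"
  unfolding coords_def
proof (intro conjI allI impI ballI)
  fix j assume j: "j < n"
  show "functional K (x (Suc j))"
    by (rule lin_on_subset[OF coordsD(1)[OF c] K]) (use j in auto)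
  show "e * x (Suc j) y = x (Suc j) y" if "y \<in> K" for y
    using coordsD(2)[OF c, of "Suc j" y] that K j by auto
next
  fix y assume y: "y \<in> K" "\<forall>j<n. x (Suc j) y = 0"
  have "x j y = 0" if "j < Suc n" for j using y 0 that by (cases j) auto
  then show "y = 0" using coordsD(3)[OF c] y(1) K by blast
qed

lemma coords_torsion_free:
  assumes c: "coords n x G" and G: "subspace G" and d: "nzd d"
    and gg: "g \<in> G" "g' \<in> G" "d *s g = d *s g'"
  shows "g = g'"
proof -
  have "x j (g - g') = 0" if j: "j < n" for j
  proof -
    have "d * x j g = d * x j g'" using coordsD(1)[OF c j] gg by (metis lin_on_scale)
    then have "x j g = x j g'" by (rule nzd_cancel[OF d])
    then show ?thesis using functional_diff[OF G coordsD(1)[OF c j]] gg by simp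
  qed
  then have "g - g' = 0" using coordsD(3)[OF c] subspace_diff[OF G] gg by blast
  then show ?thesis by simp
qed

lemma coords_scale_id:
  assumes c: "coords n x G" and G: "subspace G" and g: "g \<in> G"
    and p: "\<And>j. j < n \<Longrightarrow> p * x j g = x j g"
  shows "p *s g = g"
proof -
  have "x j (p *s g - g) = 0" if j: "j < n" for j
    using functional_diff[OF G coordsD(1)[OF c j] subspace_scale[OF G g, of p] g] p[OF j]
    by (simp add: lin_on_scale[OF coordsD(1)[OF c j] g])
  then have "p *s g - g = 0" using coordsD(3)[OF c] subspace_diff[OF G] subspace_scale[OF G] g by blast
  then show ?thesis by simp
qed

lemma section_exists:
  assumes G: "subspace G" and f: "functional G f" and fg: "fin_gen (*) (f ` G)"
    and ef: "\<And>x. x \<in> G \<Longrightarrow> e * f x = f x"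
  obtains s where "lin_on (*) scale (f ` G) s" "\<forall>r\<in>f ` G. s r \<in> G \<and> f (s r) = r"
proof -
  obtain L where "dual_list (*) (f ` G) L" using fin_gen_ideal_dual[OF fg] ef by blast
  from module_pair.lift_exists[OF pair_VR G f this] show ?thesis using that by blast
qed

text \<open>\<open>x - s (f x)\<close> projects \<open>G\<close> onto the kernel of
  \<open>f\<close>; this is why the kernel inherits finite generation.\<close>

lemma splitting:
  assumes G: "subspace G" and f: "functional G f"
    and s: "lin_on (*) scale (f ` G) s" "\<forall>r\<in>f ` G. s r \<in> G \<and> f (s r) = r"
  shows "subspace {x \<in> G. f x = 0}"
    and "\<And>x. x \<in> G \<Longrightarrow> x - s (f x) \<in> {x \<in> G. f x = 0}"
    and "lin_on scale scale G (\<lambda>x. x - s (f x))"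
    and "fin_gen scale G \<Longrightarrow> fin_gen scale {x \<in> G. f x = 0}"
    and "s 0 = 0"
proof -
  show "subspace {x \<in> G. f x = 0}" by (rule module_pair.subspace_kernel[OF pair_VR G f])
  have J: "rideal (f ` G)" by (rule module_pair.subspace_image[OF pair_VR G f])
  show s0: "s 0 = 0" by (rule module_pair.lin_on_0[OF pair_RV J s(1)])
  show proj: "x - s (f x) \<in> {x \<in> G. f x = 0}" if "x \<in> G" for x
    using that functional_diff[OF G f that, of "s (f x)"] s subspace_diff[OF G that] by simp
  show lin: "lin_on scale scale G (\<lambda>x. x - s (f x))"
    by (intro module_pair.lin_on_diff_fun[OF pair_VV] lin_on_id lin_on_comp[OF f s(1)]) auto
  have "{x \<in> G. f x = 0} = (\<lambda>x. x - s (f x)) ` G"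
  proof
    show "{x \<in> G. f x = 0} \<subseteq> (\<lambda>x. x - s (f x)) ` G"
    proof
      fix x assume "x \<in> {x \<in> G. f x = 0}"
      then have "x \<in> G" "x = x - s (f x)" by (simp_all add: s0)
      then show "x \<in> (\<lambda>x. x - s (f x)) ` G" by (rule rev_image_eqI)
    qed
  qed (use proj in blast)
  then show "fin_gen scale G \<Longrightarrow> fin_gen scale {x \<in> G. f x = 0}"
    using module_pair.fin_gen_image[OF pair_VV G lin] by simp
qed

text \<open>The first coordinate maps \<open>G\<close> onto a finitely generated ideal, which is
  projective and therefore splits off; the kernel embeds in one coordinate less.\<close>

lemma dual_list_exists:
  assumes "coords n x G" "fin_gen scale G"
  shows "\<exists>L. dual_list scale G L"
  using assms
proof (induction n arbitrary: x G)
  case 0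
  have "dual_list scale G []" using coordsD(3)[OF 0(1)] by (simp add: dual_list_def)
  then show ?case ..
next
  case (Suc n)
  note c = coordsD[OF Suc.prems(1)]
  have G: "subspace G" by (rule fin_gen_subspace[OF Suc.prems(2)])
  define f where "f = x 0"
  have f: "functional G f" "\<And>y. y \<in> G \<Longrightarrow> e * f y = f y" using c(1,2)[of 0] by (simp_all add: f_def)
  have fg: "fin_gen (*) (f ` G)" by (rule module_pair.fin_gen_image[OF pair_VR G f(1) Suc.prems(2)])
  obtain s where s: "lin_on (*) scale (f ` G) s" "\<forall>r\<in>f ` G. s r \<in> G \<and> f (s r) = r"
    by (rule section_exists[OF G f(1) fg f(2)]) blast+
  note sp = splitting[OF G f(1) s]
  have "coords n (\<lambda>j. x (Suc j)) {x \<in> G. f x = 0}"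
    by (rule coords_shift[OF Suc.prems(1)]) (auto simp: f_def)
  from Suc.IH[OF this sp(4)[OF Suc.prems(2)]]
  obtain L where L: "dual_list scale {x \<in> G. f x = 0} L" ..
  obtain L' where L': "dual_list (*) (f ` G) L'" using fin_gen_ideal_dual[OF fg] f(2) by blast
  show ?case
    by (rule dual_list_append[OF G f(1) _ module_mult s(1) _ sp(2) L L']) (use s in auto)
qed

text \<open>The kernel of the idempotent \<open>\<rho>\<close> is the purification of
  \<open>H\<close>: everything with a regular multiple in \<open>H\<close>. The induction is
  Gaussian elimination with regular instead of invertible pivots; the splitting found after
  elimination is pulled back because its image is projective.\<close>

lemma purification:
  assumes "coords n x G" "fin_gen scale G" "fin_gen scale H" "H \<subseteq> G"
  shows "\<exists>\<rho> d. lin_on scale scale G \<rho> \<and> (\<forall>x\<in>G. \<rho> x \<in> G \<and> \<rho> (\<rho> x) = \<rho> x) \<and> (\<forall>x\<in>H. \<rho> x = 0) \<and>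
    regular d \<and> (\<forall>x\<in>G. \<rho> x = 0 \<longrightarrow> d *s x \<in> H)"
  using assms
proof (induction n arbitrary: x G H)
  case 0
  have "x = 0" if "x \<in> G" for x using coordsD(3)[OF 0(1) that] by simp
  then show ?case
    using regular_1 subspace_0[OF fin_gen_subspace[OF 0(3)]] subspace_0[OF fin_gen_subspace[OF 0(2)]]
    by (intro exI[of _ "\<lambda>_. 0"] exI[of _ 1])
      (auto intro: module_pair.lin_on_zero_fun[OF pair_VV])
next
  case (Suc n)
  note c = coordsD[OF Suc.prems(1)]
  have G: "subspace G" by (rule fin_gen_subspace[OF Suc.prems(2)])
  have H: "subspace H" by (rule fin_gen_subspace[OF Suc.prems(3)])
  have HG: "\<And>y. y \<in> H \<Longrightarrow> y \<in> G" using Suc.prems(4) by blast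
  define f where "f = x 0"
  have f: "functional G f" and ef: "\<And>y. y \<in> G \<Longrightarrow> e * f y = f y"
    using c(1,2)[of 0] by (simp_all add: f_def)
  have fH: "functional H f" by (rule lin_on_subset[OF f Suc.prems(4)])
  have "fin_gen (*) (f ` H)" by (rule module_pair.fin_gen_image[OF pair_VR H fH Suc.prems(3)])
  from fin_gen_full_support[OF this] obtain a p where a: "a \<in> f ` H" and ep: "e * p = p"
    and supp: "is_supp p a" and pf: "\<And>r. r \<in> f ` H \<Longrightarrow> p * r = r"
    using ef HG by blast
  have pfH: "p * f y = f y" if "y \<in> H" for y using pf that by blast
  obtain h where h: "h \<in> H" "a = f h" using a by blast
  have hG: "h \<in> G" by (rule HG[OF h(1)])
  \<comment> \<open>The part of coordinate 0 that vanishes on \<open>H\<close>. Its image splits off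
    \<open>G\<close> at once, and on the kernel \<open>G'\<close> coordinate 0 is supported by
    \<open>p\<close>, as it is on \<open>H\<close>.\<close>
  define g where "g y = (1 - p) * f y" for y
  have g: "functional G g" using f by (auto simp: lin_on_def g_def algebra_simps)
  have eg: "e * g y = g y" if "y \<in> G" for y
    using ef[OF that] by (simp add: g_def left_diff_distrib right_diff_distrib mult.left_commute[of e])
  have fgg: "fin_gen (*) (g ` G)" by (rule module_pair.fin_gen_image[OF pair_VR G g Suc.prems(2)])
  obtain s where s: "lin_on (*) scale (g ` G) s" "\<forall>r\<in>g ` G. s r \<in> G \<and> g (s r) = r"
    by (rule section_exists[OF G g fgg eg]) blast+
  define G' where "G' = {x \<in> G. g x = 0}"
  note sp = splitting[OF G g s, folded G'_def]
  have G'G: "\<And>y. y \<in> G' \<Longrightarrow> y \<in> G" by (simp add: G'_def)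
  define b where "b = a + (1 - p)"
  have b: "regular b" unfolding b_def by (rule regular_supp[OF supp ep])
  \<comment> \<open>Elimination with pivot \<open>a = f h\<close>: f(\<phi> y) = b f(y) - f(y) a =
    (1 - p) f(y), which is 0 on \<open>G'\<close>. Using \<open>b\<close> instead of
    \<open>a\<close> keeps the multiplier regular.\<close>
  define \<phi> where "\<phi> y = b *s y - f y *s h" for y
  have \<phi>G: "lin_on scale scale G \<phi>"
    using f by (auto simp: lin_on_def \<phi>_def scale_right_distrib scale_left_distrib
        scale_right_diff_distrib mult.commute)
  then have \<phi>: "lin_on scale scale G' \<phi>" by (rule lin_on_subset) (use G'G in blast)
  have \<phi>_in: "\<phi> y \<in> G" if "y \<in> G" for y
    unfolding \<phi>_def by (intro subspace_diff[OF G] subspace_scale[OF G] that hG)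
  have HG': "H \<subseteq> G'"
    using HG pfH by (auto simp: G'_def g_def left_diff_distrib)
  have f\<phi>: "f (\<phi> y) = 0" if "y \<in> G'" for y
  proof -
    have y: "y \<in> G" by (rule G'G[OF that])
    have "f (\<phi> y) = b * f y - f y * a"
      unfolding \<phi>_def using functional_diff[OF G f subspace_scale[OF G y] subspace_scale[OF G hG]]
        lin_on_scale[OF f] y hG h by simp
    also have "\<dots> = g y" by (simp add: b_def g_def algebra_simps)
    finally show ?thesis using that by (simp add: G'_def)
  qed
  have cG: "coords n (\<lambda>j. x (Suc j)) (\<phi> ` G')"
    by (rule coords_shift[OF Suc.prems(1)]) (use \<phi>_in G'G f\<phi> in \<open>auto simp: f_def\<close>)
  have fgG: "fin_gen scale (\<phi> ` G')"
    by (rule module_pair.fin_gen_image[OF pair_VV sp(1) \<phi> sp(4)[OF Suc.prems(2)]])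
  have fgH: "fin_gen scale (\<phi> ` H)"
    by (rule module_pair.fin_gen_image[OF pair_VV H lin_on_subset[OF \<phi> HG'] Suc.prems(3)])
  obtain \<sigma> d where \<sigma>: "lin_on scale scale (\<phi> ` G') \<sigma>"
    and \<sigma>_b: "\<forall>y\<in>\<phi> ` G'. \<sigma> y \<in> \<phi> ` G' \<and> \<sigma> (\<sigma> y) = \<sigma> y"
    and \<sigma>_H: "\<forall>y\<in>\<phi> ` H. \<sigma> y = 0" and d: "regular d"
    and \<sigma>_0: "\<forall>y\<in>\<phi> ` G'. \<sigma> y = 0 \<longrightarrow> d *s y \<in> \<phi> ` H"
    using Suc.IH[OF cG fgG fgH image_mono[OF HG']] by (elim exE conjE) (rule that)
  note \<sigma>_in = \<sigma>_b[rule_format, THEN conjunct1] and \<sigma>\<sigma> = \<sigma>_b[rule_format, THEN conjunct2]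
    and \<sigma>H = \<sigma>_H[rule_format] and \<sigma>0 = \<sigma>_0[rule_format]
  have s\<phi>: "subspace (\<phi> ` G')" by (rule fin_gen_subspace[OF fgG])
  have C: "fin_gen scale (\<sigma> ` \<phi> ` G')" "\<sigma> ` \<phi> ` G' \<subseteq> \<phi> ` G'"
    using module_pair.fin_gen_image[OF pair_VV s\<phi> \<sigma> fgG] \<sigma>_in by auto
  obtain L where "dual_list scale (\<sigma> ` \<phi> ` G') L"
    using dual_list_exists[OF coords_subset[OF cG C(2)] C(1)] ..
  from module_pair.lift_exists[OF pair_VV sp(1) \<phi> this C(2)]
  obtain l where l: "lin_on scale scale (\<sigma> ` \<phi> ` G') l"
    and l_in: "\<And>z. z \<in> \<sigma> ` \<phi> ` G' \<Longrightarrow> l z \<in> G'" and \<phi>l: "\<And>z. z \<in> \<sigma> ` \<phi> ` G' \<Longrightarrow> \<phi> (l z) = z" by blast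
  have Cs: "subspace (\<sigma> ` \<phi> ` G')" by (rule fin_gen_subspace[OF C(1)])
  have l0: "l 0 = 0" by (rule module_pair.lin_on_0[OF pair_VV Cs l])
  \<comment> \<open>\<open>\<sigma>\<close> lives on the image of \<open>\<phi>\<close>. Lifting its
    values back through \<open>\<phi>\<close> gives an idempotent of \<open>G'\<close>, because
    \<open>\<phi>\<close> after \<open>l\<close> is the identity on the image of
    \<open>\<sigma>\<close>.\<close>
  define \<tau> where "\<tau> y = l (\<sigma> (\<phi> y))" for y
  define \<rho> where "\<rho> y = s (g y) + \<tau> (y - s (g y))" for y
  have \<tau>: "lin_on scale scale G' \<tau>"
    unfolding \<tau>_def by (intro lin_on_comp[OF _ l] lin_on_comp[OF \<phi> \<sigma>]) auto
  have \<tau>_in: "\<tau> y \<in> G'" if "y \<in> G'" for y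
    unfolding \<tau>_def by (intro l_in) (use that in blast)
  have \<tau>\<tau>: "\<tau> (\<tau> y) = \<tau> y" if "y \<in> G'" for y
    using that by (simp add: \<tau>_def \<phi>l \<sigma>\<sigma>)
  have "lin_on scale scale G \<rho>"
    unfolding \<rho>_def
    by (intro module_pair.lin_on_add_fun[OF pair_VV] lin_on_comp[OF g s(1)] lin_on_comp[OF sp(3) \<tau>] sp(2)) auto
  moreover have \<rho>_props: "\<rho> y \<in> G \<and> g (\<rho> y) = g y \<and> \<rho> (\<rho> y) = \<rho> y" if y: "y \<in> G" for y
  proof -
    have t: "\<tau> (y - s (g y)) \<in> G'" by (intro \<tau>_in sp(2) y)
    then have tG: "\<tau> (y - s (g y)) \<in> G" "g (\<tau> (y - s (g y))) = 0" by (simp_all add: G'_def)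
    have sG: "s (g y) \<in> G" "g (s (g y)) = g y" using s y by auto
    have "\<rho> y \<in> G" unfolding \<rho>_def by (intro subspace_add[OF G] tG sG)
    moreover have gg: "g (\<rho> y) = g y"
      using lin_on_add[OF g sG(1) tG(1)] sG tG by (simp add: \<rho>_def)
    moreover have "\<rho> (\<rho> y) = s (g y) + \<tau> (\<rho> y - s (g y))" using gg by (simp add: \<rho>_def[of "\<rho> y"])
    then have "\<rho> (\<rho> y) = \<rho> y" using \<tau>\<tau>[OF sp(2)[OF y]] by (simp add: \<rho>_def[of y])
    ultimately show ?thesis by blast
  qed
  moreover have "\<rho> y = 0" if y: "y \<in> H" for y
  proof -
    have "g y = 0" using HG' y by (auto simp: G'_def)
    then show ?thesis using \<sigma>H y by (simp add: \<rho>_def \<tau>_def sp(5) l0)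
  qed
  \<comment> \<open>\<open>\<phi> (\<tau> y)\<close> is \<open>\<sigma> (\<phi> y)\<close>, so the
    latter vanishes and \<open>d *s \<phi> y = \<phi> k\<close> with \<open>k\<close> in
    \<open>H\<close>. The two sides are \<open>(d * b) *s y\<close> and \<open>b *s k\<close> up to
    multiples of \<open>h\<close>, which lies in \<open>H\<close>.\<close>
  moreover have "(d * b) *s y \<in> H" if y: "y \<in> G" "\<rho> y = 0" for y
  proof -
    have "g y = g (\<rho> y)" using \<rho>_props[OF y(1)] by simp
    then have gy: "g y = 0" using y(2) functional_0[OF G g] by simp
    then have yG': "y \<in> G'" using y by (simp add: G'_def)
    have "\<tau> y = 0" using y gy by (simp add: \<rho>_def sp(5))
    then have "\<phi> (\<tau> y) = 0" using module_pair.lin_on_0[OF pair_VV G \<phi>G] by simp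
    then have "\<sigma> (\<phi> y) = 0" using yG' by (simp add: \<tau>_def \<phi>l)
    then obtain k where k: "k \<in> H" "d *s \<phi> y = \<phi> k" using \<sigma>0[of "\<phi> y"] yG' by blast
    have "(d * b) *s y = d *s \<phi> y + (d * f y) *s h" by (simp add: \<phi>_def scale_right_diff_distrib)
    also have "\<dots> = b *s k - f k *s h + (d * f y) *s h" using k by (simp add: \<phi>_def)
    also have "\<dots> \<in> H" by (intro subspace_add[OF H] subspace_diff[OF H] subspace_scale[OF H] k h)
    finally show ?thesis .
  qed
  ultimately show ?case using regular_mult[OF d b] by blast
qed

end

section \<open>Normal form modulo a regular element\<close>

context hereditary_corner
begin

text \<open>A finitely generated ideal is isomorphic to one that is coprime to \<open>d\<close>
  within its support: \<open>\<theta>\<close> is multiplication by an element of the inverse of J +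
  (1 - p)T. To find it, pair that ideal with its inverse; the matrix of all products has trace 1 and
  is therefore unimodular.\<close>

lemma ideal_scaling:
  assumes fg: "fin_gen (*) J" and eJ: "\<And>x. x \<in> J \<Longrightarrow> e * x = x"
    and a: "a \<in> J" and ep: "e * p = p" and supp: "is_supp p a" and pJ: "\<And>x. x \<in> J \<Longrightarrow> p * x = x"
    and d: "regular d"
  shows "\<exists>\<theta> v. lin_on (*) (*) J \<theta> \<and> (\<forall>x\<in>J. \<theta> x = 0 \<longrightarrow> x = 0) \<and> (\<forall>x\<in>J. p * \<theta> x = \<theta> x) \<and>
    v \<in> J \<and> d dvd \<theta> v - p"
proof -
  have J: "rideal J" using fg by (rule module.fin_gen_subspace[OF module_mult])
  have pp': "p * p = p" using supp by (simp add: is_supp_def)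
  define I where "I = {x. p * x \<in> J}"
  define \<delta> where "\<delta> = a + (1 - p)"
  have \<delta>: "regular \<delta>" unfolding \<delta>_def by (rule regular_supp[OF supp ep])
  note nz = nzd_cancel[OF regular_nzd[OF \<delta>]]
  have I: "rideal I"
    using rideal_0[OF J] rideal_add[OF J] rideal_mult[OF J]
    by (auto simp: rideal_def I_def distrib_left mult.left_commute[of p])
  have "p * \<delta> = a" using pp' pJ[OF a] by (simp add: \<delta>_def distrib_left right_diff_distrib)
  then have \<delta>I: "\<delta> \<in> I" using a by (simp add: I_def)
  obtain N :: nat and u v where uv: "\<And>i. i < N \<Longrightarrow> u i \<in> I"
      "\<And>i x. i < N \<Longrightarrow> x \<in> I \<Longrightarrow> \<delta> dvd v i * x" "(\<Sum>i<N. u i * v i) = \<delta>"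
    by (rule invE[OF I \<delta>I \<delta>]) blast
  \<comment> \<open>Padded with a zero at index \<open>N\<close>: the combinations run over indices
    up to and including \<open>N\<close>, so that an index 0 always exists.\<close>
  define U where "U i = (if i < N then u i else 0)" for i
  define V where "V i = (if i < N then v i else 0)" for i
  have UI: "U i \<in> I" for i using uv(1) rideal_0[OF I] by (simp add: U_def)
  have Vdvd: "\<delta> dvd V i * x" if "x \<in> I" for i x using uv(2) that by (simp add: V_def)
  define M where "M j i = (SOME t. V i * U j = \<delta> * t)" for j i
  have M: "V i * U j = \<delta> * M j i" for i j
    unfolding M_def using Vdvd[OF UI] by (metis (mono_tags) dvdE someI_ex)
  have "\<delta> * (\<Sum>j\<le>N. M j j) = (\<Sum>j\<le>N. V j * U j)" by (simp add: sum_distrib_left M)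
  also have "\<dots> = (\<Sum>j<N. V j * U j)" by (simp add: V_def flip: lessThan_Suc_atMost)
  also have "\<dots> = (\<Sum>j<N. u j * v j)" by (rule sum.cong) (simp_all add: U_def V_def mult.commute)
  also have "\<dots> = \<delta> * 1" using uv by simp
  finally have tr: "(\<Sum>j\<le>N. M j j) = 1" by (rule nz)
  obtain r c w t where rc: "(\<Sum>j\<le>N. \<Sum>i\<le>N. r j * c i * M j i) * w = 1 + d * t"
  proof -
    have "\<exists>r c w t. c 0 = 1 \<and> (\<Sum>j\<le>N. \<Sum>i\<le>N. r j * c i * M j i) * w = 1 + d * t"
    proof (rule bilinear_unimodular[OF d])
      fix P assume P: "prime_rideal P" and "\<forall>j\<le>N. \<forall>i\<le>N. M j i \<in> P"
      then have "(\<Sum>j\<le>N. M j j) \<in> P" by (intro rideal_sum) (auto simp: prime_rideal_def)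
      then show "1 \<in> P" by (simp add: tr)
    qed simp_all
    then show ?thesis using that by blast
  qed
  define A where "A = (\<Sum>j\<le>N. r j * U j)"
  define B where "B = (\<Sum>i\<le>N. c i * V i)"
  have AI: "A \<in> I" unfolding A_def by (intro rideal_sum[OF I] rideal_mult[OF I] UI)
  have "B * A = (\<Sum>j\<le>N. \<Sum>i\<le>N. r j * c i * (V i * U j))"
    unfolding A_def B_def sum_product by (subst sum.swap) (simp add: mult_ac)
  also have "\<dots> = \<delta> * (\<Sum>j\<le>N. \<Sum>i\<le>N. r j * c i * M j i)"
    unfolding M by (simp add: sum_distrib_left mult.left_commute)
  finally have BA: "B * A * w = \<delta> * (1 + d * t)" using rc by (simp add: mult.assoc)
  have "e * (e * B) = e * B" using e_idem by (simp flip: mult.assoc)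
  then obtain \<eta> where \<eta>: "e * \<eta> = \<eta>" "is_supp \<eta> (e * B)" using pp by blast
  then have \<eta>\<eta>: "\<eta> * \<eta> = \<eta>" and \<eta>B: "\<eta> * (e * B) = e * B" and \<eta>0: "\<And>r. r * (e * B) = 0 \<Longrightarrow> r * \<eta> = 0"
    by (auto simp: is_supp_def)
  \<comment> \<open>Multiplication by \<open>B\<close> may fail to be injective on \<open>J\<close>.
    Outside the support \<open>\<eta>\<close> of \<open>e * B\<close> it is 0 there, and the added
    term makes \<open>\<theta>\<close> the identity on that part.\<close>
  define B' where "B' = B + (1 - \<eta>) * \<delta>"
  have JI: "x \<in> I" if "x \<in> J" for x using that pJ by (simp add: I_def)
  have Bdvd: "\<delta> dvd B' * x" if "x \<in> J" for x
  proof -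
    have "\<delta> dvd B * x"
      unfolding B_def sum_distrib_right using Vdvd[OF JI[OF that]]
      by (intro dvd_sum) (metis dvd_mult mult.assoc)
    moreover have "B' * x = B * x + \<delta> * ((1 - \<eta>) * x)" by (simp add: B'_def algebra_simps)
    ultimately show ?thesis by simp
  qed
  define \<theta> where "\<theta> x = (SOME t. B' * x = \<delta> * t)" for x
  have \<theta>: "B' * x = \<delta> * \<theta> x" if "x \<in> J" for x
    unfolding \<theta>_def using Bdvd[OF that] by (metis (mono_tags) dvdE someI_ex)
  have lin: "lin_on (*) (*) J \<theta>"
  proof (rule lin_onI)
    fix x y assume xy: "x \<in> J" "y \<in> J"
    have "\<delta> * \<theta> (x + y) = \<delta> * (\<theta> x + \<theta> y)"
      using \<theta> xy rideal_add[OF J xy] by (simp add: distrib_left flip: \<theta>)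
    then show "\<theta> (x + y) = \<theta> x + \<theta> y" by (rule nz)
  next
    fix c x assume x: "x \<in> J"
    have "\<delta> * \<theta> (c * x) = B' * (c * x)" using \<theta> rideal_mult[OF J x] by simp
    also have "\<dots> = \<delta> * (c * \<theta> x)" by (metis \<theta>[OF x] mult.left_commute)
    finally show "\<theta> (c * x) = c * \<theta> x" by (rule nz)
  qed
  have e\<eta>B: "(1 - \<eta>) * (B * y) = 0" if "e * y = y" for y
  proof -
    have "(1 - \<eta>) * (B * y) = (e * B - \<eta> * (e * B)) * y"
      using that by (metis (no_types, lifting) left_diff_distrib mult.assoc mult.commute mult_1)
    then show ?thesis using \<eta>B that by simp
  qed
  have inj: "x = 0" if x: "x \<in> J" and 0: "\<theta> x = 0" for x
  proof -
    have B'x: "B' * x = 0" using \<theta>[OF x] 0 by simp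
    have "(1 - \<eta>) * (1 - \<eta>) = 1 - \<eta>" using \<eta>\<eta> by (simp add: algebra_simps)
    then have "\<delta> * ((1 - \<eta>) * x) = ((1 - \<eta>) * (1 - \<eta>)) * (\<delta> * x)" by (simp only: mult_ac)
    moreover have "(1 - \<eta>) * (B' * x) = (1 - \<eta>) * (B * x) + ((1 - \<eta>) * (1 - \<eta>)) * (\<delta> * x)"
      by (simp only: B'_def distrib_left distrib_right mult.assoc)
    ultimately have "(1 - \<eta>) * (B' * x) = (1 - \<eta>) * (B * x) + \<delta> * ((1 - \<eta>) * x)" by simp
    then have "\<delta> * ((1 - \<eta>) * x) = \<delta> * 0" using B'x e\<eta>B[OF eJ[OF x]] by simp
    then have \<eta>x: "(1 - \<eta>) * x = 0" by (rule nz)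
    have "B' * x = B * x + \<delta> * ((1 - \<eta>) * x)" by (simp add: B'_def algebra_simps)
    then have "B * x = 0" using B'x \<eta>x by simp
    then have "e * (B * x) = 0" by simp
    then have "x * (e * B) = 0" by (simp only: mult_ac)
    then have "x * \<eta> = 0" by (rule \<eta>0)
    then show ?thesis using \<eta>x by (simp add: algebra_simps)
  qed
  have p\<theta>: "p * \<theta> x = \<theta> x" if x: "x \<in> J" for x
    using pJ[OF x] lin_on_scale[OF lin x, of p] by simp
  define v' where "v' = w * (p * A)"
  have v'J: "v' \<in> J" using AI rideal_mult[OF J] by (simp add: v'_def I_def)
  \<comment> \<open>The part of \<open>p\<close> where the correction acts. There \<open>B\<close>
    vanishes, so \<open>q\<close> is killed by \<open>1 + d * t\<close> and hence is a multiple of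
    \<open>d\<close>: the correction does not change the value at \<open>v'\<close> modulo
    \<open>d\<close>.\<close>
  define q where "q = (1 - \<eta>) * p"
  have "\<delta> * (q * (1 + d * t)) = q * (\<delta> * (1 + d * t))" by (simp only: mult_ac)
  also have "\<dots> = q * (B * A * w)" by (simp only: BA)
  also have "\<dots> = (1 - \<eta>) * (B * (p * (A * w)))" by (simp only: q_def mult_ac)
  also have "\<dots> = 0" by (rule e\<eta>B) (simp add: ep flip: mult.assoc)
  finally have "\<delta> * (q * (1 + d * t)) = \<delta> * 0" by simp
  then have "q * (1 + d * t) = 0" by (rule nz)
  then have q: "q = d * (- t * q)" by (simp add: algebra_simps eq_neg_iff_add_eq_0)
  have "\<delta> * \<theta> v' = B' * v'" using \<theta>[OF v'J] by simp
  also have "\<dots> = p * (B * A * w) + \<delta> * (q * (A * w))" by (simp add: B'_def v'_def q_def algebra_simps)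
  also have "\<dots> = \<delta> * (p + d * (p * t) + q * (A * w))" unfolding BA by (simp add: algebra_simps)
  finally have "\<theta> v' = p + d * (p * t) + q * (A * w)" by (rule nz)
  then have "\<theta> v' - p = d * (p * t) + q * (A * w)" by simp
  moreover have "d dvd q * (A * w)" using q by (metis dvd_mult2 dvd_triv_left)
  ultimately have "d dvd \<theta> v' - p" by simp
  then show ?thesis using lin inj p\<theta> v'J by blast
qed

end

section \<open>Coordinates adapted to a regular element\<close>

context hereditary_corner_module
begin

text \<open>The next coordinate is added only where the functional so far vanishes, through the
  factor \<open>1 - p\<close>, so the support grows until it covers all coordinates. The last clause
  lets coordinate 0 be recovered from \<open>g\<close> and the others, so that \<open>g\<close> may
  replace it.\<close>

lemma full_functional:
  assumes c: "coords (Suc n) x G" and fg: "fin_gen scale G" and k: "k \<le> n"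
  shows "\<exists>g p a. functional G g \<and> (\<forall>y\<in>G. e * g y = g y) \<and> e * p = p \<and> a \<in> g ` G \<and> is_supp p a \<and>
    (\<forall>y\<in>G. p * g y = g y) \<and> (\<forall>j\<le>k. \<forall>y\<in>G. p * x j y = x j y) \<and>
    (\<forall>y\<in>G. (\<forall>j. 1 \<le> j \<longrightarrow> j \<le> k \<longrightarrow> x j y = 0) \<longrightarrow> g y = x 0 y)"
  using k
proof (induction k)
  case 0
  have G: "subspace G" by (rule fin_gen_subspace[OF fg])
  note c = coordsD[OF c]
  have f: "functional G (x 0)" and ef: "\<forall>y\<in>G. e * x 0 y = x 0 y" using c(1,2)[of 0] by simp_all
  have "fin_gen (*) (x 0 ` G)" by (rule module_pair.fin_gen_image[OF pair_VR G f fg])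
  from fin_gen_full_support[OF this] ef obtain a p where
    "a \<in> x 0 ` G" "e * p = p" "is_supp p a" "\<forall>y\<in>x 0 ` G. p * y = y" by blast
  then show ?case using f ef by (intro exI[of _ "x 0"] exI[of _ p] exI[of _ a]) auto
next
  case (Suc k)
  have G: "subspace G" by (rule fin_gen_subspace[OF fg])
  note c = coordsD[OF c]
  obtain g p a where g: "functional G g" "\<forall>y\<in>G. e * g y = g y" and ep: "e * p = p"
    and a: "a \<in> g ` G" "is_supp p a" and pg: "\<forall>y\<in>G. p * g y = g y"
    and px: "\<forall>j\<le>k. \<forall>y\<in>G. p * x j y = x j y"
    and gx: "\<forall>y\<in>G. (\<forall>j. 1 \<le> j \<longrightarrow> j \<le> k \<longrightarrow> x j y = 0) \<longrightarrow> g y = x 0 y"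
    using Suc.IH[OF Suc_leD[OF Suc.prems]] by (elim exE conjE) (rule that)
  have pp': "p * p = p" using a by (simp add: is_supp_def)
  have xk: "functional G (x (Suc k))" "\<And>y. y \<in> G \<Longrightarrow> e * x (Suc k) y = x (Suc k) y"
    using c(1,2)[of "Suc k"] Suc.prems by simp_all
  define g' where "g' y = g y + (1 - p) * x (Suc k) y" for y
  have g': "functional G g'"
    unfolding g'_def
    by (intro module_pair.lin_on_add_fun[OF pair_VR] g module_pair.lin_on_scale_fun[OF pair_VR] xk)
  have eg': "e * g' y = g' y" if "y \<in> G" for y
    using g xk that by (simp add: g'_def distrib_left left_diff_distrib right_diff_distrib mult.left_commute[of e])
  have "fin_gen (*) (g' ` G)" by (rule module_pair.fin_gen_image[OF pair_VR G g' fg])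
  from fin_gen_full_support[OF this] eg' obtain a' p' where a': "a' \<in> g' ` G" "e * p' = p'" "is_supp p' a'"
    and p': "\<forall>y\<in>g' ` G. p' * y = y" by blast
  have p'g': "p' * g' y = g' y" if "y \<in> G" for y using p' that by blast
  have pg': "p * g' y = g y" if "y \<in> G" for y
    using pg pp' that by (simp add: g'_def distrib_left left_diff_distrib right_diff_distrib flip: mult.assoc)
  have p'g: "p' * g y = g y" if "y \<in> G" for y
    using pg'[OF that] p'g'[OF that] by (metis mult.left_commute)
  \<comment> \<open>The support can only grow: \<open>p\<close> times the new functional is the old
    one, so \<open>p'\<close> fixes the old values and in particular \<open>a\<close>.\<close>
  have "(1 - p') * a = 0" using a p'g by (auto simp: left_diff_distrib)
  then have "(1 - p') * p = 0" using a by (simp add: is_supp_def)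
  then have p'p: "p' * p = p" by (simp add: left_diff_distrib)
  have "p' * x j y = x j y" if j: "j \<le> Suc k" and y: "y \<in> G" for j y
  proof (cases "j = Suc k")
    case True
    have "p' * g' y = p' * g y + p' * x (Suc k) y - p' * p * x (Suc k) y"
      by (simp add: g'_def algebra_simps)
    then have "g' y = g y + p' * x (Suc k) y - p * x (Suc k) y"
      using p'g'[OF y] p'g[OF y] p'p by simp
    then show ?thesis using True by (simp add: g'_def algebra_simps)
  next
    case False
    then have "p * x j y = x j y" using px j y by simp
    then show ?thesis using p'p by (metis mult.assoc)
  qed
  moreover have "g' y = x 0 y" if "y \<in> G" "\<forall>j. 1 \<le> j \<longrightarrow> j \<le> Suc k \<longrightarrow> x j y = 0" for y
    using gx that by (simp add: g'_def)
  ultimately show ?case using g' eg' a' p'g' by blast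
qed

text \<open>\<open>f\<close> is the functional with full support followed by the scaling of its
  image. Scaling is injective, so the kernel is unchanged, and it makes the single value
  \<open>v\<close> generate the image modulo \<open>d\<close>.\<close>

lemma coordinate_step:
  assumes c: "coords (Suc n) x G" and fg: "fin_gen scale G" and d: "regular d"
  shows "\<exists>f s p a v. functional G f \<and> (\<forall>y\<in>G. e * f y = f y) \<and> lin_on (*) scale (f ` G) s \<and>
    (\<forall>r\<in>f ` G. s r \<in> G \<and> f (s r) = r) \<and> coords n (\<lambda>j. x (Suc j)) {y \<in> G. f y = 0} \<and>
    e * p = p \<and> a \<in> f ` G \<and> is_supp p a \<and> (\<forall>y\<in>G. p *s y = y) \<and> v \<in> f ` G \<and> d dvd v - p"
proof -
  have G: "subspace G" by (rule fin_gen_subspace[OF fg])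
  obtain g p a where g: "functional G g" and eg: "\<forall>y\<in>G. e * g y = g y" and ep: "e * p = p"
    and a: "a \<in> g ` G" and supp: "is_supp p a" and pg: "\<forall>y\<in>G. p * g y = g y"
    and px: "\<forall>j\<le>n. \<forall>y\<in>G. p * x j y = x j y"
    and gx: "\<forall>y\<in>G. (\<forall>j. 1 \<le> j \<longrightarrow> j \<le> n \<longrightarrow> x j y = 0) \<longrightarrow> g y = x 0 y"
    using full_functional[OF c fg order_refl] by (elim exE conjE) (rule that)
  have J: "rideal (g ` G)" by (rule module_pair.subspace_image[OF pair_VR G g])
  have fgJ: "fin_gen (*) (g ` G)" by (rule module_pair.fin_gen_image[OF pair_VR G g fg])
  have "\<exists>\<theta> v. lin_on (*) (*) (g ` G) \<theta> \<and> (\<forall>x\<in>g ` G. \<theta> x = 0 \<longrightarrow> x = 0) \<and>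
      (\<forall>x\<in>g ` G. p * \<theta> x = \<theta> x) \<and> v \<in> g ` G \<and> d dvd \<theta> v - p"
    by (rule ideal_scaling[OF fgJ _ a ep supp _ d]) (use eg pg in auto)
  then obtain \<theta> v where \<theta>: "lin_on (*) (*) (g ` G) \<theta>" and inj: "\<forall>x\<in>g ` G. \<theta> x = 0 \<longrightarrow> x = 0"
    and p\<theta>: "\<forall>x\<in>g ` G. p * \<theta> x = \<theta> x" and v: "v \<in> g ` G" "d dvd \<theta> v - p"
    by (elim exE conjE) (rule that)
  define f where "f y = \<theta> (g y)" for y
  have f: "functional G f" unfolding f_def by (rule lin_on_comp[OF g \<theta>]) simp
  have im: "f ` G = \<theta> ` g ` G" by (auto simp: f_def)
  have ef: "e * f y = f y" if "y \<in> G" for y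
    using p\<theta> that ep unfolding f_def by (metis imageI mult.assoc)
  have fgf: "fin_gen (*) (f ` G)" by (rule module_pair.fin_gen_image[OF pair_VR G f fg])
  obtain s where s: "lin_on (*) scale (f ` G) s" "\<forall>r\<in>f ` G. s r \<in> G \<and> f (s r) = r"
    by (rule section_exists[OF G f fgf ef]) blast+
  have "coords n (\<lambda>j. x (Suc j)) {y \<in> G. f y = 0}"
  proof (rule coords_shift[OF c])
    fix y assume y: "y \<in> {y \<in> G. f y = 0}" and xy: "\<And>j. j < n \<Longrightarrow> x (Suc j) y = 0"
    have "g y = 0" using y inj by (simp add: f_def)
    moreover have "x j y = 0" if "1 \<le> j" "j \<le> n" for j using xy that by (cases j) auto
    ultimately show "x 0 y = 0" using gx y by auto
  qed auto
  moreover have "is_supp p (\<theta> a)"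
    unfolding is_supp_def
  proof (intro conjI allI impI)
    show "p * p = p" using supp by (simp add: is_supp_def)
    show "p * \<theta> a = \<theta> a" using p\<theta> a by blast
    fix r assume "r * \<theta> a = 0"
    then have "\<theta> (r * a) = 0" using lin_on_scale[OF \<theta> a] by simp
    then have "r * a = 0" using inj rideal_mult[OF J a] by blast
    then show "r * p = 0" using supp by (simp add: is_supp_def)
  qed
  moreover have "\<theta> a \<in> f ` G" "\<theta> v \<in> f ` G" using a v im by blast+
  moreover have "p *s y = y" if "y \<in> G" for y
    by (rule coords_scale_id[OF c G that]) (use px that in auto)
  ultimately show ?thesis using f ef s ep v(2) by blast
qed

text \<open>Modulo \<open>d\<close> the module behaves like a sum of cyclic ones, generated by the
  \<open>u j\<close> with coordinates \<open>x' j\<close>. The element \<open>g\<close>, on which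
  only coordinate 0 is nonzero, guarantees that any functional with coefficient 1 at
  \<open>x' 0\<close> still takes the value \<open>a\<close> and so has full support.\<close>

lemma normal_form:
  assumes "coords n x G" and "fin_gen scale G" and d: "regular d"
  shows "\<exists>x' u. coords n x' G \<and> (\<forall>j<n. u j \<in> G) \<and>
    (\<forall>y\<in>G. \<exists>z\<in>G. y = (\<Sum>j<n. x' j y *s u j) + d *s z) \<and>
    (n > 0 \<longrightarrow> (\<exists>p a g. e * p = p \<and> is_supp p a \<and> (\<forall>y\<in>G. p *s y = y) \<and> g \<in> G \<and> x' 0 g = a \<and>
      (\<forall>j<n. 0 < j \<longrightarrow> x' j g = 0) \<and> d dvd x' 0 (u 0) - p))"
  using assms(1,2)
proof (induction n arbitrary: x G)
  case 0
  have "y = d *s 0" if "y \<in> G" for y using coordsD(3)[OF 0(1) that] by simp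
  moreover have "0 \<in> G" by (rule subspace_0[OF fin_gen_subspace[OF 0(2)]])
  ultimately have "\<exists>z\<in>G. y = d *s z" if "y \<in> G" for y using that by blast
  then show ?case using 0(1) by (intro exI[of _ x] exI[of _ undefined]) auto
next
  case (Suc n)
  have G: "subspace G" by (rule fin_gen_subspace[OF Suc.prems(2)])
  obtain f s p a v where f: "functional G f" and ef: "\<forall>y\<in>G. e * f y = f y"
    and s: "lin_on (*) scale (f ` G) s" "\<forall>r\<in>f ` G. s r \<in> G \<and> f (s r) = r"
    and c: "coords n (\<lambda>j. x (Suc j)) {y \<in> G. f y = 0}"
    and p: "e * p = p" and a: "a \<in> f ` G" "is_supp p a" and py: "\<forall>y\<in>G. p *s y = y"
    and v: "v \<in> f ` G" "d dvd v - p"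
    using coordinate_step[OF Suc.prems d] by (elim exE conjE) (rule that)
  note sp = splitting[OF G f s]
  define K where "K = {y \<in> G. f y = 0}"
  note sp = sp[folded K_def]
  obtain w u where w: "coords n w K" and u: "\<forall>j<n. u j \<in> K"
    and K: "\<forall>y\<in>K. \<exists>z\<in>K. y = (\<Sum>j<n. w j y *s u j) + d *s z"
    using Suc.IH[OF c sp(4)[OF Suc.prems(2), unfolded K_def]] unfolding K_def[symmetric]
    by (elim exE conjE) (rule that)
  define x' where "x' = case_nat f (\<lambda>i y. w i (y - s (f y)))"
  define u' where "u' = case_nat (s v) u"
  have KG: "y \<in> G" if "y \<in> K" for y using that by (simp add: K_def)
  have "coords (Suc n) x' G"
    unfolding coords_def
  proof (intro conjI allI impI ballI)
    fix j assume j: "j < Suc n"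
    show "functional G (x' j)"
      using j f by (cases j) (auto simp: x'_def intro!: lin_on_comp[OF sp(3) coordsD(1)[OF w]] sp(2))
    show "e * x' j g = x' j g" if "g \<in> G" for g
      using j ef that coordsD(2)[OF w] sp(2)[OF that] by (cases j) (auto simp: x'_def)
  next
    fix y assume y: "y \<in> G" "\<forall>j<Suc n. x' j y = 0"
    have fy: "f y = 0" using y(2)[rule_format, of 0] by (simp add: x'_def)
    then have yK: "y \<in> K" using y by (simp add: K_def)
    have "w j y = 0" if "j < n" for j
      using y(2)[rule_format, of "Suc j"] that fy by (simp add: x'_def sp(5))
    then show "y = 0" using coordsD(3)[OF w yK] by blast
  qed
  moreover have "u' j \<in> G" if "j < Suc n" for j
    using that u v s KG by (cases j) (auto simp: u'_def)
  moreover have "\<exists>z\<in>G. y = (\<Sum>j<Suc n. x' j y *s u' j) + d *s z" if y: "y \<in> G" for y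
  proof -
    have k: "y - s (f y) \<in> K" by (rule sp(2)[OF y])
    then obtain z where z: "z \<in> K" "y - s (f y) = (\<Sum>j<n. w j (y - s (f y)) *s u j) + d *s z"
      using K by blast
    obtain t where t: "v - p = d * t" using v(2) by blast
    have pf: "p * f y = f y" using py y lin_on_scale[OF f y, of p] by metis
    \<comment> \<open>\<open>v - p\<close> is divisible by \<open>d\<close>, so f(y) is f(y) v up to
      a multiple of d f(y); the section turns this into a multiple of \<open>s v\<close> plus an
      element of dG.\<close>
    have "f y * v - f y * (v - p) = p * f y" by (simp add: algebra_simps)
    then have "f y = f y * v - f y * (d * t)" using t pf by simp
    then have "s (f y) = s (f y * v - f y * (d * t))" by (rule arg_cong)
    also have "f y * v - f y * (d * t) = f y * v + (- (d * t)) * f y" by (simp add: algebra_simps)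
    also have "s \<dots> = s (f y * v) + s ((- (d * t)) * f y)"
    proof (rule lin_on_add[OF s(1)])
      have J: "rideal (f ` G)" by (rule module_pair.subspace_image[OF pair_VR G f])
      show "f y * v \<in> f ` G" by (rule rideal_mult[OF J v(1)])
      show "- (d * t) * f y \<in> f ` G" by (rule rideal_mult[OF J]) (use y in blast)
    qed
    also have "\<dots> = f y *s s v + (- (d * t)) *s s (f y)"
      using lin_on_scale[OF s(1) v(1), of "f y"] lin_on_scale[OF s(1) imageI[OF y], of "- (d * t)"]
      by (simp only:)
    finally have sf: "s (f y) = f y *s s v + d *s (- (t *s s (f y)))" by simp
    have "y = s (f y) + (y - s (f y))" by simp
    also have "\<dots> = (f y *s s v + d *s (- (t *s s (f y)))) + ((\<Sum>j<n. w j (y - s (f y)) *s u j) + d *s z)"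
      by (subst z(2), subst sf) (rule refl)
    also have "\<dots> = (\<Sum>j<Suc n. x' j y *s u' j) + d *s (z - t *s s (f y))"
      unfolding sum.lessThan_Suc_shift by (simp add: x'_def u'_def scale_right_diff_distrib)
    finally have "y = (\<Sum>j<Suc n. x' j y *s u' j) + d *s (z - t *s s (f y))" .
    moreover have "z - t *s s (f y) \<in> G"
      using z KG s y by (intro subspace_diff[OF G] subspace_scale[OF G]) auto
    ultimately show ?thesis by blast
  qed
  moreover have fsa: "f (s a) = a" and fsv: "f (s v) = v" using s(2) a(1) v(1) by blast+
  then have "x' 0 (s a) = a" "x' 0 (u' 0) = v" by (simp_all add: x'_def u'_def)
  moreover have "x' j (s a) = 0" if j: "j < Suc n" "0 < j" for j
  proof -
    obtain i where i: "j = Suc i" using j by (cases j) auto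
    have Ks: "subspace K" using sp(1) .
    show ?thesis using fsa functional_0[OF Ks coordsD(1)[OF w, of i]] j i by (simp add: x'_def)
  qed
  moreover have "s a \<in> G" using s a by blast
  ultimately show ?case using p a py v by blast
qed

end

section \<open>Splitting off the content\<close>

definition iprod :: "'a::comm_ring_1 set \<Rightarrow> 'a set \<Rightarrow> 'a set" where
  "iprod I J = rspan {a * b | a b. a \<in> I \<and> b \<in> J}"

lemma iprodI: "a \<in> I \<Longrightarrow> b \<in> J \<Longrightarrow> a * b \<in> iprod I J"
  unfolding iprod_def by (rule Modules.module.span_base[OF module_mult]) blast

lemma iprod_rideal: "rideal (iprod I J)"
  unfolding iprod_def by (rule rideal_span)

lemma iprod_minimal: "rideal K \<Longrightarrow> (\<And>a b. a \<in> I \<Longrightarrow> b \<in> J \<Longrightarrow> a * b \<in> K) \<Longrightarrow> iprod I J \<subseteq> K"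
  unfolding iprod_def by (rule Modules.module.span_minimal[OF module_mult]) auto

context hereditary_corner_module
begin

lemma functional_values_rideal:
  fixes n :: nat
  assumes H: "subspace H" and X: "\<And>j. j < n \<Longrightarrow> functional H (X j)"
  shows "rideal {(\<Sum>j<n. X j (h j)) | h. \<forall>j. h j \<in> H}"
  unfolding rideal_def
proof (intro conjI ballI allI)
  have "(\<Sum>j<n. X j 0) = 0"
    using functional_0[OF H X] by (intro sum.neutral) simp
  then show "0 \<in> {(\<Sum>j<n. X j (h j)) | h. \<forall>j. h j \<in> H}"
    using subspace_0[OF H] by (intro CollectI exI[of _ "\<lambda>_. 0"]) simp
next
  fix y z assume "y \<in> {(\<Sum>j<n. X j (h j)) | h. \<forall>j. h j \<in> H}" "z \<in> {(\<Sum>j<n. X j (h j)) | h. \<forall>j. h j \<in> H}"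
  then obtain h h' where *: "y = (\<Sum>j<n. X j (h j))" "\<forall>j. h j \<in> H"
    "z = (\<Sum>j<n. X j (h' j))" "\<forall>j. h' j \<in> H" by blast
  have "(\<Sum>j<n. X j (h j + h' j)) = y + z"
    unfolding * sum.distrib[symmetric] by (rule sum.cong) (use * in \<open>auto intro!: lin_on_add[OF X]\<close>)
  moreover have "\<forall>j. h j + h' j \<in> H" using * subspace_add[OF H] by blast
  ultimately show "y + z \<in> {(\<Sum>j<n. X j (h j)) | h. \<forall>j. h j \<in> H}"
    by (intro CollectI exI[of _ "\<lambda>j. h j + h' j"] conjI) simp_all
next
  fix k y assume "y \<in> {(\<Sum>j<n. X j (h j)) | h. \<forall>j. h j \<in> H}"
  then obtain h where *: "y = (\<Sum>j<n. X j (h j))" "\<forall>j. h j \<in> H" by blast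
  have "(\<Sum>j<n. X j (k *s h j)) = k * y"
    unfolding * sum_distrib_left by (rule sum.cong) (use * in \<open>auto intro!: lin_on_scale[OF X]\<close>)
  moreover have "\<forall>j. k *s h j \<in> H" using * subspace_scale[OF H] by blast
  ultimately show "k * y \<in> {(\<Sum>j<n. X j (h j)) | h. \<forall>j. h j \<in> H}"
    by (intro CollectI exI[of _ "\<lambda>j. k *s h j"] conjI) simp_all
qed

text \<open>The inductive step of the stacked decomposition. Minimality of \<open>I\<close> bounds
  it by the content found one step earlier, and the clause on functionals bounds the contents found
  later. That \<open>p\<close> acts as the identity on \<open>G\<close> will make the supports
  decrease.\<close>

lemma content_splitting:
  assumes c: "coords (Suc n) x G" and fg: "fin_gen scale G" and H: "subspace H" and HG: "H \<subseteq> G"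
    and d: "regular d" and dG: "\<forall>y\<in>G. d *s y \<in> H"
  shows "\<exists>f s I p x'. functional G f \<and> (\<forall>y\<in>G. e * f y = f y) \<and> lin_on (*) scale (f ` G) s \<and>
    (\<forall>r\<in>f ` G. s r \<in> G \<and> f (s r) = r) \<and> coords n x' {y \<in> G. f y = 0} \<and>
    rideal I \<and> d \<in> I \<and> (\<forall>h\<in>H. f h \<in> iprod I (f ` G)) \<and> (\<forall>r\<in>iprod I (f ` G). s r \<in> H) \<and>
    (\<forall>I0. rideal I0 \<longrightarrow> d \<in> I0 \<longrightarrow> (\<forall>g. functional G g \<longrightarrow> (\<forall>h\<in>H. g h \<in> I0)) \<longrightarrow> I \<subseteq> I0) \<and>
    (\<forall>g. functional G g \<longrightarrow> (\<forall>h\<in>H. g h \<in> I)) \<and>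
    e * p = p \<and> (\<exists>a\<in>f ` G. is_supp p a) \<and> (\<forall>y\<in>G. p *s y = y)"
proof -
  have G: "subspace G" by (rule fin_gen_subspace[OF fg])
  note nz = nzd_cancel[OF regular_nzd[OF d]]
  have tf: "y = y'" if "y \<in> G" "y' \<in> G" "d *s y = d *s y'" for y y'
    by (rule coords_torsion_free[OF c G regular_nzd[OF d] that])
  have HinG: "y \<in> G" if "y \<in> H" for y using HG that by blast
  obtain X u p a g0 where X: "coords (Suc n) X G" and u: "\<forall>j<Suc n. u j \<in> G"
    and expand: "\<forall>y\<in>G. \<exists>z\<in>G. y = (\<Sum>j<Suc n. X j y *s u j) + d *s z"
    and ep: "e * p = p" and supp: "is_supp p a" and py: "\<forall>y\<in>G. p *s y = y"
    and g0: "g0 \<in> G" "X 0 g0 = a" "\<forall>j<Suc n. 0 < j \<longrightarrow> X j g0 = 0" and Xu: "d dvd X 0 (u 0) - p"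
    using normal_form[OF c fg d] by (elim exE conjE impE) (rule zero_less_Suc, rule that)
  have pp': "p * p = p" using supp by (simp add: is_supp_def)
  have Xf: "functional G (X j)" and eX: "\<And>y. y \<in> G \<Longrightarrow> e * X j y = X j y" if "j < Suc n" for j
    using coordsD(1,2)[OF X] that by blast+
  have pX: "p * X j y = X j y" if "j < Suc n" "y \<in> G" for j y
    using lin_on_scale[OF Xf[OF that(1)] that(2), of p] py that by simp
  have XH: "functional K (X j)" if "K \<subseteq> G" "j < Suc n" for K j
    using lin_on_subset[OF Xf] that by blast
  \<comment> \<open>The coordinates suffice: by the expansion in the \<open>u j\<close>, every
    functional on \<open>G\<close> takes its values on \<open>H\<close> in V + dT.\<close>
  define V where "V = {(\<Sum>j<Suc n. X j (h j)) | h. \<forall>j. h j \<in> H}"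
  have V: "rideal V" unfolding V_def by (rule functional_values_rideal[OF H XH[OF HG]])
  define I where "I = {v + r * d | v r. v \<in> V}"
  have I: "rideal I" and dI: "d \<in> I"
    unfolding I_def by (rule rideal_adjoin[OF V], rule rideal_adjoin_mem(2)[OF V])
  have gI: "g h \<in> I" if g: "functional G g" and h: "h \<in> H" for g h
  proof -
    obtain z where z: "z \<in> G" "h = (\<Sum>j<Suc n. X j h *s u j) + d *s z" using expand HinG[OF h] by blast
    have uG: "X j h *s u j \<in> G" if "j < Suc n" for j using u that subspace_scale[OF G] by blast
    have "g h = g ((\<Sum>j<Suc n. X j h *s u j) + d *s z)" using z by simp
    also have "\<dots> = g (\<Sum>j<Suc n. X j h *s u j) + g (d *s z)"
      by (intro lin_on_add[OF g] subspace_sum[OF G] subspace_scale[OF G] z) (use u in auto)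
    also have "g (\<Sum>j<Suc n. X j h *s u j) = (\<Sum>j<Suc n. g (X j h *s u j))"
      by (rule functional_sum[OF G g]) (use uG in auto)
    also have "\<dots> = (\<Sum>j<Suc n. X j (g (u j) *s h))"
      using u lin_on_scale[OF g] lin_on_scale[OF Xf HinG[OF h]]
      by (intro sum.cong) (simp_all add: mult.commute)
    finally have "g h = (\<Sum>j<Suc n. X j (g (u j) *s h)) + g z * d"
      using lin_on_scale[OF g z(1)] by (simp add: mult.commute)
    moreover have "(\<Sum>j<Suc n. X j (g (u j) *s h)) \<in> V"
      unfolding V_def using subspace_scale[OF H h]
      by (intro CollectI exI[of _ "\<lambda>j. g (u j) *s h"]) simp
    ultimately show ?thesis unfolding I_def by blast
  qed
  have Imin: "I \<subseteq> I0" if I0: "rideal I0" "d \<in> I0"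
    and g: "\<forall>g. functional G g \<longrightarrow> (\<forall>h\<in>H. g h \<in> I0)" for I0
    unfolding I_def V_def
    using g Xf by (auto simp del: sum.lessThan_Suc
        intro!: rideal_add[OF I0(1)] rideal_sum[OF I0(1)] rideal_mult[OF I0])
  obtain N :: nat and \<alpha> \<beta> where \<alpha>: "\<And>i. i < N \<Longrightarrow> \<alpha> i \<in> I"
    and \<beta>: "\<And>i x. i < N \<Longrightarrow> x \<in> I \<Longrightarrow> d dvd \<beta> i * x" and \<alpha>\<beta>: "(\<Sum>i<N. \<alpha> i * \<beta> i) = d"
    by (rule invE[OF I dI d]) blast
  define H1 where "H1 = {y \<in> G. \<forall>c\<in>I. c *s y \<in> H}"
  have H1: "subspace H1"
    by (auto simp: H1_def subspace_def scale_right_distrib subspace_0[OF G] subspace_0[OF H]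
        subspace_add[OF G] subspace_add[OF H] subspace_scale[OF G] rideal_mult_right[OF I]
        simp del: scale_scale simp add: scale_scale[symmetric])
      (simp add: rideal_mult_right[OF I])
  have H1G: "y \<in> G" if "y \<in> H1" for y using that by (simp add: H1_def)
  \<comment> \<open>\<open>y i\<close> stands for \<open>\<beta> i / d\<close> times
    \<open>h\<close>. It exists in \<open>G\<close> because \<open>d\<close> divides
    \<open>\<beta> i * X j h\<close> for each coordinate, and it lies in \<open>H1\<close> because
    \<open>\<beta> i / d\<close> maps \<open>I\<close> into the ring. Summing with the
    \<open>\<alpha> i\<close> shows that \<open>H\<close> is contained in I H1.\<close>
  have key: "\<exists>y. (\<forall>i<N. y i \<in> H1 \<and> d *s y i = \<beta> i *s h) \<and> h = (\<Sum>i<N. \<alpha> i *s y i)" if h: "h \<in> H" for h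
  proof -
    obtain z where z: "z \<in> G" "h = (\<Sum>j<Suc n. X j h *s u j) + d *s z" using expand HinG[OF h] by blast
    define t where "t i j = (SOME t. \<beta> i * X j h = d * t)" for i j
    have t: "\<beta> i * X j h = d * t i j" if "i < N" "j < Suc n" for i j
      unfolding t_def using \<beta>[OF that(1) gI[OF Xf[OF that(2)] h]] by (metis (mono_tags) dvdE someI_ex)
    define y where "y i = (\<Sum>j<Suc n. t i j *s u j) + \<beta> i *s z" for i
    have yG: "y i \<in> G" for i
      unfolding y_def using u by (intro subspace_add[OF G] subspace_sum[OF G] subspace_scale[OF G] z) auto
    have dy: "d *s y i = \<beta> i *s h" if i: "i < N" for i
    proof -
      have "d *s y i = (\<Sum>j<Suc n. (d * t i j) *s u j) + (d * \<beta> i) *s z"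
        by (simp add: y_def scale_right_distrib scale_sum_right del: sum.lessThan_Suc)
      also have "(\<Sum>j<Suc n. (d * t i j) *s u j) = (\<Sum>j<Suc n. (\<beta> i * X j h) *s u j)"
        using t[OF i] by (intro sum.cong) auto
      also have "\<dots> + (d * \<beta> i) *s z = \<beta> i *s ((\<Sum>j<Suc n. X j h *s u j) + d *s z)"
        by (simp add: scale_right_distrib scale_sum_right mult.commute del: sum.lessThan_Suc)
      finally show ?thesis using z by simp
    qed
    have "y i \<in> H1" if i: "i < N" for i
    proof -
      have "k *s y i \<in> H" if k: "k \<in> I" for k
      proof -
        obtain q where q: "\<beta> i * k = d * q" using \<beta>[OF i k] by blast
        have "d *s (k *s y i) = k *s (d *s y i)" by (rule scale_left_commute)
        also have "\<dots> = (\<beta> i * k) *s h" by (simp add: dy[OF i] mult.commute)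
        also have "\<dots> = d *s (q *s h)" by (simp add: q)
        finally have "k *s y i = q *s h"
          by (rule tf[rotated 2]) (use yG HinG[OF h] in \<open>auto intro: subspace_scale[OF G]\<close>)
        then show ?thesis using subspace_scale[OF H h] by simp
      qed
      then show ?thesis using yG by (simp add: H1_def)
    qed
    moreover have "h = (\<Sum>i<N. \<alpha> i *s y i)"
    proof (rule tf)
      show "(\<Sum>i<N. \<alpha> i *s y i) \<in> G" by (intro subspace_sum[OF G] subspace_scale[OF G] yG)
      have "d *s h = (\<Sum>i<N. \<alpha> i * \<beta> i) *s h" using \<alpha>\<beta> by simp
      also have "\<dots> = (\<Sum>i<N. \<alpha> i *s (\<beta> i *s h))" by (simp add: scale_sum_left)
      also have "\<dots> = (\<Sum>i<N. \<alpha> i *s (d *s y i))" using dy by (intro sum.cong) auto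
      also have "\<dots> = d *s (\<Sum>i<N. \<alpha> i *s y i)" by (simp add: scale_sum_right mult.commute)
      finally show "d *s h = d *s (\<Sum>i<N. \<alpha> i *s y i)" .
    qed (rule HinG[OF h])
    ultimately show ?thesis using dy by blast
  qed
  \<comment> \<open>The content of \<open>H1\<close> in the coordinates. The aim is \<open>p\<close>
    in W + dT: dividing by \<open>I\<close> makes the content trivial.\<close>
  define W where "W = {(\<Sum>j<Suc n. X j (h j)) | h. \<forall>j. h j \<in> H1}"
  have H1_sub: "H1 \<subseteq> G" using H1G by blast
  have W: "rideal W" unfolding W_def by (rule functional_values_rideal[OF H1 XH[OF H1_sub]])
  have XW: "X j y \<in> W" if j: "j < Suc n" and y: "y \<in> H1" for j y
  proof -
    have "X i (if i = j then y else 0) = (if i = j then X j y else 0)" if "i < Suc n" for i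
      using functional_0[OF G Xf[OF that]] by simp
    then have "(\<Sum>i<Suc n. X i (if i = j then y else 0)) = (\<Sum>i<Suc n. if i = j then X j y else 0)"
      by (intro sum.cong) auto
    also have "\<dots> = X j y" using j by (simp del: sum.lessThan_Suc)
    finally have "X j y = (\<Sum>i<Suc n. X i ((\<lambda>i. if i = j then y else 0) i))" by simp
    moreover have "\<forall>i. (\<lambda>i. if i = j then y else 0) i \<in> H1" using y subspace_0[OF H1] by simp
    ultimately show ?thesis
      unfolding W_def by (intro CollectI exI[of _ "\<lambda>i. if i = j then y else 0"] conjI)
  qed
  have \<beta>X: "\<exists>w\<in>W. \<beta> i * X j h = d * w" if i: "i < N" and j: "j < Suc n" and h: "h \<in> H" for i j h
  proof -
    obtain y where y: "y \<in> H1" "d *s y = \<beta> i *s h" using key[OF h] i by blast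
    have "\<beta> i * X j h = d * X j y"
      using lin_on_scale[OF Xf[OF j] HinG[OF h], of "\<beta> i"] lin_on_scale[OF Xf[OF j] H1G[OF y(1)], of d] y
      by simp
    then show ?thesis using XW[OF j y(1)] by blast
  qed
  have "\<exists>w\<in>W. \<exists>t. p * (\<alpha> i * \<beta> i) = d * (w + d * t)" if i: "i < N" for i
  proof -
    obtain h r where h: "\<alpha> i = (\<Sum>j<Suc n. X j (h j)) + r * d" "\<forall>j. h j \<in> H"
      using \<alpha>[OF i] unfolding I_def V_def by blast
    have "\<forall>j\<in>{..<Suc n}. \<exists>w. w \<in> W \<and> \<beta> i * X j (h j) = d * w" using \<beta>X[OF i] h by blast
    from bchoice[OF this] obtain w where w: "\<And>j. j < Suc n \<Longrightarrow> w j \<in> W"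
      "\<And>j. j < Suc n \<Longrightarrow> \<beta> i * X j (h j) = d * w j" by auto
    \<comment> \<open>The summand \<open>r * d\<close> of \<open>\<alpha> i\<close> is handled
      through \<open>u 0\<close>: \<open>d *s u 0\<close> lies in \<open>H\<close>, so
      \<open>\<beta> i * X 0 (u 0)\<close> lies in \<open>W\<close>, and \<open>X 0 (u 0)\<close> is
      \<open>p\<close> modulo \<open>d\<close>.\<close>
    obtain t0 where t0: "X 0 (u 0) - p = d * t0" using Xu by blast
    have u0: "u 0 \<in> G" using u by blast
    obtain w0 where w0: "w0 \<in> W" "\<beta> i * X 0 (d *s u 0) = d * w0"
      using \<beta>X[OF i zero_less_Suc, of "d *s u 0"] dG u0 by blast
    have "d * (\<beta> i * X 0 (u 0)) = d * w0"
      using w0(2) lin_on_scale[OF Xf[OF zero_less_Suc] u0, of d] by (simp add: mult.left_commute)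
    then have w0': "\<beta> i * X 0 (u 0) = w0" by (rule nz)
    have "X 0 (u 0) = p + d * t0" using t0 by (simp add: algebra_simps)
    then have \<beta>p: "\<beta> i * p = w0 - d * (\<beta> i * t0)" using w0' by (auto simp: algebra_simps)
    have "\<beta> i * \<alpha> i = (\<Sum>j<Suc n. \<beta> i * X j (h j)) + \<beta> i * (r * d)"
      by (simp add: h distrib_left sum_distrib_left del: sum.lessThan_Suc)
    also have "(\<Sum>j<Suc n. \<beta> i * X j (h j)) = d * (\<Sum>j<Suc n. w j)"
      unfolding sum_distrib_left using w by (intro sum.cong) auto
    finally have "p * (\<alpha> i * \<beta> i) = p * (d * (\<Sum>j<Suc n. w j) + \<beta> i * (r * d))"
      by (simp only: mult.commute)
    also have "\<dots> = d * (p * (\<Sum>j<Suc n. w j)) + d * r * (\<beta> i * p)"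
      by (simp only: distrib_left mult_ac)
    also have "\<dots> = d * (p * (\<Sum>j<Suc n. w j) + r * w0 + d * (- r * (\<beta> i * t0)))"
      unfolding \<beta>p by (simp only: right_diff_distrib distrib_left mult_minus_right mult_minus_left mult_ac)
        simp
    finally have "p * (\<alpha> i * \<beta> i) = d * ((p * (\<Sum>j<Suc n. w j) + r * w0) + d * (- r * (\<beta> i * t0)))" .
    moreover have "p * (\<Sum>j<Suc n. w j) + r * w0 \<in> W"
      using w w0 by (intro rideal_add[OF W] rideal_mult[OF W] rideal_sum[OF W]) auto
    ultimately show ?thesis by blast
  qed
  then have "\<forall>i\<in>{..<N}. \<exists>wt. fst wt \<in> W \<and> p * (\<alpha> i * \<beta> i) = d * (fst wt + d * snd wt)" by force
  from bchoice[OF this] obtain wt where wt: "\<And>i. i < N \<Longrightarrow> fst (wt i) \<in> W"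
    "\<And>i. i < N \<Longrightarrow> p * (\<alpha> i * \<beta> i) = d * (fst (wt i) + d * snd (wt i))" by auto
  have "d * p = (\<Sum>i<N. p * (\<alpha> i * \<beta> i))"
    using \<alpha>\<beta> by (simp add: mult.commute flip: sum_distrib_left)
  also have "\<dots> = d * ((\<Sum>i<N. fst (wt i)) + d * (\<Sum>i<N. snd (wt i)))"
    unfolding sum_distrib_left sum.distrib[symmetric] using wt(2) by (intro sum.cong) auto
  finally have p_eq: "p = (\<Sum>i<N. fst (wt i)) + d * (\<Sum>i<N. snd (wt i))" by (rule nz)
  have "(\<Sum>i<N. fst (wt i)) \<in> W" using wt by (intro rideal_sum[OF W]) auto
  then obtain hs where hs: "\<forall>j. hs j \<in> H1" "(\<Sum>i<N. fst (wt i)) = (\<Sum>j<Suc n. X j (hs j))"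
    unfolding W_def by blast
  define t where "t = (\<Sum>i<N. snd (wt i))"
  have p_sum: "p = (\<Sum>j\<le>n. X j (hs j)) + d * t"
    using p_eq hs by (simp add: t_def lessThan_Suc_atMost)
  have hsG: "hs j \<in> G" for j using hs H1G by blast
  \<comment> \<open>Rows are the elements \<open>hs j\<close> of \<open>H1\<close>, columns the
    coordinates. \<open>c\<close> gives the functional \<open>f\<close>; \<open>r\<close> and the
    factor \<open>w\<close> give an element of \<open>H1\<close> on which it is \<open>p\<close>
    modulo \<open>d\<close>.\<close>
  have "\<exists>r c w t. c 0 = 1 \<and> (\<Sum>j\<le>n. \<Sum>i\<le>n. r j * c i * X i (hs j)) * w = p + d * t"
  proof (rule bilinear_unimodular[OF d pp'])
    show "p * X i (hs j) = X i (hs j)" if "i \<le> n" for i j using pX[of i] hsG that by simp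
    fix P assume P: "prime_rideal P" "d \<in> P" and all: "\<forall>j\<le>n. \<forall>i\<le>n. X i (hs j) \<in> P"
    have idl: "rideal P" using P by (simp add: prime_rideal_def)
    show "p \<in> P"
      unfolding p_sum using all by (intro rideal_add[OF idl] rideal_sum[OF idl] rideal_mult_right[OF idl P(2)]) auto
  qed
  then obtain r c w t2 where c0: "c 0 = 1"
    and rc: "(\<Sum>j\<le>n. \<Sum>i\<le>n. r j * c i * X i (hs j)) * w = p + d * t2" by (elim exE conjE) (rule that)
  define f where "f y = (\<Sum>i\<le>n. c i * X i y)" for y
  have f: "functional G f"
    unfolding f_def using Xf
    by (intro module_pair.lin_on_sum_fun[OF pair_VR] module_pair.lin_on_scale_fun[OF pair_VR]) auto
  have ef: "e * f y = f y" if "y \<in> G" for y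
    unfolding f_def sum_distrib_left using eX that by (intro sum.cong) (auto simp: mult.left_commute[of e])
  have pf: "p * f y = f y" if "y \<in> G" for y
    using lin_on_scale[OF f that, of p] py that by simp
  define h where "h = w *s (\<Sum>j\<le>n. r j *s hs j)"
  have hH1: "h \<in> H1"
    unfolding h_def using hs by (intro subspace_scale[OF H1] subspace_sum[OF H1]) auto
  have "f h = w * f (\<Sum>j\<le>n. r j *s hs j)"
    unfolding h_def using hsG by (intro lin_on_scale[OF f] subspace_sum[OF G] subspace_scale[OF G])
  also have "f (\<Sum>j\<le>n. r j *s hs j) = (\<Sum>j\<le>n. f (r j *s hs j))"
    using hsG by (intro functional_sum[OF G f] subspace_scale[OF G])
  also have "\<dots> = (\<Sum>j\<le>n. r j * f (hs j))" using lin_on_scale[OF f hsG] by simp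
  also have "\<dots> = (\<Sum>j\<le>n. \<Sum>i\<le>n. r j * c i * X i (hs j))"
    by (simp add: f_def sum_distrib_left mult.assoc)
  finally have fh: "f h = p + d * t2" using rc by (simp add: mult.commute)
  \<comment> \<open>\<open>h\<close> alone reaches f(y) only modulo \<open>d\<close>; the error is
    removed by a multiple of \<open>d *s y\<close>, which is in \<open>H1\<close> since dG lies in
    \<open>H\<close>.\<close>
  have im: "f ` H1 = f ` G"
  proof
    show "f ` G \<subseteq> f ` H1"
    proof
      fix r assume "r \<in> f ` G"
      then obtain y where y: "y \<in> G" "r = f y" by blast
      have "d *s y \<in> H1"
        unfolding H1_def
      proof (intro CollectI conjI ballI)
        show "d *s y \<in> G" by (rule subspace_scale[OF G y(1)])
        fix k
        have "k *s d *s y = d *s (k *s y)" by (rule scale_left_commute)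
        moreover have "d *s (k *s y) \<in> H" using dG subspace_scale[OF G y(1)] by blast
        ultimately show "k *s d *s y \<in> H" by (simp only:)
      qed
      then have in1: "f y *s h - t2 *s (d *s y) \<in> H1"
        by (rule subspace_diff[OF H1 subspace_scale[OF H1 hH1] subspace_scale[OF H1]])
      have "f (f y *s h - t2 *s (d *s y)) = f (f y *s h) - f (t2 *s (d *s y))"
        by (intro functional_diff[OF G f] subspace_scale[OF G] y H1G hH1)
      also have "\<dots> = f y * (p + d * t2) - t2 * (d * f y)"
        using lin_on_scale[OF f H1G[OF hH1]] lin_on_scale[OF f subspace_scale[OF G y(1)]]
          lin_on_scale[OF f y(1)] fh by simp
      also have "\<dots> = p * f y" by (simp add: algebra_simps)
      finally have "r = f (f y *s h - t2 *s (d *s y))" using pf y by simp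
      then show "r \<in> f ` H1" using in1 by blast
    qed
  qed (use H1G in blast)
  have fH1: "functional H1 f" by (rule lin_on_subset[OF f]) (use H1G in blast)
  have fgf: "fin_gen (*) (f ` H1)"
    unfolding im by (rule module_pair.fin_gen_image[OF pair_VR G f fg])
  obtain s where s: "lin_on (*) scale (f ` H1) s" "\<forall>r\<in>f ` H1. s r \<in> H1 \<and> f (s r) = r"
    by (rule section_exists[OF H1 fH1 fgf ef]) (use H1G in blast)+
  have J: "rideal (f ` G)" by (rule module_pair.subspace_image[OF pair_VR G f])
  have s_lin: "lin_on (*) scale (f ` G) s" using s im by simp
  have s_in: "\<forall>r\<in>f ` G. s r \<in> G \<and> f (s r) = r" using s(2) H1G unfolding im by blast
  have fI: "f y \<in> iprod I (f ` G)" if y: "y \<in> H" for y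
  proof -
    obtain v where v: "\<forall>i<N. v i \<in> H1 \<and> d *s v i = \<beta> i *s y" "y = (\<Sum>i<N. \<alpha> i *s v i)"
      using key[OF y] by blast
    have vG: "v i \<in> G" if "i < N" for i using v that H1G by blast
    have "f (\<Sum>i<N. \<alpha> i *s v i) = (\<Sum>i<N. f (\<alpha> i *s v i))"
      using vG by (intro functional_sum[OF G f] subspace_scale[OF G]) auto
    also have "\<dots> = (\<Sum>i<N. \<alpha> i * f (v i))" using vG lin_on_scale[OF f] by (intro sum.cong) auto
    also have "\<dots> \<in> iprod I (f ` G)"
      using vG \<alpha> by (intro rideal_sum[OF iprod_rideal] iprodI) auto
    finally show ?thesis using v by simp
  qed
  \<comment> \<open>The section takes values in \<open>H1\<close>, and I H1 lies in \<open>H\<close>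
    by the definition of \<open>H1\<close>.\<close>
  have sI: "s r \<in> H" if "r \<in> iprod I (f ` G)" for r
  proof -
    have "iprod I (f ` G) \<subseteq> {r \<in> f ` G. s r \<in> H}"
    proof (rule iprod_minimal)
      show "rideal {r \<in> f ` G. s r \<in> H}"
        unfolding rideal_def
        using rideal_0[OF J] rideal_add[OF J] rideal_mult[OF J] lin_on_add[OF s_lin] lin_on_scale[OF s_lin]
          module_pair.lin_on_0[OF pair_RV J s_lin] subspace_0[OF H] subspace_add[OF H] subspace_scale[OF H]
        by (simp del: image_iff)
      fix k b assume k: "k \<in> I" "b \<in> f ` G"
      then have "s b \<in> H1" using s(2) im by blast
      then have "s (k * b) \<in> H" using k lin_on_scale[OF s_lin k(2)] by (simp add: H1_def)
      then show "k * b \<in> {r \<in> f ` G. s r \<in> H}" using rideal_mult[OF J k(2)] by blast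
    qed
    then show ?thesis using that by blast
  qed
  have coordsK: "coords n (\<lambda>j. X (Suc j)) {y \<in> G. f y = 0}"
  proof (rule coords_shift[OF X])
    fix y assume y: "y \<in> {y \<in> G. f y = 0}" and "\<And>j. j < n \<Longrightarrow> X (Suc j) y = 0"
    then have "f y = X 0 y"
      unfolding f_def using c0 by (simp add: sum.atMost_shift)
    then show "X 0 y = 0" using y by simp
  qed auto
  have "f g0 = a"
    unfolding f_def using g0 c0 by (simp add: sum.atMost_shift)
  then have "\<exists>a\<in>f ` G. is_supp p a" using g0 supp by blast
  then show ?thesis
    using f ef s_lin s_in coordsK I dI fI sI Imin gI ep py by blast
qed

end

text \<open>Summands sorted by decreasing support: at a point of the spectrum, the number of
  \<open>q j\<close> that are 1 there is the rank. Zero ideals are allowed, with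
  \<open>q j = 0\<close>, so \<open>n\<close> only bounds the ranks.\<close>

definition (in hereditary_corner) ranked :: "nat \<Rightarrow> (nat \<Rightarrow> 'a set) \<Rightarrow> (nat \<Rightarrow> 'a) \<Rightarrow> bool" where
  "ranked n J q \<longleftrightarrow>
    (\<forall>j<n. fin_gen (*) (J j) \<and> (\<forall>r\<in>J j. e * r = r) \<and> e * q j = q j \<and> (\<exists>a\<in>J j. is_supp (q j) a) \<and>
      (\<forall>r\<in>J j. q j * r = r)) \<and>
    (\<forall>i j. i \<le> j \<longrightarrow> j < n \<longrightarrow> q i * q j = q j)"

section \<open>Iterating the splitting\<close>

context hereditary_corner_module
begin

text \<open>The bound \<open>I0\<close> makes the ideals a chain: for the kernel it becomes the
  content \<open>I\<close> just split off. A functional on the kernel \<open>K\<close>, composed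
  with the projection, is a functional on \<open>G\<close>, so on H \<inter> K its values stay in
  \<open>I\<close>.\<close>

lemma stacked_full_rank:
  assumes "coords n x G" "fin_gen scale G" "subspace H" "H \<subseteq> G"
    and d: "regular d" and "\<forall>y\<in>G. d *s y \<in> H"
    and "rideal I0" "d \<in> I0" "\<forall>g. functional G g \<longrightarrow> (\<forall>h\<in>H. g h \<in> I0)"
  shows "\<exists>\<phi> J q I. ranked n J q \<and> (\<forall>j<n. functional G (\<phi> j)) \<and> (\<forall>j<n. \<forall>y\<in>G. \<phi> j y \<in> J j) \<and>
    (\<forall>r. (\<forall>j<n. r j \<in> J j) \<longrightarrow> (\<exists>y\<in>G. \<forall>j<n. \<phi> j y = r j)) \<and>
    (\<forall>y\<in>G. (\<forall>j<n. \<phi> j y = 0) \<longrightarrow> y = 0) \<and>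
    (\<forall>j<n. rideal (I j) \<and> d \<in> I j \<and> I j \<subseteq> I0) \<and> (\<forall>i j. i \<le> j \<longrightarrow> j < n \<longrightarrow> I j \<subseteq> I i) \<and>
    (\<forall>y\<in>G. y \<in> H \<longleftrightarrow> (\<forall>j<n. \<phi> j y \<in> iprod (I j) (J j)))"
  using assms(1-4,6-)
proof (induction n arbitrary: x G H I0)
  case 0
  have "y = 0" if "y \<in> G" for y using coordsD(3)[OF 0(1) that] by simp
  moreover have "0 \<in> G" "0 \<in> H" using subspace_0 fin_gen_subspace[OF 0(2)] 0(3) by blast+
  ultimately show ?case unfolding ranked_def by auto
next
  case (Suc n)
  have G: "subspace G" by (rule fin_gen_subspace[OF Suc.prems(2)])
  note H = \<open>subspace H\<close>
  obtain f s I p x' where f: "functional G f" and ef: "\<forall>y\<in>G. e * f y = f y"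
    and s: "lin_on (*) scale (f ` G) s" "\<forall>r\<in>f ` G. s r \<in> G \<and> f (s r) = r"
    and x': "coords n x' {y \<in> G. f y = 0}" and I: "rideal I" and dI: "d \<in> I"
    and fI: "\<forall>h\<in>H. f h \<in> iprod I (f ` G)" and sI: "\<forall>r\<in>iprod I (f ` G). s r \<in> H"
    and Imin: "\<forall>I0. rideal I0 \<longrightarrow> d \<in> I0 \<longrightarrow> (\<forall>g. functional G g \<longrightarrow> (\<forall>h\<in>H. g h \<in> I0)) \<longrightarrow> I \<subseteq> I0"
    and gI: "\<forall>g. functional G g \<longrightarrow> (\<forall>h\<in>H. g h \<in> I)"
    and ep: "e * p = p" and supp: "\<exists>a\<in>f ` G. is_supp p a" and py: "\<forall>y\<in>G. p *s y = y"
    using content_splitting[OF Suc.prems(1-4) d Suc.prems(5)] by (elim exE conjE) (rule that)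
  define K where "K = {y \<in> G. f y = 0}"
  note sp = splitting[OF G f s, folded K_def]
  have KG: "y \<in> G" if "y \<in> K" for y using that by (simp add: K_def)
  define t where "t y = y - s (f y)" for y
  have t_in: "t y \<in> K" if "y \<in> G" for y unfolding t_def by (rule sp(2)[OF that])
  have t: "lin_on scale scale G t" unfolding t_def by (rule sp(3))
  have t_id: "t y = y" if "y \<in> K" for y using that sp(5) by (simp add: t_def K_def)
  have fgJ: "fin_gen (*) (f ` G)" by (rule module_pair.fin_gen_image[OF pair_VR G f Suc.prems(2)])
  have J: "rideal (f ` G)" by (rule module_pair.subspace_image[OF pair_VR G f])
  have HK: "subspace (H \<inter> K)" by (rule subspace_inter[OF H sp(1)])
  have "\<exists>\<phi> J q I'. ranked n J q \<and> (\<forall>j<n. functional K (\<phi> j)) \<and> (\<forall>j<n. \<forall>y\<in>K. \<phi> j y \<in> J j) \<and>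
    (\<forall>r. (\<forall>j<n. r j \<in> J j) \<longrightarrow> (\<exists>y\<in>K. \<forall>j<n. \<phi> j y = r j)) \<and>
    (\<forall>y\<in>K. (\<forall>j<n. \<phi> j y = 0) \<longrightarrow> y = 0) \<and>
    (\<forall>j<n. rideal (I' j) \<and> d \<in> I' j \<and> I' j \<subseteq> I) \<and> (\<forall>i j. i \<le> j \<longrightarrow> j < n \<longrightarrow> I' j \<subseteq> I' i) \<and>
    (\<forall>y\<in>K. y \<in> H \<inter> K \<longleftrightarrow> (\<forall>j<n. \<phi> j y \<in> iprod (I' j) (J j)))"
  proof (rule Suc.IH[OF x'[folded K_def] sp(4)[OF Suc.prems(2)] HK _ _ I dI])
    show "\<forall>y\<in>K. d *s y \<in> H \<inter> K" using Suc.prems(5) KG subspace_scale[OF sp(1)] by blast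
    show "\<forall>g. functional K g \<longrightarrow> (\<forall>h\<in>H \<inter> K. g h \<in> I)"
    proof (intro allI impI ballI)
      fix g h assume g: "functional K g" and h: "h \<in> H \<inter> K"
      have "functional G (\<lambda>y. g (t y))" by (rule lin_on_comp[OF t g]) (rule t_in)
      then have "g (t h) \<in> I" using gI h by blast
      then show "g h \<in> I" using t_id h by simp
    qed
  qed blast
  then obtain \<phi> J' q I' where rk: "ranked n J' q" and \<phi>: "\<forall>j<n. functional K (\<phi> j)"
    and \<phi>_in: "\<forall>j<n. \<forall>y\<in>K. \<phi> j y \<in> J' j"
    and surj: "\<forall>r. (\<forall>j<n. r j \<in> J' j) \<longrightarrow> (\<exists>y\<in>K. \<forall>j<n. \<phi> j y = r j)"
    and inj: "\<forall>y\<in>K. (\<forall>j<n. \<phi> j y = 0) \<longrightarrow> y = 0"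
    and I': "\<forall>j<n. rideal (I' j) \<and> d \<in> I' j \<and> I' j \<subseteq> I"
    and chain: "\<forall>i j. i \<le> j \<longrightarrow> j < n \<longrightarrow> I' j \<subseteq> I' i"
    and mem: "\<forall>y\<in>K. y \<in> H \<inter> K \<longleftrightarrow> (\<forall>j<n. \<phi> j y \<in> iprod (I' j) (J' j))"
    by (elim exE conjE) (rule that)
  define \<phi>' where "\<phi>' = case_nat f (\<lambda>j y. \<phi> j (t y))"
  define J'' where "J'' = case_nat (f ` G) J'"
  define q' where "q' = case_nat p q"
  define I'' where "I'' = case_nat I I'"
  have J'0: "0 \<in> J' j" if "j < n" for j
    using rk that rideal_0[OF module.fin_gen_subspace[OF module_mult]] unfolding ranked_def by blast
  \<comment> \<open>\<open>J' j\<close> has an element \<open>a\<close> of support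
    \<open>q j\<close> that is a value of a functional on \<open>K\<close>, and \<open>p\<close>
    acts as the identity on \<open>K\<close>; hence \<open>p\<close> fixes \<open>a\<close> and then
    \<open>q j\<close>.\<close>
  have pq: "p * q j = q j" if j: "j < n" for j
  proof -
    obtain a where a: "a \<in> J' j" "is_supp (q j) a" using rk j unfolding ranked_def by blast
    have "\<forall>i<n. (if i = j then a else 0) \<in> J' i" using a J'0 by auto
    then obtain k where k: "k \<in> K" "\<phi> j k = a" using surj[rule_format, of "\<lambda>i. if i = j then a else 0"] j by auto
    have "p * a = a" using lin_on_scale[OF \<phi>[rule_format, OF j] k(1), of p] py KG[OF k(1)] k by simp
    then have "(1 - p) * a = 0" by (simp add: left_diff_distrib)
    then have "(1 - p) * q j = 0" using a by (simp add: is_supp_def)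
    then show ?thesis by (simp add: left_diff_distrib)
  qed
  have pp': "p * p = p" using supp by (auto simp: is_supp_def)
  have pf: "p * f y = f y" if "y \<in> G" for y
    using lin_on_scale[OF f that, of p] py that by simp
  have "ranked (Suc n) J'' q'"
    unfolding ranked_def
  proof (intro conjI allI impI)
    fix j assume j: "j < Suc n"
    show "fin_gen (*) (J'' j)" "\<forall>r\<in>J'' j. e * r = r" "e * q' j = q' j" "\<exists>a\<in>J'' j. is_supp (q' j) a"
        "\<forall>r\<in>J'' j. q' j * r = r"
      using rk[unfolded ranked_def] j fgJ ef ep supp pf by (cases j; simp add: J''_def q'_def)+
  next
    fix i j :: nat assume "i \<le> j" "j < Suc n"
    then show "q' i * q' j = q' j"
      using rk[unfolded ranked_def] pp' pq by (cases i; cases j) (auto simp: q'_def)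
  qed
  moreover have "functional G (\<phi>' j)" if j: "j < Suc n" for j
    using j f \<phi> by (cases j) (auto simp: \<phi>'_def intro!: lin_on_comp[OF t] t_in)
  moreover have "\<phi>' j y \<in> J'' j" if "j < Suc n" "y \<in> G" for j y
    using that \<phi>_in t_in by (cases j) (auto simp: \<phi>'_def J''_def)
  moreover have "\<exists>y\<in>G. \<forall>j<Suc n. \<phi>' j y = r j" if r: "\<forall>j<Suc n. r j \<in> J'' j" for r
  proof -
    have "\<forall>j<n. r (Suc j) \<in> J' j" using r by (auto simp: J''_def)
    then obtain k where k: "k \<in> K" "\<forall>j<n. \<phi> j k = r (Suc j)"
      using surj[rule_format, of "\<lambda>j. r (Suc j)"] by blast
    have r0: "r 0 \<in> f ` G" using r[rule_format, of 0] by (simp add: J''_def)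
    have s0: "s (r 0) \<in> G" "f (s (r 0)) = r 0" using s(2) r0 by blast+
    have "f (s (r 0) + k) = r 0" using lin_on_add[OF f s0(1) KG[OF k(1)]] s0 k by (simp add: K_def)
    moreover from this have "t (s (r 0) + k) = k" by (simp add: t_def)
    ultimately have "\<phi>' j (s (r 0) + k) = r j" if "j < Suc n" for j
      using that k by (cases j) (auto simp: \<phi>'_def)
    then show ?thesis using subspace_add[OF G s0(1) KG[OF k(1)]] by blast
  qed
  moreover have "y = 0" if y: "y \<in> G" "\<forall>j<Suc n. \<phi>' j y = 0" for y
  proof -
    have fy: "f y = 0" using y(2)[rule_format, of 0] by (simp add: \<phi>'_def)
    then have yK: "y \<in> K" using y by (simp add: K_def)
    have "\<phi> j y = 0" if "j < n" for j
      using y(2)[rule_format, of "Suc j"] that t_id[OF yK] by (simp add: \<phi>'_def)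
    then show ?thesis using inj yK by blast
  qed
  moreover have II0: "I \<subseteq> I0" using Imin Suc.prems(6-8) by blast
  moreover have "rideal (I'' j) \<and> d \<in> I'' j \<and> I'' j \<subseteq> I0" if "j < Suc n" for j
    using that I dI I' II0 by (cases j) (auto simp: I''_def)
  moreover have "I'' j \<subseteq> I'' i" if "i \<le> j" "j < Suc n" for i j
    using that I' chain by (cases i; cases j) (simp_all add: I''_def)
  moreover have "y \<in> H \<longleftrightarrow> (\<forall>j<Suc n. \<phi>' j y \<in> iprod (I'' j) (J'' j))" if y: "y \<in> G" for y
  proof -
    have "(\<forall>j<Suc n. \<phi>' j y \<in> iprod (I'' j) (J'' j)) \<longleftrightarrow>
        f y \<in> iprod I (f ` G) \<and> (\<forall>j<n. \<phi> j (t y) \<in> iprod (I' j) (J' j))"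
      unfolding All_less_Suc2 by (simp add: \<phi>'_def I''_def J''_def)
    also have "\<dots> \<longleftrightarrow> f y \<in> iprod I (f ` G) \<and> t y \<in> H \<inter> K" using mem t_in[OF y] by blast
    also have "\<dots> \<longleftrightarrow> y \<in> H"
    proof
      assume a: "f y \<in> iprod I (f ` G) \<and> t y \<in> H \<inter> K"
      then have "s (f y) + t y \<in> H" using sI subspace_add[OF H] by blast
      then show "y \<in> H" by (simp add: t_def)
    next
      assume a: "y \<in> H"
      then have "f y \<in> iprod I (f ` G)" using fI by blast
      moreover from this have "t y \<in> H" unfolding t_def using sI subspace_diff[OF H a] by blast
      ultimately show "f y \<in> iprod I (f ` G) \<and> t y \<in> H \<inter> K" using t_in[OF y] by blast
    qed
    finally show ?thesis by blast
  qed
  ultimately show ?case by (intro exI[of _ \<phi>'] exI[of _ J''] exI[of _ q'] exI[of _ I'']) simp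
qed

text \<open>The full-rank case is applied twice: to \<open>H\<close> in its purification
  \<open>K\<close>, and to the complement \<open>C\<close> inside itself, where it merely decomposes
  a projective module into ideals with decreasing supports.\<close>

theorem stacked_decomposition:
  assumes c: "coords n x G" and fg: "fin_gen scale G" and fH: "fin_gen scale H" and HG: "H \<subseteq> G"
  shows "\<exists>d \<phi> J q I \<psi> L w. regular d \<and> ranked n J q \<and> ranked n L w \<and>
    (\<forall>j<n. functional G (\<phi> j) \<and> functional G (\<psi> j)) \<and>
    (\<forall>j<n. \<forall>y\<in>G. \<phi> j y \<in> J j \<and> \<psi> j y \<in> L j) \<and>
    (\<forall>r r'. (\<forall>j<n. r j \<in> J j \<and> r' j \<in> L j) \<longrightarrow> (\<exists>y\<in>G. \<forall>j<n. \<phi> j y = r j \<and> \<psi> j y = r' j)) \<and>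
    (\<forall>y\<in>G. (\<forall>j<n. \<phi> j y = 0 \<and> \<psi> j y = 0) \<longrightarrow> y = 0) \<and>
    (\<forall>j<n. rideal (I j) \<and> d \<in> I j) \<and> (\<forall>i j. i \<le> j \<longrightarrow> j < n \<longrightarrow> I j \<subseteq> I i) \<and>
    (\<forall>y\<in>G. y \<in> H \<longleftrightarrow> (\<forall>j<n. \<phi> j y \<in> iprod (I j) (J j) \<and> \<psi> j y = 0))"
proof -
  have G: "subspace G" by (rule fin_gen_subspace[OF fg])
  have H: "subspace H" by (rule fin_gen_subspace[OF fH])
  obtain \<rho> d where \<rho>: "lin_on scale scale G \<rho>" and \<rho>_in: "\<forall>y\<in>G. \<rho> y \<in> G \<and> \<rho> (\<rho> y) = \<rho> y"
    and \<rho>H: "\<forall>y\<in>H. \<rho> y = 0" and d: "regular d" and dH: "\<forall>y\<in>G. \<rho> y = 0 \<longrightarrow> d *s y \<in> H"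
    using purification[OF c fg fH HG] by (elim exE conjE) (rule that)
  define K where "K = {y \<in> G. \<rho> y = 0}"
  define C where "C = \<rho> ` G"
  define t where "t y = y - \<rho> y" for y
  have t: "lin_on scale scale G t"
    unfolding t_def by (intro module_pair.lin_on_diff_fun[OF pair_VV] lin_on_id \<rho>)
  have KG: "y \<in> G" if "y \<in> K" for y using that by (simp add: K_def)
  have CG: "C \<subseteq> G" using \<rho>_in by (auto simp: C_def)
  have K: "subspace K" unfolding K_def by (rule module_pair.subspace_kernel[OF pair_VV G \<rho>])
  have t_in: "t y \<in> K" if "y \<in> G" for y
    using module_pair.lin_on_diff[OF pair_VV G \<rho> that, of "\<rho> y"] \<rho>_in that subspace_diff[OF G that]
    by (simp add: K_def t_def)
  have t_id: "t y = y" if "y \<in> K" for y using that by (simp add: t_def K_def)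
  have "t ` G = K" using t_in t_id KG by (auto intro!: image_eqI)
  then have fgK: "fin_gen scale K" using module_pair.fin_gen_image[OF pair_VV G t fg] by simp
  have fgC: "fin_gen scale C" unfolding C_def by (rule module_pair.fin_gen_image[OF pair_VV G \<rho> fg])
  have C: "subspace C" by (rule fin_gen_subspace[OF fgC])
  have \<rho>_id: "\<rho> y = y" if "y \<in> C" for y using that \<rho>_in by (auto simp: C_def)
  have HK: "H \<subseteq> K" using HG \<rho>H by (auto simp: K_def)
  have cK: "coords n x K" by (rule coords_subset[OF c]) (use KG in blast)
  have cC: "coords n x C" by (rule coords_subset[OF c CG])
  have dK: "\<forall>y\<in>K. d *s y \<in> H" using dH by (simp add: K_def)
  have U: "rideal (UNIV :: 'a set)" by (simp add: rideal_def)
  have triv: "\<forall>g. functional A g \<longrightarrow> (\<forall>h\<in>B. g h \<in> UNIV)" for A B by simp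
  obtain \<phi> J q I where rk: "ranked n J q" and \<phi>: "\<forall>j<n. functional K (\<phi> j)"
    and \<phi>_in: "\<forall>j<n. \<forall>y\<in>K. \<phi> j y \<in> J j"
    and surj: "\<forall>r. (\<forall>j<n. r j \<in> J j) \<longrightarrow> (\<exists>y\<in>K. \<forall>j<n. \<phi> j y = r j)"
    and inj: "\<forall>y\<in>K. (\<forall>j<n. \<phi> j y = 0) \<longrightarrow> y = 0"
    and I: "\<forall>j<n. rideal (I j) \<and> d \<in> I j \<and> I j \<subseteq> UNIV"
    and chain: "\<forall>i j. i \<le> j \<longrightarrow> j < n \<longrightarrow> I j \<subseteq> I i"
    and mem: "\<forall>y\<in>K. y \<in> H \<longleftrightarrow> (\<forall>j<n. \<phi> j y \<in> iprod (I j) (J j))"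
    using stacked_full_rank[OF cK fgK H HK d dK U UNIV_I triv] by (elim exE conjE) (rule that)
  \<comment> \<open>For \<open>C\<close> inside itself the regular element is 1, and only the
    decomposition into ideals is kept.\<close>
  have "\<forall>y\<in>C. 1 *s y \<in> C" by simp
  from stacked_full_rank[OF cC fgC C order_refl regular_1 this U UNIV_I triv]
  obtain \<psi> L w where rk': "ranked n L w" and \<psi>: "\<forall>j<n. functional C (\<psi> j)"
    and \<psi>_in: "\<forall>j<n. \<forall>y\<in>C. \<psi> j y \<in> L j"
    and surj': "\<forall>r. (\<forall>j<n. r j \<in> L j) \<longrightarrow> (\<exists>y\<in>C. \<forall>j<n. \<psi> j y = r j)"
    and inj': "\<forall>y\<in>C. (\<forall>j<n. \<psi> j y = 0) \<longrightarrow> y = 0"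
    by (elim exE conjE) (rule that)
  have \<rho>C: "\<rho> y \<in> C" if "y \<in> G" for y using that by (simp add: C_def)
  define \<Phi> where "\<Phi> j y = \<phi> j (t y)" for j y
  define \<Psi> where "\<Psi> j y = \<psi> j (\<rho> y)" for j y
  have "functional G (\<Phi> j) \<and> functional G (\<Psi> j)" if "j < n" for j
    unfolding \<Phi>_def \<Psi>_def using that \<phi> \<psi> t_in \<rho>C by (auto intro!: lin_on_comp[OF t] lin_on_comp[OF \<rho>])
  moreover have "\<Phi> j y \<in> J j \<and> \<Psi> j y \<in> L j" if "j < n" "y \<in> G" for j y
    unfolding \<Phi>_def \<Psi>_def using that \<phi>_in \<psi>_in t_in \<rho>C by simp
  moreover have "\<exists>y\<in>G. \<forall>j<n. \<Phi> j y = r j \<and> \<Psi> j y = r' j"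
    if r: "\<forall>j<n. r j \<in> J j \<and> r' j \<in> L j" for r r'
  proof -
    obtain k where k: "k \<in> K" "\<forall>j<n. \<phi> j k = r j" using surj r by blast
    obtain l where l: "l \<in> C" "\<forall>j<n. \<psi> j l = r' j" using surj' r by blast
    have "\<rho> (k + l) = l"
      using lin_on_add[OF \<rho> KG[OF k(1)], of l] l CG \<rho>_id k by (auto simp: K_def)
    moreover from this have "t (k + l) = k" by (simp add: t_def)
    ultimately have "\<forall>j<n. \<Phi> j (k + l) = r j \<and> \<Psi> j (k + l) = r' j" using k l by (simp add: \<Phi>_def \<Psi>_def)
    moreover have "k + l \<in> G" using subspace_add[OF G KG[OF k(1)]] l CG by blast
    ultimately show ?thesis by blast
  qed
  moreover have "y = 0" if y: "y \<in> G" "\<forall>j<n. \<Phi> j y = 0 \<and> \<Psi> j y = 0" for y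
  proof -
    have "t y = 0" using inj t_in[OF y(1)] y(2) by (auto simp: \<Phi>_def)
    moreover have "\<rho> y = 0" using inj' \<rho>C[OF y(1)] y(2) by (auto simp: \<Psi>_def)
    ultimately show ?thesis by (simp add: t_def)
  qed
  moreover have "y \<in> H \<longleftrightarrow> (\<forall>j<n. \<Phi> j y \<in> iprod (I j) (J j) \<and> \<Psi> j y = 0)" if y: "y \<in> G" for y
  proof
    assume yH: "y \<in> H"
    then have "t y = y" "\<rho> y = 0" using HK t_id \<rho>H by blast+
    moreover have "\<psi> j 0 = 0" if "j < n" for j by (rule functional_0[OF C]) (use \<psi> that in blast)
    ultimately show "\<forall>j<n. \<Phi> j y \<in> iprod (I j) (J j) \<and> \<Psi> j y = 0"
      using mem yH HK by (auto simp: \<Phi>_def \<Psi>_def)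
  next
    assume a: "\<forall>j<n. \<Phi> j y \<in> iprod (I j) (J j) \<and> \<Psi> j y = 0"
    then have "\<rho> y = 0" using inj' \<rho>C[OF y] by (auto simp: \<Psi>_def)
    then have "y \<in> K" using y by (simp add: K_def)
    then show "y \<in> H" using mem a t_id by (auto simp: \<Phi>_def)
  qed
  ultimately show ?thesis
    using d rk rk' I chain
    by (intro exI[of _ d] exI[of _ \<Phi>] exI[of _ J] exI[of _ q] exI[of _ I] exI[of _ \<Psi>] exI[of _ L] exI[of _ w]) simp
qed

end

section \<open>Cyclic torsion and the lemma of Schanuel\<close>

text \<open>The difference of consecutive supports, with 1 placed before the family and 0 after it:
  the idempotent of the locus where exactly \<open>r\<close> of the supports are 1.\<close>

definition rank_idem :: "nat \<Rightarrow> (nat \<Rightarrow> 'a::comm_ring_1) \<Rightarrow> nat \<Rightarrow> 'a" where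
  "rank_idem n q r = (if r = 0 then 1 else q (r - 1)) - (if r < n then q r else 0)"

context
  fixes n :: nat and q :: "nat \<Rightarrow> 'a::comm_ring_1"
  assumes q: "\<And>i j. i \<le> j \<Longrightarrow> j < n \<Longrightarrow> q i * q j = q j"
begin

lemma rank_idem_mult_q:
  assumes "i < n" "r \<le> n"
  shows "rank_idem n q r * q i = (if i < r then rank_idem n q r else 0)"
proof (cases "i < r")
  case True
  then have "q i * q (r - 1) = q (r - 1)" "r < n \<Longrightarrow> q i * q r = q r" using q assms by auto
  then show ?thesis using True by (auto simp: rank_idem_def right_diff_distrib mult.commute[of _ "q i"])
next
  case False
  then have "r \<noteq> 0 \<Longrightarrow> q (r - 1) * q i = q i" "q r * q i = q i" using q assms by auto
  then show ?thesis using False assms by (auto simp: rank_idem_def left_diff_distrib)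
qed

lemma rank_idem_orth:
  assumes rs: "r \<le> n" "s \<le> n"
  shows "rank_idem n q r * rank_idem n q s = (if r = s then rank_idem n q r else 0)"
proof (cases "s = 0")
  case True
  then have "rank_idem n q r * rank_idem n q s
      = rank_idem n q r - (if 0 < n then rank_idem n q r * q 0 else 0)"
    by (simp add: rank_idem_def[of n q 0] right_diff_distrib)
  then show ?thesis using True rs by (auto simp: rank_idem_mult_q)
next
  case False
  then have "rank_idem n q r * rank_idem n q s
      = rank_idem n q r * q (s - 1) - (if s < n then rank_idem n q r * q s else 0)"
    by (simp add: rank_idem_def[of n q s] right_diff_distrib)
  then show ?thesis using False rs by (auto simp: rank_idem_mult_q)
qed

lemma q_eq_sum_rank_idem:
  assumes "i < n"
  shows "q i = (\<Sum>r\<in>{i<..n}. rank_idem n q r)"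
proof -
  have "(\<Sum>r\<in>{i<..k}. rank_idem n q r) = q i - (if k < n then q k else 0)" if "i \<le> k" "k \<le> n" for k
    using that
  proof (induction k rule: dec_induct)
    case base
    then show ?case using assms by simp
  next
    case (step k)
    then have "{i<..Suc k} = insert (Suc k) {i<..k}" by auto
    then show ?case using step by (simp add: rank_idem_def)
  qed
  from this[of n] show ?thesis using assms by simp
qed

end

text \<open>This makes J / IJ cyclic. The symmetry x \<theta>(v) = \<theta>(v x) = v \<theta>(x),
  with \<theta>(v) equal to \<open>p\<close> modulo \<open>d\<close>, writes \<open>x\<close> as
  \<theta>(x) v up to a multiple of d x.\<close>

lemma scaled_mem_iprod:
  fixes \<theta> :: "'a::comm_ring_1 \<Rightarrow> 'a"
  assumes \<theta>: "lin_on (*) (*) J \<theta>" and J: "rideal J" and I: "rideal I" and d: "d \<in> I"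
    and v: "v \<in> J" "d dvd \<theta> v - p" and p: "\<And>x. x \<in> J \<Longrightarrow> p * x = x" and x: "x \<in> J"
  shows "x \<in> iprod I J \<longleftrightarrow> \<theta> x \<in> I"
proof
  have "iprod I J \<subseteq> {x \<in> J. \<theta> x \<in> I}"
  proof (rule iprod_minimal)
    have "\<theta> 0 = 0" by (rule module_pair.lin_on_0[OF _ J \<theta>]) (intro module_pair.intro module_mult)
    then show "rideal {x \<in> J. \<theta> x \<in> I}"
      unfolding rideal_def
      using rideal_0[OF J] rideal_add[OF J] rideal_mult[OF J] rideal_0[OF I] rideal_add[OF I] rideal_mult[OF I]
        lin_on_add[OF \<theta>] lin_on_scale[OF \<theta>] by simp
    show "a * b \<in> {x \<in> J. \<theta> x \<in> I}" if "a \<in> I" "b \<in> J" for a b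
      using that rideal_mult[OF J] lin_on_scale[OF \<theta>] rideal_mult_right[OF I] by simp
  qed
  then show "x \<in> iprod I J \<Longrightarrow> \<theta> x \<in> I" by blast
next
  assume a: "\<theta> x \<in> I"
  obtain t where t: "\<theta> v - p = d * t" using v(2) by blast
  have "v * \<theta> x = \<theta> (v * x)" using lin_on_scale[OF \<theta> x] by simp
  also have "\<dots> = x * \<theta> v" using lin_on_scale[OF \<theta> v(1), of x] by (simp add: mult.commute)
  also have "\<dots> = x * (p + d * t)" by (simp flip: t)
  also have "\<dots> = p * x + d * (t * x)" by (simp add: algebra_simps)
  finally have "x = \<theta> x * v - d * (t * x)" using p[OF x] by (simp add: algebra_simps)
  also have "\<dots> \<in> iprod I J"
    using a d v rideal_mult[OF J x] by (intro rideal_diff[OF iprod_rideal] iprodI)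
  finally show "x \<in> iprod I J" .
qed

context hereditary_corner_module
begin

text \<open>
  Where the rank of the torsion part is \<open>r\<close>, its \<open>r\<close> invariants are pushed to the last \<open>r\<close> of
  the \<open>n\<close> places; this makes the new ideals a chain although the supports \<open>q j\<close> decrease.
\<close>

lemma cyclic_torsion:
  assumes rk: "ranked n J q" and d: "regular d"
    and \<phi>: "\<forall>j<n. functional G (\<phi> j)" "\<forall>j<n. \<forall>y\<in>G. \<phi> j y \<in> J j"
    and I: "\<forall>j<n. rideal (I j) \<and> d \<in> I j" and chain: "\<forall>i j. i \<le> j \<longrightarrow> j < n \<longrightarrow> I j \<subseteq> I i"
  shows "\<exists>I' z. (\<forall>j<n. rideal (I' j) \<and> d \<in> I' j) \<and> (\<forall>i j. i \<le> j \<longrightarrow> j < n \<longrightarrow> I' j \<subseteq> I' i) \<and>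
    (\<forall>j<n. functional G (z j)) \<and>
    (\<forall>y\<in>G. (\<forall>j<n. \<phi> j y \<in> iprod (I j) (J j)) \<longleftrightarrow> (\<forall>j<n. z j y \<in> I' j)) \<and>
    (\<forall>c. \<exists>r. (\<forall>j<n. r j \<in> J j) \<and> (\<forall>y\<in>G. (\<forall>j<n. \<phi> j y = r j) \<longrightarrow> (\<forall>j<n. z j y - c j \<in> I' j)))"
proof -
  have J: "rideal (J j)" if "j < n" for j
    using rk that module.fin_gen_subspace[OF module_mult] unfolding ranked_def by blast
  have qJ: "q j * x = x" if "j < n" "x \<in> J j" for j x using rk that unfolding ranked_def by blast
  have qq: "q i * q j = q j" if "i \<le> j" "j < n" for i j using rk that unfolding ranked_def by blast
  have "\<forall>j\<in>{..<n}. \<exists>\<theta>v. lin_on (*) (*) (J j) (fst \<theta>v) \<and> (\<forall>x\<in>J j. q j * fst \<theta>v x = fst \<theta>v x) \<and>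
      snd \<theta>v \<in> J j \<and> d dvd fst \<theta>v (snd \<theta>v) - q j"
  proof
    fix j assume "j \<in> {..<n}"
    then have j: "j < n" by simp
    obtain a where a: "a \<in> J j" "is_supp (q j) a" using rk j unfolding ranked_def by blast
    have "\<exists>\<theta> v. lin_on (*) (*) (J j) \<theta> \<and> (\<forall>x\<in>J j. \<theta> x = 0 \<longrightarrow> x = 0) \<and> (\<forall>x\<in>J j. q j * \<theta> x = \<theta> x) \<and>
        v \<in> J j \<and> d dvd \<theta> v - q j"
      by (rule ideal_scaling[OF _ _ a(1) _ a(2) _ d]) (use rk j in \<open>auto simp: ranked_def\<close>)
    then show "\<exists>\<theta>v. lin_on (*) (*) (J j) (fst \<theta>v) \<and> (\<forall>x\<in>J j. q j * fst \<theta>v x = fst \<theta>v x) \<and>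
      snd \<theta>v \<in> J j \<and> d dvd fst \<theta>v (snd \<theta>v) - q j" by auto
  qed
  from bchoice[OF this] obtain \<theta>v where \<theta>v: "\<forall>j\<in>{..<n}. lin_on (*) (*) (J j) (fst (\<theta>v j)) \<and>
      (\<forall>x\<in>J j. q j * fst (\<theta>v j) x = fst (\<theta>v j) x) \<and>
      snd (\<theta>v j) \<in> J j \<and> d dvd fst (\<theta>v j) (snd (\<theta>v j)) - q j" ..
  define \<theta> where "\<theta> j = fst (\<theta>v j)" for j
  define v where "v j = snd (\<theta>v j)" for j
  have \<theta>: "lin_on (*) (*) (J j) (\<theta> j)" "\<And>x. x \<in> J j \<Longrightarrow> q j * \<theta> j x = \<theta> j x"
    and v: "v j \<in> J j" "d dvd \<theta> j (v j) - q j" if "j < n" for j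
    using \<theta>v that by (auto simp: \<theta>_def v_def)
  define \<delta> where "\<delta> = rank_idem n q"
  have \<delta>q: "\<delta> r * q i = (if i < r then \<delta> r else 0)" if "i < n" "r \<le> n" for r i
    unfolding \<delta>_def by (rule rank_idem_mult_q[OF qq that])
  have \<delta>\<delta>: "\<delta> r * \<delta> s = (if r = s then \<delta> r else 0)" if "r \<le> n" "s \<le> n" for r s
    unfolding \<delta>_def by (rule rank_idem_orth[OF qq that])
  have q_sum: "q i = (\<Sum>r\<in>{i<..n}. \<delta> r)" if "i < n" for i
    unfolding \<delta>_def by (rule q_eq_sum_rank_idem[OF qq that])
  \<comment> \<open>Orthogonality: multiplication by one rank idempotent extracts its term from a
    sum over ranks.\<close>
  have pick: "\<delta> r * (\<Sum>s\<in>A. \<delta> s * F s) = \<delta> r * F r" if "r \<in> A" "A \<subseteq> {..n}" for r A F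
  proof -
    have "finite A" using that finite_subset by blast
    have "\<delta> r * (\<Sum>s\<in>A. \<delta> s * F s) = (\<Sum>s\<in>A. if s = r then \<delta> r * F r else 0)"
      unfolding sum_distrib_left
      by (rule sum.cong) (use that in \<open>auto simp: \<delta>\<delta> subset_iff simp flip: mult.assoc\<close>)
    then show ?thesis using that \<open>finite A\<close> by simp
  qed
  \<comment> \<open>On the locus of rank \<open>r\<close>, place \<open>j\<close> holds the
    invariant with number j - (n - r). For j < n - r there is no condition: on that locus
    \<open>I' j\<close> is everything and contributes nothing to the quotient.\<close>
  define I' where "I' j = {x. \<forall>r\<le>n. n - r \<le> j \<longrightarrow> \<delta> r * x \<in> I (j - (n - r))}" for j
  define z where "z j y = (\<Sum>r\<in>{r. r \<le> n \<and> n - r \<le> j}. \<delta> r * \<theta> (j - (n - r)) (\<phi> (j - (n - r)) y))" for j y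
  have idx: "j - (n - r) < n" "j - (n - r) < r" if "j < n" "r \<le> n" "n - r \<le> j" for j r :: nat
    using that by auto
  have \<delta>z: "\<delta> r * z j y = \<delta> r * \<theta> (j - (n - r)) (\<phi> (j - (n - r)) y)" if "j < n" "r \<le> n" "n - r \<le> j" for r j y
    unfolding z_def by (rule pick[where F = "\<lambda>r. \<theta> (j - (n - r)) (\<phi> (j - (n - r)) y)"]) (use that in auto)
  have I'_ideal: "rideal (I' j) \<and> d \<in> I' j" if j: "j < n" for j
  proof
    define k where "k r = j - (n - r)" for r
    have Ij: "rideal (I (k r))" "d \<in> I (k r)" if "r \<le> n" "n - r \<le> j" for r
      unfolding k_def using I idx[OF j that] by blast+
    have I'_eq: "I' j = {x. \<forall>r\<le>n. n - r \<le> j \<longrightarrow> \<delta> r * x \<in> I (k r)}"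
      by (simp add: I'_def k_def)
    show "rideal (I' j)"
      unfolding rideal_def I'_eq
      by (simp add: distrib_left mult.left_commute[of "\<delta> _"]
          rideal_0[OF Ij(1)] rideal_add[OF Ij(1)] rideal_mult[OF Ij(1)])
    show "d \<in> I' j" unfolding I'_eq using rideal_mult[OF Ij] by blast
  qed
  have I'_chain: "I' j \<subseteq> I' i" if ij: "i \<le> j" "j < n" for i j
  proof
    fix x assume x: "x \<in> I' j"
    have "\<delta> r * x \<in> I (i - (n - r))" if r: "r \<le> n" "n - r \<le> i" for r
    proof -
      have "\<delta> r * x \<in> I (j - (n - r))" using x r ij by (simp add: I'_def)
      moreover have "i - (n - r) \<le> j - (n - r)" "j - (n - r) < n" using ij by auto
      ultimately show ?thesis using chain by blast
    qed
    then show "x \<in> I' i" by (simp add: I'_def)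
  qed
  have z_fun: "functional G (z j)" if j: "j < n" for j
    unfolding z_def
  proof (intro module_pair.lin_on_sum_fun[OF pair_VR] module_pair.lin_on_scale_fun[OF pair_VR])
    fix r assume "r \<in> {r. r \<le> n \<and> n - r \<le> j}"
    then have i: "j - (n - r) < n" using idx[OF j] by blast
    show "functional G (\<lambda>y. \<theta> (j - (n - r)) (\<phi> (j - (n - r)) y))"
      by (rule lin_on_comp[OF _ \<theta>(1)[OF i]]) (use \<phi> i in auto)
  qed
  have kernel: "(\<forall>j<n. \<phi> j y \<in> iprod (I j) (J j)) \<longleftrightarrow> (\<forall>j<n. z j y \<in> I' j)" if y: "y \<in> G" for y
  proof -
    have "\<phi> i y \<in> iprod (I i) (J i) \<longleftrightarrow> \<theta> i (\<phi> i y) \<in> I i" if i: "i < n" for i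
      by (rule scaled_mem_iprod[OF \<theta>(1)[OF i] J[OF i] _ _ v[OF i] qJ[OF i]]) (use I \<phi> i y in auto)
    then have "(\<forall>j<n. \<phi> j y \<in> iprod (I j) (J j)) \<longleftrightarrow> (\<forall>i<n. \<theta> i (\<phi> i y) \<in> I i)" by blast
    also have "\<dots> \<longleftrightarrow> (\<forall>j<n. z j y \<in> I' j)"
    proof
      assume a: "\<forall>i<n. \<theta> i (\<phi> i y) \<in> I i"
      show "\<forall>j<n. z j y \<in> I' j"
      proof (intro allI impI)
        fix j assume j: "j < n"
        have "\<delta> r * z j y \<in> I (j - (n - r))" if r: "r \<le> n" "n - r \<le> j" for r
          unfolding \<delta>z[OF j r] using idx[OF j r] a I by (blast intro: rideal_mult)
        then show "z j y \<in> I' j" by (simp add: I'_def)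
      qed
    next
      assume a: "\<forall>j<n. z j y \<in> I' j"
      show "\<forall>i<n. \<theta> i (\<phi> i y) \<in> I i"
      proof (intro allI impI)
        fix i assume i: "i < n"
        have Ii: "rideal (I i)" using I i by blast
        have "\<delta> r * \<theta> i (\<phi> i y) \<in> I i" if r: "r \<in> {i<..n}" for r
        proof -
          \<comment> \<open>The place to which invariant \<open>i\<close> was moved on the locus of
            rank \<open>r\<close>.\<close>
          define j where "j = i + (n - r)"
          have j: "j < n" "r \<le> n" "n - r \<le> j" "j - (n - r) = i" using r i by (auto simp: j_def)
          have "\<delta> r * z j y \<in> I (j - (n - r))" using a j(1-3) unfolding I'_def by blast
          then show ?thesis using \<delta>z[OF j(1-3)] j(4) by simp
        qed
        then have "(\<Sum>r\<in>{i<..n}. \<delta> r * \<theta> i (\<phi> i y)) \<in> I i" by (rule rideal_sum[OF Ii])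
        moreover have "(\<Sum>r\<in>{i<..n}. \<delta> r * \<theta> i (\<phi> i y)) = q i * \<theta> i (\<phi> i y)"
          using q_sum[OF i] by (simp add: sum_distrib_right)
        ultimately show "\<theta> i (\<phi> i y) \<in> I i" using \<theta>(2)[OF i] \<phi> i y by simp
      qed
    qed
    finally show ?thesis .
  qed
  have surj: "\<exists>r. (\<forall>j<n. r j \<in> J j) \<and>
      (\<forall>y\<in>G. (\<forall>j<n. \<phi> j y = r j) \<longrightarrow> (\<forall>j<n. z j y - c j \<in> I' j))" for c
  proof -
    \<comment> \<open>Undoes the shift of places. If \<open>\<phi> i y\<close> is
      \<open>w i * v i\<close>, then \<open>\<theta> i\<close> takes it to \<open>w i * q i\<close>
      modulo \<open>d\<close>, and \<open>d\<close> lies in every \<open>I' j\<close>.\<close>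
    define w where "w i = (\<Sum>r\<in>{i<..n}. \<delta> r * c (i + (n - r)))" for i
    have "z j y - c j \<in> I' j" if y: "y \<in> G" "\<forall>j<n. \<phi> j y = w j * v j" and j: "j < n" for y j
    proof -
      have "\<delta> r * (z j y - c j) \<in> I (j - (n - r))" if r: "r \<le> n" "n - r \<le> j" for r
      proof -
        define i where "i = j - (n - r)"
        have i: "i < n" "i < r" "i + (n - r) = j" using idx[OF j r] r by (auto simp: i_def)
        obtain t where t: "\<theta> i (v i) - q i = d * t" using v(2)[OF i(1)] by blast
        then have t': "\<theta> i (v i) = q i + d * t" by (simp add: algebra_simps)
        have "\<delta> r * w i = \<delta> r * c (i + (n - r))"
          unfolding w_def by (rule pick[where F = "\<lambda>r. c (i + (n - r))"]) (use i r in auto)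
        then have "\<delta> r * w i = \<delta> r * c j" by (simp only: i(3))
        moreover have "\<delta> r * q i = \<delta> r" using \<delta>q i r by simp
        moreover have "\<delta> r * z j y = \<delta> r * (w i * \<theta> i (v i))"
          using \<delta>z[OF j r] lin_on_scale[OF \<theta>(1)[OF i(1)] v(1)[OF i(1)]] y(2) i(1) by (simp flip: i_def)
        moreover have "\<delta> r * (w i * \<theta> i (v i)) = w i * (\<delta> r * q i) + d * (\<delta> r * w i * t)"
          unfolding t' by (simp add: algebra_simps)
        ultimately have "\<delta> r * (z j y - c j) = d * (\<delta> r * w i * t)"
          by (simp add: right_diff_distrib mult.commute)
        moreover have "rideal (I i)" "d \<in> I i" using I i by blast+
        ultimately show ?thesis by (simp add: i_def rideal_mult_right)
      qed
      then show ?thesis by (simp add: I'_def)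
    qed
    moreover have "\<forall>j<n. w j * v j \<in> J j" using v J by (auto intro: rideal_mult)
    ultimately show ?thesis by (intro exI[of _ "\<lambda>j. w j * v j"]) blast
  qed
  show ?thesis
    using I'_ideal I'_chain z_fun kernel surj by (intro exI[of _ I'] exI[of _ z]) blast
qed

text \<open>\<open>N\<close> stands for the fibre product of two maps from \<open>G\<close> and
  \<open>G'\<close> onto a common module, and the sets of \<open>x\<close> with (x, 0) and of
  \<open>y\<close> with (0, y) in \<open>N\<close> are their kernels. Given as a relation, it keeps
  the common module, which lives outside the type classes, out of the statement.\<close>

lemma schanuel:
  assumes G: "subspace G" "dual_list scale G L" "fin_gen scale G"
    and G': "subspace G'" "dual_list scale G' L'"
    and N: "N \<subseteq> G \<times> G'" "(0, 0) \<in> N" "\<And>x y x' y'. (x, y) \<in> N \<Longrightarrow> (x', y') \<in> N \<Longrightarrow> (x + x', y + y') \<in> N"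
      "\<And>c x y. (x, y) \<in> N \<Longrightarrow> (c *s x, c *s y) \<in> N"
    and surj: "\<And>x. x \<in> G \<Longrightarrow> \<exists>y. (x, y) \<in> N" "\<And>y. y \<in> G' \<Longrightarrow> \<exists>x. (x, y) \<in> N"
    and fg: "fin_gen scale {y. (0, y) \<in> N}"
  shows "fin_gen scale {x. (x, 0) \<in> N}"
proof -
  define sc where "sc c xy = (c *s fst xy, c *s snd xy)" for c and xy :: "'v \<times> 'v"
  have sc: "Modules.module sc"
    by standard (auto simp: sc_def scale_right_distrib scale_left_distrib)
  have pr: "module_pair sc scale" by (intro module_pair.intro sc module_axioms)
  have subN: "Modules.module.subspace sc N"
    unfolding Modules.module.subspace_def[OF sc] using N(2-4) by (auto simp: sc_def zero_prod_def)
  have Ndiff: "(x - x', y - y') \<in> N" if "(x, y) \<in> N" "(x', y') \<in> N" for x y x' y'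
    using Modules.module.subspace_diff[OF sc subN that] by simp
  have fst: "lin_on sc scale N fst" and snd: "lin_on sc scale N snd" by (auto simp: lin_on_def sc_def)
  obtain l where l: "lin_on scale sc G l" "\<forall>c\<in>G. l c \<in> N \<and> fst (l c) = c"
  proof -
    have "G \<subseteq> fst ` N" using surj(1) by force
    from module_pair.lift_exists[OF pr subN fst G(2) this] show ?thesis using that by blast
  qed
  obtain l' where l': "lin_on scale sc G' l'" "\<forall>c\<in>G'. l' c \<in> N \<and> snd (l' c) = c"
  proof -
    have "G' \<subseteq> snd ` N" using surj(2) by force
    from module_pair.lift_exists[OF pr subN snd G'(2) this] show ?thesis using that by blast
  qed
  define q where "q x = snd (l x)" for x
  define p where "p y = fst (l' y)" for y
  have q: "lin_on scale scale G q" unfolding q_def by (rule lin_on_comp[OF l(1) snd]) (use l in blast)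
  have p: "lin_on scale scale G' p" unfolding p_def by (rule lin_on_comp[OF l'(1) fst]) (use l' in blast)
  have Nq: "(x, q x) \<in> N" if "x \<in> G" for x using l(2) that by (metis prod.collapse q_def)
  have Np: "(p y, y) \<in> N" if "y \<in> G'" for y using l'(2) that by (metis prod.collapse p_def)
  have qG: "q x \<in> G'" if "x \<in> G" for x using Nq[OF that] N(1) by blast
  define K where "K = {y. (0, y) \<in> N}"
  have KG: "K \<subseteq> G'" using N(1) by (auto simp: K_def)
  \<comment> \<open>\<open>q\<close> and \<open>p\<close> are maps between \<open>G\<close> and
    \<open>G'\<close> over the common module, so \<open>x - p (q x)\<close> is in the kernel for
    every \<open>x\<close>. If (x, 0) is in \<open>N\<close>, then \<open>q x\<close> is in
    \<open>K\<close>, and \<open>x\<close> is the sum of \<open>t x\<close> and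
    \<open>p (q x)\<close>.\<close>
  define t where "t x = x - p (q x)" for x
  have t: "lin_on scale scale G t"
    unfolding t_def by (intro module_pair.lin_on_diff_fun[OF pair_VV] lin_on_id lin_on_comp[OF q p] qG)
  obtain S where S: "finite S" "t ` G = span S"
    using module_pair.fin_gen_image[OF pair_VV G(1) t G(3)] by (auto simp: fin_gen_def)
  have fgK: "fin_gen scale K" using fg by (simp add: K_def)
  obtain S' where S': "finite S'" "p ` K = span S'"
    using module_pair.fin_gen_image[OF pair_VV fin_gen_subspace[OF fgK] lin_on_subset[OF p KG] fgK]
    by (auto simp: fin_gen_def)
  have tN: "(t x, 0) \<in> N" if "x \<in> G" for x
    using Ndiff[OF Nq[OF that] Np[OF qG[OF that]]] by (simp add: t_def)
  have pN: "(p y, 0) \<in> N" if "y \<in> K" for y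
    using Ndiff[OF Np, of y 0 y] that KG by (auto simp: K_def)
  have "{x. (x, 0) \<in> N} = span (S \<union> S')"
  proof (intro equalityI subsetI)
    fix x assume "x \<in> {x. (x, 0) \<in> N}"
    then have x0: "(x, 0) \<in> N" by simp
    then have x: "x \<in> G" using N(1) by blast
    have "(0, q x) \<in> N" using Ndiff[OF Nq[OF x] x0] by simp
    then have "p (q x) \<in> span S'" using S' by (auto simp: K_def)
    moreover have "t x \<in> span S" using S x by blast
    moreover have "x = t x + p (q x)" by (simp add: t_def)
    ultimately show "x \<in> span (S \<union> S')" unfolding span_Un by blast
  next
    fix x assume "x \<in> span (S \<union> S')"
    then obtain a b where "x = a + b" "a \<in> t ` G" "b \<in> p ` K" unfolding span_Un S S' by blast
    then show "x \<in> {x. (x, 0) \<in> N}" using tN pN N(3)[of _ 0 _ 0] by auto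
  qed
  then show ?thesis using S S' unfolding fin_gen_def by blast
qed

end

section \<open>Invertible ideals\<close>

context cring
begin

lemma regular_elementD:
  assumes "s \<in> regular_elements R"
  shows "s \<in> carrier R" "\<And>a. a \<in> carrier R \<Longrightarrow> a \<otimes> s = \<zero> \<Longrightarrow> a = \<zero>"
  using assms by (auto simp: regular_elements_def)

lemma regular_cancel:
  assumes s: "s \<in> regular_elements R" and ab: "a \<in> carrier R" "b \<in> carrier R" "a \<otimes> s = b \<otimes> s"
  shows "a = b"
proof -
  note sc = regular_elementD(1)[OF s]
  have "(a \<ominus> b) \<otimes> s = a \<otimes> s \<ominus> b \<otimes> s" using ab sc by algebra
  also have "\<dots> = \<zero>" using ab sc by (simp add: r_neg minus_eq)
  finally have "a \<ominus> b = \<zero>" using regular_elementD(2)[OF s] ab by blast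
  then have "(a \<ominus> b) \<oplus> b = \<zero> \<oplus> b" by simp
  moreover have "(a \<ominus> b) \<oplus> b = a" using ab(1,2) by algebra
  ultimately show ?thesis using ab(1,2) by simp
qed

lemma regular_elements_one: "\<one> \<in> regular_elements R"
  by (auto simp: regular_elements_def)

lemma regular_elements_mult:
  assumes s: "s \<in> regular_elements R" and t: "t \<in> regular_elements R"
  shows "s \<otimes> t \<in> regular_elements R"
proof -
  note c = regular_elementD(1)[OF s] regular_elementD(1)[OF t]
  have "a = \<zero>" if a: "a \<in> carrier R" "a \<otimes> (s \<otimes> t) = \<zero>" for a
  proof -
    have "(a \<otimes> s) \<otimes> t = \<zero>" using a c by (simp add: m_assoc)
    then have "a \<otimes> s = \<zero>" using regular_elementD(2)[OF t] a c by blast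
    then show ?thesis using regular_elementD(2)[OF s] a by blast
  qed
  then show ?thesis using c by (auto simp: regular_elements_def)
qed

text \<open>Equality of the two classes amounts to transitivity of the relation, which rests on
  cancelling the regular denominators.\<close>

lemma fraction_eqI:
  assumes a: "a \<in> carrier R" "b \<in> carrier R" and s: "s \<in> regular_elements R" "t \<in> regular_elements R"
    and eq: "a \<otimes> t = b \<otimes> s"
  shows "fraction R a s = fraction R b t"
proof -
  note c = regular_elementD(1)[OF s(1)] regular_elementD(1)[OF s(2)]
  have *: "a \<otimes> v = k \<otimes> s \<longleftrightarrow> b \<otimes> v = k \<otimes> t" if k: "k \<in> carrier R" "v \<in> regular_elements R" for k v
  proof -
    note v = regular_elementD(1)[OF k(2)]
    have 1: "(a \<otimes> v) \<otimes> t = (b \<otimes> v) \<otimes> s"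
    proof -
      have "(a \<otimes> v) \<otimes> t = (a \<otimes> t) \<otimes> v" using a c v by (simp add: m_ac)
      also have "\<dots> = (b \<otimes> v) \<otimes> s" unfolding eq using a c v by (simp add: m_ac)
      finally show ?thesis .
    qed
    have 2: "(k \<otimes> s) \<otimes> t = (k \<otimes> t) \<otimes> s" using k c by (simp add: m_ac)
    show ?thesis
    proof
      assume "a \<otimes> v = k \<otimes> s"
      then have "(b \<otimes> v) \<otimes> s = (k \<otimes> t) \<otimes> s" using 1 2 by simp
      then show "b \<otimes> v = k \<otimes> t" using regular_cancel[OF s(1)] a k c v by simp
    next
      assume "b \<otimes> v = k \<otimes> t"
      then have "(a \<otimes> v) \<otimes> t = (k \<otimes> s) \<otimes> t" using 1 2 by simp
      then show "a \<otimes> v = k \<otimes> s" using regular_cancel[OF s(2)] a k c v by simp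
    qed
  qed
  show ?thesis using a s * by (auto simp: fraction_def frac_rel_def)
qed

lemma fraction_self: "a \<in> carrier R \<Longrightarrow> s \<in> regular_elements R \<Longrightarrow> (a, s) \<in> fraction R a s"
  by (auto simp: fraction_def frac_rel_def)

lemma fractionD:
  assumes "(b, t) \<in> fraction R a s"
  shows "a \<in> carrier R" "b \<in> carrier R" "s \<in> regular_elements R" "t \<in> regular_elements R" "a \<otimes> t = b \<otimes> s"
  using assms by (auto simp: fraction_def frac_rel_def)

lemma fraction_carrier:
  "a \<in> carrier R \<Longrightarrow> s \<in> regular_elements R \<Longrightarrow> fraction R a s \<in> carrier (total_fractions R)"
  by (auto simp: total_fractions_def fraction_def intro!: quotientI)

lemma fraction_mult:
  assumes a: "a \<in> carrier R" "b \<in> carrier R" and s: "s \<in> regular_elements R" "t \<in> regular_elements R"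
  shows "fraction R a s \<otimes>\<^bsub>total_fractions R\<^esub> fraction R b t = fraction R (a \<otimes> b) (s \<otimes> t)"
proof -
  have "fraction R (fst x \<otimes> fst y) (snd x \<otimes> snd y) = fraction R (a \<otimes> b) (s \<otimes> t)"
    if "x \<in> fraction R a s" "y \<in> fraction R b t" for x y
  proof -
    note x = fractionD[of "fst x" "snd x" a s, simplified, OF that(1)]
    note y = fractionD[of "fst y" "snd y" b t, simplified, OF that(2)]
    note c = regular_elementD(1)[OF x(4)] regular_elementD(1)[OF y(4)]
      regular_elementD(1)[OF s(1)] regular_elementD(1)[OF s(2)]
    have "(fst x \<otimes> fst y) \<otimes> (s \<otimes> t) = (fst x \<otimes> s) \<otimes> (fst y \<otimes> t)" using x y c by (simp add: m_ac)
    also have "\<dots> = (a \<otimes> snd x) \<otimes> (b \<otimes> snd y)" using x y by simp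
    also have "\<dots> = (a \<otimes> b) \<otimes> (snd x \<otimes> snd y)" using a c by (simp add: m_ac)
    finally show ?thesis
      by (intro fraction_eqI regular_elements_mult m_closed x y s)
  qed
  then have "fraction R a s \<otimes>\<^bsub>total_fractions R\<^esub> fraction R b t
      = (\<Union>x\<in>fraction R a s. \<Union>y\<in>fraction R b t. fraction R (a \<otimes> b) (s \<otimes> t))"
    by (simp add: total_fractions_def case_prod_unfold)
  then show ?thesis using fraction_self[OF a(1) s(1)] fraction_self[OF a(2) s(2)] by auto
qed

lemma fraction_add:
  assumes a: "a \<in> carrier R" "b \<in> carrier R" and s: "s \<in> regular_elements R" "t \<in> regular_elements R"
  shows "fraction R a s \<oplus>\<^bsub>total_fractions R\<^esub> fraction R b t = fraction R (a \<otimes> t \<oplus> b \<otimes> s) (s \<otimes> t)"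
proof -
  have "fraction R (fst x \<otimes> snd y \<oplus> fst y \<otimes> snd x) (snd x \<otimes> snd y)
      = fraction R (a \<otimes> t \<oplus> b \<otimes> s) (s \<otimes> t)"
    if "x \<in> fraction R a s" "y \<in> fraction R b t" for x y
  proof -
    note x = fractionD[of "fst x" "snd x" a s, simplified, OF that(1)]
    note y = fractionD[of "fst y" "snd y" b t, simplified, OF that(2)]
    note c = regular_elementD(1)[OF x(4)] regular_elementD(1)[OF y(4)]
      regular_elementD(1)[OF s(1)] regular_elementD(1)[OF s(2)]
    have "(fst x \<otimes> snd y \<oplus> fst y \<otimes> snd x) \<otimes> (s \<otimes> t)
        = (fst x \<otimes> s) \<otimes> (snd y \<otimes> t) \<oplus> (fst y \<otimes> t) \<otimes> (snd x \<otimes> s)"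
      using x y c by (simp add: l_distr r_distr m_ac)
    also have "\<dots> = (a \<otimes> snd x) \<otimes> (snd y \<otimes> t) \<oplus> (b \<otimes> snd y) \<otimes> (snd x \<otimes> s)" using x y by simp
    also have "\<dots> = (a \<otimes> t \<oplus> b \<otimes> s) \<otimes> (snd x \<otimes> snd y)" using a c by (simp add: l_distr r_distr m_ac)
    finally show ?thesis
      using c x y a by (intro fraction_eqI regular_elements_mult x y s) simp_all
  qed
  then have "fraction R a s \<oplus>\<^bsub>total_fractions R\<^esub> fraction R b t
      = (\<Union>x\<in>fraction R a s. \<Union>y\<in>fraction R b t. fraction R (a \<otimes> t \<oplus> b \<otimes> s) (s \<otimes> t))"
    by (simp add: total_fractions_def case_prod_unfold)
  then show ?thesis using fraction_self[OF a(1) s(1)] fraction_self[OF a(2) s(2)] by auto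
qed

lemma fraction_add_same:
  assumes a: "a \<in> carrier R" "b \<in> carrier R" and s: "s \<in> regular_elements R"
  shows "fraction R a s \<oplus>\<^bsub>total_fractions R\<^esub> fraction R b s = fraction R (a \<oplus> b) s"
  unfolding fraction_add[OF a s s]
  using a s regular_elementD(1)[OF s]
  by (intro fraction_eqI regular_elements_mult) (simp_all add: l_distr m_assoc)

lemma fraction_zero_iff:
  assumes a: "a \<in> carrier R" and s: "s \<in> regular_elements R"
  shows "fraction R a s = \<zero>\<^bsub>total_fractions R\<^esub> \<longleftrightarrow> a = \<zero>"
proof
  assume "fraction R a s = \<zero>\<^bsub>total_fractions R\<^esub>"
  then have "(a, s) \<in> fraction R \<zero> \<one>" using fraction_self[OF a s] by (simp add: total_fractions_def)
  from fractionD(5)[OF this] show "a = \<zero>" using a regular_elementD(1)[OF s] by simp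
next
  assume "a = \<zero>"
  moreover have "fraction R \<zero> s = fraction R \<zero> \<one>"
    using regular_elementD(1)[OF s] s by (intro fraction_eqI) (simp_all add: regular_elements_one)
  ultimately show "fraction R a s = \<zero>\<^bsub>total_fractions R\<^esub>" by (simp add: total_fractions_def)
qed

text \<open>The inverse in \<open>add_monoid\<close> is a definite description; it is evaluated by
  proving uniqueness directly, without first establishing that the total fractions form a
  ring.\<close>

lemma fraction_neg:
  assumes a: "a \<in> carrier R" and s: "s \<in> regular_elements R"
  shows "inv\<^bsub>add_monoid (total_fractions R)\<^esub> (fraction R a s) = fraction R (\<ominus> a) s"
proof -
  note sc = regular_elementD(1)[OF s]
  have 1: "fraction R a s \<oplus>\<^bsub>total_fractions R\<^esub> fraction R (\<ominus> a) s = \<zero>\<^bsub>total_fractions R\<^esub>"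
    using a s by (simp add: fraction_add_same fraction_zero_iff r_neg)
  have 2: "fraction R (\<ominus> a) s \<oplus>\<^bsub>total_fractions R\<^esub> fraction R a s = \<zero>\<^bsub>total_fractions R\<^esub>"
    using a s by (simp add: fraction_add_same fraction_zero_iff l_neg)
  have uniq: "y = fraction R (\<ominus> a) s" if y: "y \<in> carrier (total_fractions R)"
      "fraction R a s \<oplus>\<^bsub>total_fractions R\<^esub> y = \<zero>\<^bsub>total_fractions R\<^esub>" for y
  proof -
    obtain b t where bt: "b \<in> carrier R" "t \<in> regular_elements R" "y = fraction R b t"
      using y(1) by (auto simp: total_fractions_def fraction_def elim!: quotientE)
    note tc = regular_elementD(1)[OF bt(2)]
    have z: "a \<otimes> t \<oplus> b \<otimes> s = \<zero>"
      using y(2) a s bt sc tc by (simp add: fraction_add fraction_zero_iff regular_elements_mult)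
    have "b \<otimes> s = (a \<otimes> t \<oplus> b \<otimes> s) \<oplus> \<ominus> a \<otimes> t" using a bt sc tc by algebra
    then have "b \<otimes> s = \<ominus> a \<otimes> t" using z a tc by simp
    then show ?thesis unfolding bt using a bt s by (intro fraction_eqI) simp_all
  qed
  have 3: "fraction R (\<ominus> a) s \<in> carrier (total_fractions R)" using a s by (intro fraction_carrier) simp_all
  have "(THE y. y \<in> carrier (total_fractions R) \<and>
      fraction R a s \<oplus>\<^bsub>total_fractions R\<^esub> y = \<zero>\<^bsub>total_fractions R\<^esub> \<and>
      y \<oplus>\<^bsub>total_fractions R\<^esub> fraction R a s = \<zero>\<^bsub>total_fractions R\<^esub>) = fraction R (\<ominus> a) s"
    using 1 2 3 uniq by (intro the_equality conjI; (elim conjE)?)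
  then show ?thesis unfolding m_inv_def by simp
qed

text \<open>The inverse is the set \<open>N\<close> of fractions b / d with \<open>b\<close> in (dR
  : I). Its product with \<open>I\<close> lies in the ring by the definition of that colon ideal,
  and contains 1 because \<open>d\<close> is in the product of \<open>I\<close> with it.\<close>

lemma invertible_idealI:
  assumes I: "ideal I R" and d: "d \<in> regular_elements R"
    and dI: "d \<in> I \<cdot> {b \<in> carrier R. \<forall>x\<in>I. \<exists>t\<in>carrier R. b \<otimes> x = d \<otimes> t}" (is "d \<in> I \<cdot> ?B")
  shows "invertible_ideal R I"
proof -
  let ?Q = "total_fractions R"
  note dc = regular_elementD(1)[OF d]
  have Ic: "x \<in> carrier R" if "x \<in> I" for x using ideal.Icarr[OF I that] .
  have B: "ideal ?B R"
  proof (rule idealI[OF ring_axioms])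
    show "subgroup ?B (add_monoid R)"
    proof (rule add.subgroupI)
      have "\<zero> \<in> ?B" using Ic dc by (auto intro!: bexI[of _ \<zero>])
      then show "?B \<noteq> {}" by blast
      fix a assume a: "a \<in> ?B"
      have "\<exists>t\<in>carrier R. \<ominus> a \<otimes> x = d \<otimes> t" if x: "x \<in> I" for x
      proof -
        obtain t where t: "t \<in> carrier R" "a \<otimes> x = d \<otimes> t" using a x by blast
        then have "\<ominus> a \<otimes> x = d \<otimes> (\<ominus> t)" using a Ic[OF x] dc by (simp add: l_minus r_minus)
        then show ?thesis using t by blast
      qed
      then show "\<ominus> a \<in> ?B" using a by simp
      fix b assume b: "b \<in> ?B"
      have "\<exists>t\<in>carrier R. (a \<oplus> b) \<otimes> x = d \<otimes> t" if x: "x \<in> I" for x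
      proof -
        obtain t where t: "t \<in> carrier R" "a \<otimes> x = d \<otimes> t" using a x by blast
        obtain u where u: "u \<in> carrier R" "b \<otimes> x = d \<otimes> u" using b x by blast
        have "(a \<oplus> b) \<otimes> x = d \<otimes> (t \<oplus> u)" using a b Ic[OF x] dc t u by (simp add: l_distr r_distr)
        then show ?thesis using t u by blast
      qed
      then show "a \<oplus> b \<in> ?B" using a b by simp
    qed auto
    fix a r assume a: "a \<in> ?B" and r: "r \<in> carrier R"
    have "\<exists>t\<in>carrier R. (r \<otimes> a) \<otimes> x = d \<otimes> t" if x: "x \<in> I" for x
    proof -
      obtain t where t: "t \<in> carrier R" "a \<otimes> x = d \<otimes> t" using a x by blast
      have "(r \<otimes> a) \<otimes> x = r \<otimes> (a \<otimes> x)" using a Ic[OF x] r by (simp add: m_assoc)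
      also have "\<dots> = d \<otimes> (r \<otimes> t)" using t dc r by (simp add: m_lcomm)
      finally show ?thesis using t r by blast
    qed
    then show "r \<otimes> a \<in> ?B" using a r by simp
    then show "a \<otimes> r \<in> ?B" using a r by (simp add: m_comm)
  qed
  define N where "N = (\<lambda>b. fraction R b d) ` ?B"
  have Bc: "b \<in> carrier R" if "b \<in> ?B" for b using that by simp
  have "additive_subgroup N ?Q"
  proof (rule additive_subgroup.intro, rule subgroup.intro)
    show "N \<subseteq> carrier (add_monoid ?Q)" using d by (auto simp: N_def intro: fraction_carrier)
    fix x y assume "x \<in> N" "y \<in> N"
    then obtain b c where bc: "b \<in> ?B" "c \<in> ?B" "x = fraction R b d" "y = fraction R c d"
      unfolding N_def by blast
    have "b \<oplus> c \<in> ?B" by (rule additive_subgroup.a_closed[OF ideal.axioms(1)[OF B] bc(1,2)])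
    then show "x \<otimes>\<^bsub>add_monoid ?Q\<^esub> y \<in> N"
      unfolding N_def using bc fraction_add_same[OF Bc[OF bc(1)] Bc[OF bc(2)] d] by auto
  next
    have "\<zero> \<in> ?B" by (rule additive_subgroup.zero_closed[OF ideal.axioms(1)[OF B]])
    moreover have "fraction R \<zero> d = \<zero>\<^bsub>?Q\<^esub>" using fraction_zero_iff[OF zero_closed d] by simp
    ultimately show "\<one>\<^bsub>add_monoid ?Q\<^esub> \<in> N" unfolding N_def by force
  next
    fix x assume "x \<in> N"
    then obtain b where b: "b \<in> ?B" "x = fraction R b d" unfolding N_def by blast
    have "\<ominus> b \<in> ?B" by (rule additive_subgroup.a_inv_closed[OF ideal.axioms(1)[OF B] b(1)])
    then show "inv\<^bsub>add_monoid ?Q\<^esub> x \<in> N"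
      unfolding N_def b using fraction_neg[OF Bc[OF b(1)] d] by blast
  qed
  moreover have "frac_embed R a \<otimes>\<^bsub>?Q\<^esub> x \<in> N" if a: "a \<in> carrier R" and x: "x \<in> N" for a x
  proof -
    obtain b where b: "b \<in> ?B" "x = fraction R b d" using x unfolding N_def by blast
    have "frac_embed R a \<otimes>\<^bsub>?Q\<^esub> x = fraction R (a \<otimes> b) d"
      unfolding frac_embed_def b using fraction_mult[OF a Bc[OF b(1)] regular_elements_one d] dc by simp
    moreover have "a \<otimes> b \<in> ?B" by (rule ideal.I_l_closed[OF B b(1) a])
    ultimately show ?thesis unfolding N_def by blast
  qed
  moreover have "frac_embed R d \<otimes>\<^bsub>?Q\<^esub> x \<in> frac_embed R ` carrier R" if x: "x \<in> N" for x
  proof -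
    obtain b where b: "b \<in> ?B" "x = fraction R b d" using x unfolding N_def by blast
    have "frac_embed R d \<otimes>\<^bsub>?Q\<^esub> x = fraction R (d \<otimes> b) d"
      unfolding frac_embed_def b using fraction_mult[OF dc Bc[OF b(1)] regular_elements_one d] dc by simp
    also have "\<dots> = fraction R b \<one>"
      using b dc d by (intro fraction_eqI) (simp_all add: regular_elements_one m_comm)
    finally show ?thesis using b by (simp add: frac_embed_def)
  qed
  ultimately have "fractional_ideal R N" using d unfolding fractional_ideal_def by blast
  moreover have "(frac_embed R ` I) \<cdot>\<^bsub>?Q\<^esub> N = frac_embed R ` carrier R"
  proof (intro equalityI subsetI)
    fix x assume "x \<in> (frac_embed R ` I) \<cdot>\<^bsub>?Q\<^esub> N"
    then show "x \<in> frac_embed R ` carrier R"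
    proof (induction rule: ideal_prod.induct)
      case (prod i j)
      then obtain a b where ab: "a \<in> I" "i = frac_embed R a" "b \<in> ?B" "j = fraction R b d"
        unfolding N_def by blast
      then obtain t where t: "t \<in> carrier R" "b \<otimes> a = d \<otimes> t" by blast
      have "i \<otimes>\<^bsub>?Q\<^esub> j = fraction R (a \<otimes> b) d"
        unfolding ab frac_embed_def
        using fraction_mult[OF Ic[OF ab(1)] Bc[OF ab(3)] regular_elements_one d] dc by simp
      also have "\<dots> = fraction R t \<one>"
        using ab t Ic dc d by (intro fraction_eqI) (simp_all add: regular_elements_one m_comm)
      finally show ?case using t by (simp add: frac_embed_def)
    next
      case (sum s1 s2)
      then obtain a b where "a \<in> carrier R" "b \<in> carrier R" "s1 = frac_embed R a" "s2 = frac_embed R b" by blast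
      then show ?case
        using fraction_add_same[of a b \<one>] regular_elements_one by (auto simp: frac_embed_def)
    qed
  next
    fix x assume "x \<in> frac_embed R ` carrier R"
    then obtain r where r: "r \<in> carrier R" "x = frac_embed R r" by blast
    have IB: "ideal (I \<cdot> ?B) R" by (rule ideal_prod_is_ideal[OF I B])
    \<comment> \<open>Divides the members of the product ideal by \<open>d\<close>; membership in
      the carrier is carried along for the addition of fractions.\<close>
    have "z \<in> carrier R \<and> fraction R z d \<in> (frac_embed R ` I) \<cdot>\<^bsub>?Q\<^esub> N" if "z \<in> I \<cdot> ?B" for z
      using that
    proof (induction rule: ideal_prod.induct)
      case (prod i j)
      have "fraction R (i \<otimes> j) d = frac_embed R i \<otimes>\<^bsub>?Q\<^esub> fraction R j d"
        unfolding frac_embed_def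
        using fraction_mult[OF Ic[OF prod(1)] Bc[OF prod(2)] regular_elements_one d] dc by simp
      moreover have "fraction R j d \<in> N" unfolding N_def using prod(2) by (rule imageI)
      ultimately show ?case
        using prod Ic by (simp add: ideal_prod.prod)
    next
      case (sum s1 s2)
      then show ?case using fraction_add_same[of s1 s2 d] d ideal_prod.sum by fastforce
    qed
    from this[OF ideal.I_l_closed[OF IB dI r(1)]]
    have "fraction R (r \<otimes> d) d \<in> (frac_embed R ` I) \<cdot>\<^bsub>?Q\<^esub> N" by blast
    moreover have "fraction R (r \<otimes> d) d = fraction R r \<one>"
      using r dc d by (intro fraction_eqI) (simp_all add: regular_elements_one)
    ultimately show "x \<in> (frac_embed R ` I) \<cdot>\<^bsub>?Q\<^esub> N" using r by (simp add: frac_embed_def)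
  qed
  ultimately show ?thesis using I by (auto simp: invertible_ideal_def)
qed

end

section \<open>Embedding a ring as a corner of a type\<close>

definition vscale :: "'t::comm_ring_1 \<Rightarrow> ('i \<Rightarrow> 't) \<Rightarrow> 'i \<Rightarrow> 't" where
  "vscale c v = (\<lambda>i. c * v i)"

lemma vscale_apply [simp]: "vscale c v i = c * v i"
  by (simp add: vscale_def)

lemma module_vscale: "Modules.module vscale"
  by standard (auto simp: vscale_def fun_eq_iff algebra_simps)

lemma free_module_simps:
  "carrier (free_module R S) = {x \<in> S \<rightarrow>\<^sub>E carrier R. finite {i \<in> S. x i \<noteq> \<zero>\<^bsub>R\<^esub>}}"
  "x \<oplus>\<^bsub>free_module R S\<^esub> y = (\<lambda>i\<in>S. x i \<oplus>\<^bsub>R\<^esub> y i)"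
  "a \<odot>\<^bsub>free_module R S\<^esub> x = (\<lambda>i\<in>S. a \<otimes>\<^bsub>R\<^esub> x i)"
  "\<zero>\<^bsub>free_module R S\<^esub> = (\<lambda>i\<in>S. \<zero>\<^bsub>R\<^esub>)"
  by (simp_all add: free_module_def direct_sum_def ideal_module_def)

text \<open>
  The ring \<open>R\<close> is identified with the corner \<open>e T\<close> of a type \<open>T\<close>, by \<open>\<iota>\<close> and the projection \<open>\<kappa>\<close>.
  This replaces the carriers of the locale-based algebra by type class algebra.
\<close>

locale corner_embedding = cring R for R (structure) +
  fixes \<iota> :: "'a \<Rightarrow> 't::comm_ring_1" and \<kappa> :: "'t \<Rightarrow> 'a" and e :: 't
  assumes \<kappa>_closed [simp]: "\<kappa> t \<in> carrier R"
    and \<kappa>_add: "\<kappa> (s + t) = \<kappa> s \<oplus> \<kappa> t"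
    and \<kappa>_mult: "\<kappa> (s * t) = \<kappa> s \<otimes> \<kappa> t"
    and \<kappa>_one: "\<kappa> 1 = \<one>"
    and \<iota>_\<kappa>: "\<iota> (\<kappa> t) = e * t"
    and \<kappa>_\<iota>: "a \<in> carrier R \<Longrightarrow> \<kappa> (\<iota> a) = a"
begin

lemma \<kappa>_zero: "\<kappa> 0 = \<zero>"
  using \<kappa>_add[of 0 0] by simp

lemma \<kappa>_uminus: "\<kappa> (- t) = \<ominus> \<kappa> t"
proof -
  have "\<kappa> (- t) \<oplus> \<kappa> t = \<zero>" by (simp add: \<kappa>_zero flip: \<kappa>_add)
  from minus_equality[OF this] show ?thesis by simp
qed

lemma e_eq: "e = \<iota> \<one>"
  using \<iota>_\<kappa>[of 1] by (simp add: \<kappa>_one)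

lemma e_\<iota>: "a \<in> carrier R \<Longrightarrow> e * \<iota> a = \<iota> a"
  by (metis \<iota>_\<kappa> \<kappa>_\<iota>)

lemma e_idem: "e * e = e"
  using e_\<iota>[of \<one>] e_eq by simp

lemma \<kappa>_e: "\<kappa> e = \<one>"
  by (simp add: e_eq \<kappa>_\<iota>)

lemma \<kappa>_e_mult: "\<kappa> (e * t) = \<kappa> t"
  by (simp add: \<kappa>_mult \<kappa>_e)

lemma \<iota>_add: "a \<in> carrier R \<Longrightarrow> b \<in> carrier R \<Longrightarrow> \<iota> (a \<oplus> b) = \<iota> a + \<iota> b"
  using \<iota>_\<kappa>[of "\<iota> a + \<iota> b"] by (simp add: \<kappa>_add \<kappa>_\<iota> distrib_left e_\<iota>)

lemma \<iota>_mult: "a \<in> carrier R \<Longrightarrow> b \<in> carrier R \<Longrightarrow> \<iota> (a \<otimes> b) = \<iota> a * \<iota> b"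
  using \<iota>_\<kappa>[of "\<iota> a * \<iota> b"] by (simp add: \<kappa>_mult \<kappa>_\<iota> e_\<iota> flip: mult.assoc)

lemma \<iota>_zero: "\<iota> \<zero> = 0"
  using \<iota>_\<kappa>[of 0] by (simp add: \<kappa>_zero)

lemma \<iota>_inj: "a \<in> carrier R \<Longrightarrow> b \<in> carrier R \<Longrightarrow> \<iota> a = \<iota> b \<Longrightarrow> a = b"
  by (metis \<kappa>_\<iota>)

lemma \<kappa>_inj: "e * s = s \<Longrightarrow> e * t = t \<Longrightarrow> \<kappa> s = \<kappa> t \<Longrightarrow> s = t"
  by (metis \<iota>_\<kappa>)

lemma \<kappa>_image_ideal:
  assumes I: "rideal I"
  shows "ideal (\<kappa> ` I) R"
proof (rule idealI[OF ring_axioms])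
  show "subgroup (\<kappa> ` I) (add_monoid R)"
  proof (rule add.subgroupI)
    show "\<kappa> ` I \<noteq> {}" using rideal_0[OF I] by blast
    show "\<ominus> a \<in> \<kappa> ` I" if "a \<in> \<kappa> ` I" for a
      using that rideal_neg[OF I] by (auto simp flip: \<kappa>_uminus)
    show "a \<oplus> b \<in> \<kappa> ` I" if "a \<in> \<kappa> ` I" "b \<in> \<kappa> ` I" for a b
      using that rideal_add[OF I] by (auto simp flip: \<kappa>_add)
  qed auto
  fix a x assume a: "a \<in> \<kappa> ` I" and x: "x \<in> carrier R"
  obtain t where t: "t \<in> I" "a = \<kappa> t" using a by blast
  have "x \<otimes> a = \<kappa> (\<iota> x * t)" using t x by (simp add: \<kappa>_mult \<kappa>_\<iota>)
  then show "x \<otimes> a \<in> \<kappa> ` I" using rideal_mult[OF I t(1)] by blast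
  then show "a \<otimes> x \<in> \<kappa> ` I" using t x by (simp add: m_comm)
qed

lemma \<kappa>_mem_iff:
  assumes I: "rideal I" and t: "e * t = t"
  shows "\<kappa> t \<in> \<kappa> ` I \<longleftrightarrow> t \<in> I"
proof
  assume "\<kappa> t \<in> \<kappa> ` I"
  then obtain s where s: "s \<in> I" "\<kappa> t = \<kappa> s" by blast
  then have "t = e * s" using t \<kappa>_inj[OF t, of "e * s"] e_idem by (simp add: \<kappa>_e_mult flip: mult.assoc)
  then show "t \<in> I" using rideal_mult[OF I s(1)] by simp
qed blast

text \<open>Extensional functions are \<open>undefined\<close> outside \<open>S\<close>; the value 0
  instead lets the pointwise operations of the function type apply.\<close>

definition vec :: "'i set \<Rightarrow> ('i \<Rightarrow> 'a) \<Rightarrow> 'i \<Rightarrow> 't" where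
  "vec S x = (\<lambda>i. if i \<in> S then \<iota> (x i) else 0)"

lemma vec_add:
  "x \<in> carrier (free_module R S) \<Longrightarrow> y \<in> carrier (free_module R S) \<Longrightarrow>
    vec S (x \<oplus>\<^bsub>free_module R S\<^esub> y) = vec S x + vec S y"
  by (auto simp: vec_def free_module_simps fun_eq_iff PiE_iff \<iota>_add)

lemma vec_scale:
  "x \<in> carrier (free_module R S) \<Longrightarrow> vec S (\<kappa> c \<odot>\<^bsub>free_module R S\<^esub> x) = vscale c (vec S x)"
  by (auto simp: vec_def free_module_simps fun_eq_iff PiE_iff \<iota>_mult \<iota>_\<kappa> e_\<iota> mult.left_commute[of e] mult.assoc)

lemma vec_zero: "vec S (\<zero>\<^bsub>free_module R S\<^esub>) = 0"
  by (auto simp: vec_def free_module_simps fun_eq_iff \<iota>_zero)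

lemma vec_inj: "inj_on (vec S) (carrier (free_module R S))"
proof (rule inj_onI)
  fix x y assume x: "x \<in> carrier (free_module R S)" and y: "y \<in> carrier (free_module R S)"
    and eq: "vec S x = vec S y"
  show "x = y"
  proof (rule PiE_ext[of _ S "\<lambda>_. carrier R"])
    show "x \<in> S \<rightarrow>\<^sub>E carrier R" "y \<in> S \<rightarrow>\<^sub>E carrier R" using x y by (auto simp: free_module_simps)
    fix i assume i: "i \<in> S"
    then have "\<iota> (x i) = \<iota> (y i)" using fun_cong[OF eq, of i] by (simp add: vec_def)
    then show "x i = y i" using x y i by (intro \<iota>_inj) (auto simp: free_module_simps PiE_iff)
  qed
qed

lemma vec_image:
  "vec S ` carrier (free_module R S) = {v. (\<forall>i. e * v i = v i) \<and> (\<forall>i. i \<notin> S \<longrightarrow> v i = 0) \<and> finite {i. v i \<noteq> 0}}"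
proof (intro equalityI subsetI)
  fix v assume "v \<in> vec S ` carrier (free_module R S)"
  then obtain x where x: "x \<in> carrier (free_module R S)" "v = vec S x" by blast
  have "{i. v i \<noteq> 0} \<subseteq> {i \<in> S. x i \<noteq> \<zero>}" using x by (auto simp: vec_def \<iota>_zero)
  moreover have "finite {i \<in> S. x i \<noteq> \<zero>}" using x by (simp add: free_module_simps)
  ultimately have "finite {i. v i \<noteq> 0}" by (rule finite_subset)
  then show "v \<in> {v. (\<forall>i. e * v i = v i) \<and> (\<forall>i. i \<notin> S \<longrightarrow> v i = 0) \<and> finite {i. v i \<noteq> 0}}"
    using x by (auto simp: vec_def free_module_simps PiE_iff e_\<iota>)
next
  fix v assume v: "v \<in> {v. (\<forall>i. e * v i = v i) \<and> (\<forall>i. i \<notin> S \<longrightarrow> v i = 0) \<and> finite {i. v i \<noteq> 0}}"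
  define x where "x = (\<lambda>i\<in>S. \<kappa> (v i))"
  have "{i \<in> S. x i \<noteq> \<zero>} \<subseteq> {i. v i \<noteq> 0}" by (auto simp: x_def \<kappa>_zero)
  then have "finite {i \<in> S. x i \<noteq> \<zero>}" using v finite_subset by blast
  then have "x \<in> carrier (free_module R S)" by (auto simp: free_module_simps x_def)
  moreover have "v = vec S x" using v by (auto simp: vec_def x_def fun_eq_iff \<iota>_\<kappa>)
  ultimately show "v \<in> vec S ` carrier (free_module R S)" by blast
qed

lemma submodule_image:
  assumes A: "submodule A R M"
    and add: "\<And>x y. x \<in> A \<Longrightarrow> y \<in> A \<Longrightarrow> \<alpha> (x \<oplus>\<^bsub>M\<^esub> y) = \<alpha> x + \<alpha> y"
    and scale: "\<And>c x. x \<in> A \<Longrightarrow> \<alpha> (\<kappa> c \<odot>\<^bsub>M\<^esub> x) = vscale c (\<alpha> x)"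
  shows "Modules.module.subspace vscale (\<alpha> ` A)"
proof -
  have sg: "subgroup A (add_monoid M)" using A by (rule submodule.axioms)
  have cl: "\<kappa> c \<odot>\<^bsub>M\<^esub> x \<in> A" if "x \<in> A" for c x using submodule.smult_closed[OF A] that by simp
  obtain x0 where x0: "x0 \<in> A" using subgroup.one_closed[OF sg] by blast
  have "vscale 0 (\<alpha> x0) = 0" by (simp add: vscale_def fun_eq_iff)
  then have "0 \<in> \<alpha> ` A" using scale[OF x0, of 0] cl[OF x0, of 0] by (metis imageI)
  moreover have "\<alpha> x + \<alpha> y \<in> \<alpha> ` A" if "x \<in> A" "y \<in> A" for x y
    using subgroup.m_closed[OF sg that] that by (auto simp flip: add)
  moreover have "vscale c (\<alpha> x) \<in> \<alpha> ` A" if "x \<in> A" for c x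
    using cl[OF that] that by (auto simp flip: scale)
  ultimately show ?thesis unfolding Modules.module.subspace_def[OF module_vscale] by blast
qed

text \<open>Embed the ideal as a summand \<open>A\<close> of a free module: \<open>g s\<close> is
  the coordinate at \<open>s\<close>, and \<open>X s\<close> corresponds to the component in
  \<open>A\<close> of the basis vector at \<open>s\<close>. The basis \<open>S\<close> may be
  infinite, but each \<open>y\<close> involves only finitely many members.\<close>

lemma dual_basis_ideal:
  assumes her: "hereditary R" and J: "rideal J"
  shows "\<exists>(S :: 'a set) X g. (\<forall>s\<in>S. X s \<in> J) \<and> (\<forall>s\<in>S. \<forall>c. \<forall>y\<in>J. g s (c * y) = c * g s y) \<and>
    (\<forall>y\<in>J. \<exists>T. finite T \<and> T \<subseteq> S \<and> e * y = (\<Sum>s\<in>T. g s y * X s))"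
proof -
  define I where "I = \<kappa> ` J"
  have I: "ideal I R" unfolding I_def by (rule \<kappa>_image_ideal[OF J])
  have Ic: "y \<in> carrier R" if "y \<in> I" for y using ideal.Icarr[OF I that] .
  have "projective R (ideal_module R I)" using her I by (simp add: hereditary_def)
  then obtain S :: "'a set" and A B where A: "submodule A R (free_module R S)" and B: "submodule B R (free_module R S)"
    and AB: "A <+>\<^bsub>free_module R S\<^esub> B = carrier (free_module R S)"
    and int: "A \<inter> B = {\<zero>\<^bsub>free_module R S\<^esub>}"
    and iso: "module_isomorphic R (ideal_module R I) (free_module R S\<lparr>carrier := A\<rparr>)"
    unfolding projective_def by (elim exE conjE) (rule that)
  let ?F = "free_module R S"
  obtain \<phi> where "\<phi> \<in> module_iso R (ideal_module R I) (?F\<lparr>carrier := A\<rparr>)"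
    using iso by (auto simp: module_isomorphic_def)
  then have bij: "bij_betw \<phi> I A" and \<phi>_add: "\<And>x y. x \<in> I \<Longrightarrow> y \<in> I \<Longrightarrow> \<phi> (x \<oplus> y) = \<phi> x \<oplus>\<^bsub>?F\<^esub> \<phi> y"
    and \<phi>_smult: "\<And>a x. a \<in> carrier R \<Longrightarrow> x \<in> I \<Longrightarrow> \<phi> (a \<otimes> x) = a \<odot>\<^bsub>?F\<^esub> \<phi> x"
    by (auto simp: module_iso_def module_homs_def ideal_module_def)
  have Ac: "A \<subseteq> carrier ?F" and Bc: "B \<subseteq> carrier ?F"
    using subgroup.subset[OF submodule.axioms(1)[OF A]] subgroup.subset[OF submodule.axioms(1)[OF B]] by simp_all
  have \<phi>A: "\<phi> y \<in> A" if "y \<in> I" for y using bij that by (auto simp: bij_betw_def)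
  define \<alpha> where "\<alpha> y = vec S (\<phi> y)" for y
  have sc: "\<kappa> c \<otimes> y \<in> I" if "y \<in> I" for c y using ideal.I_l_closed[OF I that] by simp
  have \<alpha>_add: "\<alpha> (y \<oplus> z) = \<alpha> y + \<alpha> z" if "y \<in> I" "z \<in> I" for y z
    using that \<phi>_add \<phi>A Ac vec_add[of "\<phi> y" S "\<phi> z"] by (auto simp: \<alpha>_def)
  have \<alpha>_scale: "\<alpha> (\<kappa> c \<otimes> y) = vscale c (\<alpha> y)" if "y \<in> I" for c y
    using that \<phi>_smult \<phi>A Ac vec_scale[of "\<phi> y" S c] by (auto simp: \<alpha>_def)
  have \<alpha>_inj: "inj_on \<alpha> I"
    unfolding \<alpha>_def using bij vec_inj[of S] Ac \<phi>A
    by (intro comp_inj_on[of \<phi> I "vec S", unfolded comp_def]) (auto simp: bij_betw_def intro: inj_on_subset)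
  have im: "\<alpha> ` I = vec S ` A" using bij by (auto simp: \<alpha>_def bij_betw_def image_comp)
  have vA: "Modules.module.subspace vscale (vec S ` A)"
    by (rule submodule_image[OF A]) (use Ac in \<open>auto intro!: vec_add vec_scale\<close>)
  have vB: "Modules.module.subspace vscale (vec S ` B)"
    by (rule submodule_image[OF B]) (use Bc in \<open>auto intro!: vec_add vec_scale\<close>)
  define k where "k w = \<iota> (inv_into I \<alpha> w)" for w
  have k: "k (\<alpha> y) = \<iota> y" if "y \<in> I" for y using that \<alpha>_inj by (simp add: k_def)
  have k_lin: "lin_on vscale (*) (vec S ` A) k"
    unfolding im[symmetric]
  proof (rule lin_onI)
    fix v w assume "v \<in> \<alpha> ` I" "w \<in> \<alpha> ` I"
    then obtain y z where yz: "y \<in> I" "z \<in> I" "v = \<alpha> y" "w = \<alpha> z" by blast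
    have "y \<oplus> z \<in> I" using additive_subgroup.a_closed[OF ideal.axioms(1)[OF I]] yz by blast
    then show "k (v + w) = k v + k w" using yz k Ic by (simp add: \<iota>_add flip: \<alpha>_add)
  next
    fix c v assume "v \<in> \<alpha> ` I"
    then obtain y where y: "y \<in> I" "v = \<alpha> y" by blast
    have "k (vscale c v) = \<iota> (\<kappa> c \<otimes> y)" using y k sc by (simp flip: \<alpha>_scale)
    also have "\<dots> = c * (e * \<iota> y)" using Ic[OF y(1)] by (simp add: \<iota>_mult \<iota>_\<kappa> mult_ac)
    also have "\<dots> = c * k v" using y k e_\<iota>[OF Ic[OF y(1)]] by simp
    finally show "k (vscale c v) = c * k v" .
  qed
  define b where "b s = (\<lambda>i\<in>S. if i = s then \<one> else \<zero>)" for s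
  have b: "b s \<in> carrier ?F" for s
  proof -
    have "{i \<in> S. b s i \<noteq> \<zero>} \<subseteq> {s}" by (auto simp: b_def)
    then have "finite {i \<in> S. b s i \<noteq> \<zero>}" by (rule finite_subset) simp
    then show ?thesis by (auto simp: free_module_simps b_def)
  qed
  have "\<exists>pq. fst pq \<in> A \<and> snd pq \<in> B \<and> b s = fst pq \<oplus>\<^bsub>?F\<^esub> snd pq" for s
  proof -
    have "b s \<in> A <+>\<^bsub>?F\<^esub> B" using b AB by simp
    then show ?thesis unfolding set_add_def set_mult_def by force
  qed
  then obtain pq where pq: "\<And>s. fst (pq s) \<in> A" "\<And>s. snd (pq s) \<in> B"
    "\<And>s. b s = fst (pq s) \<oplus>\<^bsub>?F\<^esub> snd (pq s)" by metis
  define p where "p s = fst (pq s)" for s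
  define q where "q s = snd (pq s)" for s
  have p: "p s \<in> A" and q: "q s \<in> B" and bpq: "vec S (b s) = vec S (p s) + vec S (q s)" for s
    using pq(1,2)[of s] vec_add[of "p s" S "q s"] pq(3)[of s] Ac Bc by (auto simp: p_def q_def)
  define x where "x s = inv_into I \<phi> (p s)" for s
  have x: "x s \<in> I" "\<phi> (x s) = p s" for s
    using bij p[of s] by (auto simp: x_def bij_betw_def intro: inv_into_into f_inv_into_f)
  define X where "X s = \<iota> (x s)" for s
  define g where "g s t = \<iota> (\<phi> (\<kappa> t) s)" for s t
  have XJ: "X s \<in> J" for s
  proof -
    obtain t where "t \<in> J" "x s = \<kappa> t" using x(1)[of s] by (auto simp: I_def)
    then show ?thesis using rideal_mult[OF J] by (simp add: X_def \<iota>_\<kappa>)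
  qed
  have \<phi>c: "\<phi> y s \<in> carrier R" if "y \<in> I" "s \<in> S" for y s
    using \<phi>A[OF that(1)] Ac that by (auto simp: free_module_simps PiE_iff)
  have g: "g s (c * y) = c * g s y" if s: "s \<in> S" and y: "y \<in> J" for s c y
  proof -
    have yI: "\<kappa> y \<in> I" using y by (simp add: I_def)
    have "\<phi> (\<kappa> c \<otimes> \<kappa> y) s = \<kappa> c \<otimes> \<phi> (\<kappa> y) s"
      using s by (simp add: \<phi>_smult[OF \<kappa>_closed yI] free_module_simps)
    then have "g s (c * y) = \<iota> (\<kappa> c \<otimes> \<phi> (\<kappa> y) s)" by (simp add: g_def \<kappa>_mult)
    also have "\<dots> = c * (e * \<iota> (\<phi> (\<kappa> y) s))" using \<phi>c[OF yI s] by (simp add: \<iota>_mult \<iota>_\<kappa> mult_ac)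
    also have "\<dots> = c * g s y" using e_\<iota>[OF \<phi>c[OF yI s]] by (simp add: g_def)
    finally show ?thesis .
  qed
  have "\<exists>T. finite T \<and> T \<subseteq> S \<and> e * y = (\<Sum>s\<in>T. g s y * X s)" if y: "y \<in> J" for y
  proof -
    have yI: "\<kappa> y \<in> I" using y by (simp add: I_def)
    define T where "T = {s \<in> S. \<phi> (\<kappa> y) s \<noteq> \<zero>}"
    have T: "finite T" using \<phi>A[OF yI] Ac by (auto simp: T_def free_module_simps)
    have "\<alpha> (\<kappa> y) i = (\<Sum>s\<in>T. vscale (g s y) (vec S (b s))) i" for i
    proof -
      have sum_apply: "(\<Sum>s\<in>T. F s) i = (\<Sum>s\<in>T. F s i)" for F :: "'a \<Rightarrow> 'a \<Rightarrow> 't"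
        using T by (induction T) simp_all
      have "(\<Sum>s\<in>T. vscale (g s y) (vec S (b s)) i) = (\<Sum>s\<in>T. if s = i then g i y * e else 0)"
        by (rule sum.cong) (auto simp: vec_def b_def \<iota>_zero T_def simp flip: e_eq)
      also have "\<dots> = (if i \<in> T then e * g i y else 0)" using T by (simp add: mult.commute)
      also have "\<dots> = \<alpha> (\<kappa> y) i"
        using e_\<iota>[OF \<phi>c[OF yI, of i]] by (auto simp: \<alpha>_def vec_def g_def T_def \<iota>_zero)
      finally show ?thesis by (simp add: sum_apply)
    qed
    then have "\<alpha> (\<kappa> y) = (\<Sum>s\<in>T. vscale (g s y) (vec S (b s)))" by blast
    also have "\<dots> = (\<Sum>s\<in>T. vscale (g s y) (vec S (p s))) + (\<Sum>s\<in>T. vscale (g s y) (vec S (q s)))"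
      by (simp add: bpq Modules.module.scale_right_distrib[OF module_vscale] sum.distrib)
    finally have eq: "\<alpha> (\<kappa> y) = (\<Sum>s\<in>T. vscale (g s y) (vec S (p s))) + (\<Sum>s\<in>T. vscale (g s y) (vec S (q s)))"
      (is "_ = ?P + ?Q") .
    have P: "?P \<in> vec S ` A"
      by (intro Modules.module.subspace_sum[OF module_vscale vA] Modules.module.subspace_scale[OF module_vscale vA] imageI p)
    have Q: "?Q \<in> vec S ` B"
      by (intro Modules.module.subspace_sum[OF module_vscale vB] Modules.module.subspace_scale[OF module_vscale vB] imageI q)
    \<comment> \<open>The vector itself and its part \<open>?P\<close> lie in \<open>A\<close>, so
      the part \<open>?Q\<close> lies in both summands and is 0.\<close>
    have "\<alpha> (\<kappa> y) \<in> vec S ` A" using yI im by blast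
    from Modules.module.subspace_diff[OF module_vscale vA this P] have "?Q \<in> vec S ` A"
      unfolding eq by (simp only: add_diff_cancel_left')
    then obtain a c where ac: "a \<in> A" "c \<in> B" "?Q = vec S a" "?Q = vec S c" using Q by blast
    then have "a = c" using inj_onD[OF vec_inj, of S a c] Ac Bc by auto
    then have "a = \<zero>\<^bsub>?F\<^esub>" using ac int by blast
    then have "?Q = 0" using ac vec_zero by simp
    then have "\<alpha> (\<kappa> y) = ?P" using eq by simp
    then have "\<iota> (\<kappa> y) = k ?P" using k[OF yI] by simp
    also have "\<dots> = (\<Sum>s\<in>T. k (vscale (g s y) (vec S (p s))))"
      by (rule module_pair.lin_on_sum[OF _ vA k_lin])
        (auto intro!: module_pair.intro module_vscale module_mult Modules.module.subspace_scale[OF module_vscale vA] p)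
    also have "\<dots> = (\<Sum>s\<in>T. g s y * k (vec S (p s)))" using p by (simp add: lin_on_scale[OF k_lin])
    also have "\<dots> = (\<Sum>s\<in>T. g s y * X s)"
      using k[OF x(1)] by (simp add: \<alpha>_def x(2) X_def)
    finally show ?thesis using T by (auto simp: \<iota>_\<kappa> T_def)
  qed
  then show ?thesis using XJ g by (intro exI[of _ S] exI[of _ X] exI[of _ g]) blast
qed

text \<open>Both properties are read off a dual basis. For a principal ideal with generator
  \<open>a\<close>, writing X_s = c_s a makes the sum of the g_s(a) c_s, cut down to the corner, an
  idempotent that fixes \<open>a\<close>. For an ideal containing a regular \<open>d\<close>, the
  g_s(d) serve as \<open>b\<close>, since g_s(d) x = g_s(d x) = d g_s(x).\<close>

lemma corner_is_hereditary:
  assumes her: "hereditary R"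
  shows "hereditary_corner e"
proof
  show "e * e = e" by (rule e_idem)
  fix a assume ea: "e * a = a"
  define J where "J = {c * a | c. True}"
  have J: "rideal J" unfolding J_def by (rule rideal_principal)
  have "a = 1 * a" by simp
  then have aJ: "a \<in> J" unfolding J_def by blast
  obtain S :: "'a set" and X g where X: "\<forall>s\<in>S. X s \<in> J" and g: "\<forall>s\<in>S. \<forall>c. \<forall>y\<in>J. g s (c * y) = c * g s y"
    and dual: "\<forall>y\<in>J. \<exists>T. finite T \<and> T \<subseteq> S \<and> e * y = (\<Sum>s\<in>T. g s y * X s)"
    using dual_basis_ideal[OF her J] by (elim exE conjE) (rule that)
  obtain T where T: "finite T" "T \<subseteq> S" "a = (\<Sum>s\<in>T. g s a * X s)" using dual aJ ea by metis
  have "\<forall>s\<in>T. \<exists>c. X s = c * a" using X T(2) by (auto simp: J_def)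
  from bchoice[OF this] obtain c where c: "\<forall>s\<in>T. X s = c s * a" ..
  define p where "p = e * (\<Sum>s\<in>T. g s a * c s)"
  have "(\<Sum>s\<in>T. g s a * X s) = (\<Sum>s\<in>T. g s a * c s) * a"
    unfolding sum_distrib_right using c by (intro sum.cong) (auto simp: mult.assoc)
  then have "e * a = p * a" unfolding p_def using T(3) by (simp add: mult.assoc)
  then have pa: "p * a = a" using ea by simp
  have ann: "r * p = 0" if "r * a = 0" for r
  proof -
    have "r * g s a = 0" if "s \<in> T" for s
    proof -
      have "s \<in> S" using that T by blast
      then have "r * g s a = g s (r * a)" "g s (0 * a) = 0 * g s a" using g aJ by metis+
      then show ?thesis using \<open>r * a = 0\<close> by simp
    qed
    then have "r * (\<Sum>s\<in>T. g s a * c s) = 0"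
      unfolding sum_distrib_left by (intro sum.neutral) (simp flip: mult.assoc)
    then show ?thesis by (simp add: p_def mult.left_commute[of r])
  qed
  have "(1 - p) * a = 0" using pa by (simp add: left_diff_distrib)
  then have "(1 - p) * p = 0" by (rule ann)
  then have "p * p = p" by (simp add: left_diff_distrib)
  moreover have "e * p = p" using e_idem by (simp add: p_def flip: mult.assoc)
  ultimately show "\<exists>p. e * p = p \<and> is_supp p a" using pa ann unfolding is_supp_def by blast
next
  fix I d assume I: "rideal I" and d: "d \<in> I" and reg: "corner.regular e d"
  interpret corner e by standard (rule e_idem)
  have ed: "(1 - e) * d = 1 - e" using reg by (simp add: regular_def)
  obtain S :: "'a set" and X g where X: "\<forall>s\<in>S. X s \<in> I" and g: "\<forall>s\<in>S. \<forall>c. \<forall>y\<in>I. g s (c * y) = c * g s y"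
    and dual: "\<forall>y\<in>I. \<exists>T. finite T \<and> T \<subseteq> S \<and> e * y = (\<Sum>s\<in>T. g s y * X s)"
    using dual_basis_ideal[OF her I] by (elim exE conjE) (rule that)
  obtain T where T: "finite T" "T \<subseteq> S" "e * d = (\<Sum>s\<in>T. g s d * X s)" using dual d by blast
  obtain h where h: "bij_betw h {0..<card T} T" using ex_bij_betw_nat_finite[OF T(1)] by blast
  define m where "m = card T"
  have hT: "h i \<in> S" if "i < m" for i using h that T(2) by (auto simp: bij_betw_def m_def)
  \<comment> \<open>The dual basis covers only the corner; the extra index \<open>m\<close> supplies
    the complement, where 1 - e = (1 - e) d lies in \<open>I\<close>.\<close>
  define a where "a i = (if i < m then X (h i) else 1 - e)" for i
  define b where "b i = (if i < m then g (h i) d else 1 - e)" for i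
  have "a i \<in> I" for i
    using X hT rideal_mult[OF I d, of "1 - e"] ed by (simp add: a_def)
  moreover have "d dvd b i * x" if x: "x \<in> I" for i x
  proof (cases "i < m")
    case True
    have "g (h i) d * x = d * g (h i) x"
      using g[rule_format, OF hT[OF True] d, of x] g[rule_format, OF hT[OF True] x, of d] by (simp add: mult.commute)
    then show ?thesis using True by (simp add: b_def)
  next
    case False
    have "(1 - e) * x = d * ((1 - e) * x)" using ed by (metis mult.assoc mult.commute)
    then show ?thesis using False by (metis b_def dvd_triv_left)
  qed
  moreover have "(\<Sum>i<Suc m. a i * b i) = d"
  proof -
    have "(\<Sum>i<m. a i * b i) = (\<Sum>i\<in>{0..<card T}. g (h i) d * X (h i))"
      by (rule sum.cong) (auto simp: m_def a_def b_def)
    also have "\<dots> = (\<Sum>s\<in>T. g s d * X s)" by (rule sum.reindex_bij_betw[OF h])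
    finally have "(\<Sum>i<Suc m. a i * b i) = e * d + (1 - e) * (1 - e)"
      using T(3) by (simp add: a_def b_def)
    also have "(1 - e) * (1 - e) = (1 - e) * d" using e_idem ed by (simp add: algebra_simps)
    finally show ?thesis by (simp add: algebra_simps)
  qed
  ultimately show "\<exists>(N::nat) a b. (\<forall>i<N. a i \<in> I) \<and> (\<forall>i<N. \<forall>x\<in>I. d dvd b i * x) \<and> (\<Sum>i<N. a i * b i) = d"
    by (intro exI[of _ "Suc m"] exI[of _ a] exI[of _ b]) simp
qed

end

text \<open>All laws are inherited from the type along the surjection \<open>\<kappa>\<close>; this
  is how \<open>Re\<close> is seen to be a ring.\<close>

lemma cring_image:
  fixes S (structure) and \<kappa> :: "'t::comm_ring_1 \<Rightarrow> 'a"
  assumes car: "carrier S = range \<kappa>"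
    and add: "\<And>s t. \<kappa> (s + t) = \<kappa> s \<oplus> \<kappa> t" and mult: "\<And>s t. \<kappa> (s * t) = \<kappa> s \<otimes> \<kappa> t"
    and zero: "\<kappa> 0 = \<zero>" and one: "\<kappa> 1 = \<one>"
  shows "cring S"
proof (rule cringI)
  show "abelian_group S"
  proof (rule abelian_groupI)
    show "\<zero> \<in> carrier S" unfolding car zero[symmetric] by blast
    show "\<exists>y\<in>carrier S. y \<oplus> x = \<zero>" if x: "x \<in> carrier S" for x
    proof -
      obtain t where "x = \<kappa> t" using x unfolding car by blast
      then have "\<kappa> (- t) \<oplus> x = \<zero>" by (simp add: zero flip: add)
      then show ?thesis unfolding car by blast
    qed
  qed (auto simp: car zero[symmetric] ac_simps simp flip: add)
  show "comm_monoid S"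
    by (rule comm_monoidI) (auto simp: car one[symmetric] ac_simps simp flip: mult)
  show "(x \<oplus> y) \<otimes> z = x \<otimes> z \<oplus> y \<otimes> z" if "x \<in> carrier S" "y \<in> carrier S" "z \<in> carrier S" for x y z
    using that by (auto simp: car distrib_right simp flip: mult add)
qed

section \<open>Smaller corners, and transport of ideals and free modules\<close>

context corner_embedding
begin

text \<open>Makes \<open>Re\<close> again a corner of the same type, so that
  \<open>invertible_image\<close> can be applied in it.\<close>

lemma sub_corner:
  assumes \<delta>: "e * \<delta> = \<delta>" "\<delta> * \<delta> = \<delta>"
  shows "corner_embedding (idem_ring R (\<kappa> \<delta>)) \<iota> (\<lambda>t. \<kappa> (\<delta> * t)) \<delta>"
proof -
  let ?S = "idem_ring R (\<kappa> \<delta>)"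
  have car: "carrier ?S = range (\<lambda>t. \<kappa> (\<delta> * t))"
  proof -
    have "carrier ?S = (\<lambda>r. r \<otimes> \<kappa> \<delta>) ` carrier R" by (auto simp: idem_ring_def r_coset_def)
    also have "\<dots> = range (\<lambda>t. \<kappa> (\<delta> * t))"
    proof (intro equalityI subsetI)
      fix x assume "x \<in> (\<lambda>r. r \<otimes> \<kappa> \<delta>) ` carrier R"
      then obtain r where r: "r \<in> carrier R" "x = r \<otimes> \<kappa> \<delta>" by blast
      then have "x = \<kappa> (\<delta> * \<iota> r)" by (simp add: \<kappa>_mult \<kappa>_\<iota> m_comm)
      then show "x \<in> range (\<lambda>t. \<kappa> (\<delta> * t))" by (rule range_eqI)
    next
      fix x assume "x \<in> range (\<lambda>t. \<kappa> (\<delta> * t))"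
      then obtain t where "x = \<kappa> (\<delta> * t)" by blast
      then have "x = \<kappa> t \<otimes> \<kappa> \<delta>" by (simp add: \<kappa>_mult m_comm)
      then show "x \<in> (\<lambda>r. r \<otimes> \<kappa> \<delta>) ` carrier R" by (rule image_eqI) simp
    qed
    finally show ?thesis .
  qed
  have mult: "\<kappa> (\<delta> * (s * t)) = \<kappa> (\<delta> * s) \<otimes> \<kappa> (\<delta> * t)" for s t
  proof -
    have "\<delta> * (s * t) = (\<delta> * \<delta>) * (s * t)" using \<delta> by simp
    also have "\<dots> = (\<delta> * s) * (\<delta> * t)" by (simp only: mult_ac)
    finally show ?thesis by (simp only: \<kappa>_mult)
  qed
  have ops: "a \<oplus>\<^bsub>?S\<^esub> b = a \<oplus> b" "a \<otimes>\<^bsub>?S\<^esub> b = a \<otimes> b" "\<zero>\<^bsub>?S\<^esub> = \<zero>" "\<one>\<^bsub>?S\<^esub> = \<kappa> \<delta>" for a b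
    by (simp_all add: idem_ring_def)
  show ?thesis
  proof (intro corner_embedding.intro corner_embedding_axioms.intro)
    show "cring ?S"
      by (rule cring_image[of _ "\<lambda>t. \<kappa> (\<delta> * t)"])
        (simp_all add: car ops mult distrib_left \<kappa>_add \<kappa>_zero)
    show "\<kappa> (\<delta> * t) \<in> carrier ?S" for t unfolding car by blast
    show "\<kappa> (\<delta> * (s + t)) = \<kappa> (\<delta> * s) \<oplus>\<^bsub>?S\<^esub> \<kappa> (\<delta> * t)" for s t by (simp add: ops distrib_left \<kappa>_add)
    show "\<kappa> (\<delta> * (s * t)) = \<kappa> (\<delta> * s) \<otimes>\<^bsub>?S\<^esub> \<kappa> (\<delta> * t)" for s t by (simp add: ops mult)
    show "\<kappa> (\<delta> * 1) = \<one>\<^bsub>?S\<^esub>" by (simp add: ops)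
    show "\<iota> (\<kappa> (\<delta> * t)) = \<delta> * t" for t using \<delta> by (simp add: \<iota>_\<kappa> flip: mult.assoc)
    show "\<kappa> (\<delta> * \<iota> a) = a" if a: "a \<in> carrier ?S" for a
    proof -
      obtain t where t: "a = \<kappa> (\<delta> * t)" using a unfolding car by blast
      have "\<delta> * (e * (\<delta> * t)) = \<delta> * t" using \<delta> by (metis mult.assoc mult.commute)
      then show ?thesis unfolding t \<iota>_\<kappa> by simp
    qed
  qed
qed

text \<open>The hypothesis on \<open>d\<close> is \<open>nzd\<close> and does not mention the
  corner, because the data may come from a larger corner than the one in which the result is
  used.\<close>

lemma invertible_image:
  fixes N :: nat
  assumes J: "rideal J" and d: "d \<in> J" "nzd d"
    and u: "\<And>i. i < N \<Longrightarrow> u i \<in> J" and v: "\<And>i x. i < N \<Longrightarrow> x \<in> J \<Longrightarrow> d dvd v i * x"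
    and sum: "(\<Sum>i<N. u i * v i) = d"
  shows "invertible_ideal R (\<kappa> ` J)"
proof (rule invertible_idealI[OF \<kappa>_image_ideal[OF J]])
  show "\<kappa> d \<in> regular_elements R"
    unfolding regular_elements_def
  proof (intro CollectI conjI ballI impI)
    fix a assume a: "a \<in> carrier R" "a \<otimes> \<kappa> d = \<zero>"
    then have "\<iota> (a \<otimes> \<kappa> d) = 0" by (simp add: \<iota>_zero)
    moreover have "\<iota> (a \<otimes> \<kappa> d) = (e * \<iota> a) * d" using a(1) by (simp add: \<iota>_mult \<iota>_\<kappa> mult_ac)
    ultimately have "(e * \<iota> a) * d = 0" by simp
    then have "\<iota> a = 0" using nzdD[OF d(2)] e_\<iota>[OF a(1)] by simp
    then show "a = \<zero>" using \<kappa>_\<iota>[OF a(1)] by (simp add: \<kappa>_zero)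
  qed simp
  define B where "B = {b \<in> carrier R. \<forall>x\<in>\<kappa> ` J. \<exists>t\<in>carrier R. b \<otimes> x = \<kappa> d \<otimes> t}"
  have vB: "\<kappa> (v i) \<in> B" if "i < N" for i
  proof -
    have "\<exists>t\<in>carrier R. \<kappa> (v i) \<otimes> \<kappa> x = \<kappa> d \<otimes> t" if x: "x \<in> J" for x
    proof -
      obtain t where "v i * x = d * t" using v[OF \<open>i < N\<close> x] by blast
      then have "\<kappa> (v i) \<otimes> \<kappa> x = \<kappa> d \<otimes> \<kappa> t" by (simp flip: \<kappa>_mult)
      then show ?thesis using \<kappa>_closed by blast
    qed
    then show ?thesis by (auto simp: B_def)
  qed
  have "\<exists>t\<in>carrier R. \<zero> \<otimes> \<kappa> x = \<kappa> d \<otimes> t" for x by (rule bexI[of _ \<zero>]) simp_all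
  then have zB: "\<zero> \<in> B" by (auto simp: B_def)
  have "\<kappa> (\<Sum>i<k. u i * v i) \<in> \<kappa> ` J \<cdot> B" if "k \<le> N" for k
    using that
  proof (induction k)
    case 0
    have "\<kappa> 0 \<otimes> \<zero> \<in> \<kappa> ` J \<cdot> B" by (intro ideal_prod.prod imageI rideal_0[OF J] zB)
    then show ?case by (simp add: \<kappa>_zero)
  next
    case (Suc k)
    then have "\<kappa> (u k) \<otimes> \<kappa> (v k) \<in> \<kappa> ` J \<cdot> B" using u vB by (intro ideal_prod.prod) auto
    then show ?case using Suc by (simp add: \<kappa>_add \<kappa>_mult ideal_prod.sum)
  qed
  from this[of N] show "\<kappa> d \<in> \<kappa> ` J \<cdot> {b \<in> carrier R. \<forall>x\<in>\<kappa> ` J. \<exists>t\<in>carrier R. b \<otimes> x = \<kappa> d \<otimes> t}"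
    unfolding sum B_def by simp
qed

lemma iprod_image:
  assumes I: "rideal I" and J: "rideal J"
  shows "\<kappa> ` iprod I J = \<kappa> ` I \<cdot> \<kappa> ` J"
proof
  let ?K = "{t. \<kappa> t \<in> \<kappa> ` I \<cdot> \<kappa> ` J}"
  have id: "ideal (\<kappa> ` I \<cdot> \<kappa> ` J) R" by (intro ideal_prod_is_ideal \<kappa>_image_ideal I J)
  have "iprod I J \<subseteq> ?K"
  proof (rule iprod_minimal)
    show "rideal ?K"
      unfolding rideal_def
      using additive_subgroup.zero_closed[OF ideal.axioms(1)[OF id]]
        additive_subgroup.a_closed[OF ideal.axioms(1)[OF id]] ideal.I_l_closed[OF id]
      by (simp add: \<kappa>_zero \<kappa>_add \<kappa>_mult)
    show "a * b \<in> ?K" if "a \<in> I" "b \<in> J" for a b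
      using that by (simp add: \<kappa>_mult ideal_prod.prod)
  qed
  then show "\<kappa> ` iprod I J \<subseteq> \<kappa> ` I \<cdot> \<kappa> ` J" by blast
  show "\<kappa> ` I \<cdot> \<kappa> ` J \<subseteq> \<kappa> ` iprod I J"
  proof
    fix x assume "x \<in> \<kappa> ` I \<cdot> \<kappa> ` J"
    then show "x \<in> \<kappa> ` iprod I J"
    proof (induction rule: ideal_prod.induct)
      case (prod i j)
      then obtain a b where "a \<in> I" "b \<in> J" "i \<otimes> j = \<kappa> (a * b)" by (auto simp: \<kappa>_mult)
      then show ?case using iprodI[of a I b J] by auto
    next
      case (sum s1 s2)
      then obtain a b where "a \<in> iprod I J" "b \<in> iprod I J" "s1 \<oplus> s2 = \<kappa> (a + b)" by (auto simp: \<kappa>_add)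
      then show ?case using rideal_add[OF iprod_rideal] by blast
    qed
  qed
qed

lemma fg_image:
  assumes "fin_gen (*) J"
  shows "fg_ideal R (\<kappa> ` J)"
proof -
  obtain S where S: "finite S" "J = rspan S" using assms by (auto simp: fin_gen_def)
  have J: "rideal J" unfolding S by (rule rideal_span)
  have "\<kappa> ` J = Idl (\<kappa> ` S)"
  proof
    have sub: "\<kappa> ` S \<subseteq> carrier R" by auto
    have id: "ideal (Idl (\<kappa> ` S)) R" by (rule genideal_ideal[OF sub])
    have "rideal {t. \<kappa> t \<in> Idl (\<kappa> ` S)}"
      unfolding rideal_def
      using additive_subgroup.zero_closed[OF ideal.axioms(1)[OF id]]
        additive_subgroup.a_closed[OF ideal.axioms(1)[OF id]] ideal.I_l_closed[OF id]
      by (simp add: \<kappa>_zero \<kappa>_add \<kappa>_mult)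
    then have "rspan S \<subseteq> {t. \<kappa> t \<in> Idl (\<kappa> ` S)}"
      using genideal_self[OF sub] by (intro Modules.module.span_minimal[OF module_mult]) auto
    then show "\<kappa> ` J \<subseteq> Idl (\<kappa> ` S)" using S by blast
    show "Idl (\<kappa> ` S) \<subseteq> \<kappa> ` J"
      using Modules.module.span_superset[OF module_mult, of S] S
      by (intro genideal_minimal \<kappa>_image_ideal J) auto
  qed
  moreover have "finite (\<kappa> ` S)" "\<kappa> ` S \<subseteq> carrier R" using S by auto
  ultimately show ?thesis unfolding fg_ideal_def by blast
qed

lemma free_closed:
  assumes S: "finite S" and x: "x \<in> carrier (free_module R S)"
  shows "y \<in> carrier (free_module R S) \<Longrightarrow> x \<oplus>\<^bsub>free_module R S\<^esub> y \<in> carrier (free_module R S)"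
    and "a \<in> carrier R \<Longrightarrow> a \<odot>\<^bsub>free_module R S\<^esub> x \<in> carrier (free_module R S)"
  using assms by (auto simp: free_module_simps PiE_iff)

definition std :: "nat \<Rightarrow> (nat \<Rightarrow> 't) set" where
  "std k = vec {1..k} ` carrier (free_module R {1..k})"

lemma std_eq: "std k = {v. (\<forall>i. e * v i = v i) \<and> (\<forall>i. i \<notin> {1..k} \<longrightarrow> v i = 0)}"
proof -
  have "finite {i. v i \<noteq> 0}" if "\<forall>i. i \<notin> {1..k} \<longrightarrow> v i = 0" for v :: "nat \<Rightarrow> 't"
    by (rule finite_subset[of _ "{1..k}"]) (use that in auto)
  then show ?thesis unfolding std_def vec_image by blast
qed

lemma fin_gen_std: "fin_gen vscale (std k)"
proof -
  define b where "b j = (\<lambda>i. if i = j then e else 0)" for j :: nat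
  have sub: "Modules.module.subspace vscale (std k)"
    unfolding Modules.module.subspace_def[OF module_vscale] std_eq
    by (auto simp: distrib_left mult.left_commute[of e])
  have "std k = Modules.module.span vscale (b ` {1..k})"
  proof
    show "Modules.module.span vscale (b ` {1..k}) \<subseteq> std k"
      by (rule Modules.module.span_minimal[OF module_vscale _ sub]) (auto simp: std_eq b_def e_idem)
    show "std k \<subseteq> Modules.module.span vscale (b ` {1..k})"
    proof
      fix v assume v: "v \<in> std k"
      have "v = (\<Sum>j\<in>{1..k}. vscale (v j) (b j))"
      proof
        fix i
        have sum_apply: "(\<Sum>s\<in>A. F s) i = (\<Sum>s\<in>A. F s i)" if "finite A" for A and F :: "nat \<Rightarrow> nat \<Rightarrow> 't"
          using that by (induction A) simp_all
        have "(\<Sum>j\<in>{1..k}. vscale (v j) (b j)) i = (\<Sum>j\<in>{1..k}. if j = i then v i * e else 0)"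
          unfolding sum_apply[OF finite_atLeastAtMost] by (rule sum.cong) (auto simp: b_def)
        also have "\<dots> = v i" using v by (auto simp: std_eq mult.commute)
        finally show "v i = (\<Sum>j\<in>{1..k}. vscale (v j) (b j)) i" by simp
      qed
      also have "\<dots> \<in> Modules.module.span vscale (b ` {1..k})"
        by (intro Modules.module.span_sum[OF module_vscale] Modules.module.span_scale[OF module_vscale]
            Modules.module.span_base[OF module_vscale] imageI)
      finally show "v \<in> Modules.module.span vscale (b ` {1..k})" .
    qed
  qed
  then show ?thesis unfolding fin_gen_def by blast
qed

text \<open>The homomorphism is conjugated to a linear map on \<open>std l\<close>, where finite
  generation is known. In this way the relations of a presentation become a finitely generated set
  of vectors.\<close>

lemma fin_gen_hom_image:
  assumes f: "f \<in> module_homs R (free_module R {1..l}) P"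
    and add: "\<And>x y. x \<in> carrier P \<Longrightarrow> y \<in> carrier P \<Longrightarrow> \<beta> (x \<oplus>\<^bsub>P\<^esub> y) = \<beta> x + \<beta> y"
    and scale: "\<And>c x. x \<in> carrier P \<Longrightarrow> \<beta> (\<kappa> c \<odot>\<^bsub>P\<^esub> x) = vscale c (\<beta> x)"
  shows "fin_gen vscale (\<beta> ` f ` carrier (free_module R {1..l::nat}))"
proof -
  let ?F = "free_module R {1..l}"
  define g where "g v = \<beta> (f (inv_into (carrier ?F) (vec {1..l}) v))" for v
  have g: "g (vec {1..l} x) = \<beta> (f x)" if "x \<in> carrier ?F" for x
    using that vec_inj[of "{1..l}"] by (simp add: g_def)
  have fc: "f x \<in> carrier P" if "x \<in> carrier ?F" for x using f that by (auto simp: module_homs_def)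
  have lin: "lin_on vscale vscale (std l) g"
    unfolding std_def
  proof (rule lin_onI)
    fix v w assume "v \<in> vec {1..l} ` carrier ?F" "w \<in> vec {1..l} ` carrier ?F"
    then obtain x y where xy: "x \<in> carrier ?F" "y \<in> carrier ?F" "v = vec {1..l} x" "w = vec {1..l} y" by blast
    have "g (v + w) = g (vec {1..l} (x \<oplus>\<^bsub>?F\<^esub> y))" using xy vec_add by metis
    also have "\<dots> = \<beta> (f (x \<oplus>\<^bsub>?F\<^esub> y))" by (rule g) (intro free_closed finite_atLeastAtMost xy)
    also have "\<dots> = \<beta> (f x) + \<beta> (f y)" using f xy fc add by (simp add: module_homs_def)
    finally show "g (v + w) = g v + g w" using xy g by simp
  next
    fix c v assume "v \<in> vec {1..l} ` carrier ?F"
    then obtain x where x: "x \<in> carrier ?F" "v = vec {1..l} x" by blast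
    have "g (vscale c v) = g (vec {1..l} (\<kappa> c \<odot>\<^bsub>?F\<^esub> x))" using x vec_scale by metis
    also have "\<dots> = \<beta> (f (\<kappa> c \<odot>\<^bsub>?F\<^esub> x))" by (rule g) (intro free_closed finite_atLeastAtMost x \<kappa>_closed)
    also have "\<dots> = vscale c (\<beta> (f x))" using f x fc scale by (simp add: module_homs_def)
    finally show "g (vscale c v) = vscale c (g v)" using x g by simp
  qed
  have "g ` std l = \<beta> ` f ` carrier ?F"
    unfolding std_def image_image using g by (intro image_cong) auto
  moreover have "fin_gen vscale (g ` std l)"
    by (rule module_pair.fin_gen_image[OF _ _ lin fin_gen_std])
      (intro module_pair.intro module_vscale, rule module.fin_gen_subspace[OF module_vscale fin_gen_std])
  ultimately show ?thesis by simp
qed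

lemma vscale_module:
  assumes "hereditary R"
  shows "hereditary_corner_module e (vscale :: 't \<Rightarrow> ('i \<Rightarrow> 't) \<Rightarrow> 'i \<Rightarrow> 't)"
  by (intro hereditary_corner_module.intro corner_is_hereditary assms module_vscale)

lemma coords_std:
  assumes "hereditary R"
  shows "hereditary_corner_module.coords e vscale k (\<lambda>j v. v (Suc j)) (std k)"
proof -
  interpret hereditary_corner_module e "vscale :: 't \<Rightarrow> (nat \<Rightarrow> 't) \<Rightarrow> nat \<Rightarrow> 't" by (rule vscale_module[OF assms])
  have "v = 0" if v: "v \<in> std k" "\<forall>j<k. v (Suc j) = 0" for v
  proof
    fix i
    show "v i = 0 i"
    proof (cases "i \<in> {1..k}")
      case True
      then have "i - 1 < k" by auto
      then have "v (Suc (i - 1)) = 0" using v(2) by blast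
      then show ?thesis using True by simp
    qed (use v in \<open>auto simp: std_eq\<close>)
  qed
  then show ?thesis unfolding coords_def by (auto simp: lin_on_def std_eq)
qed

lemma invertible_regular_image:
  assumes her: "hereditary R" and I: "rideal I" and d: "d \<in> I" "corner.regular e d"
  shows "invertible_ideal R (\<kappa> ` I)"
proof -
  interpret hereditary_corner e by (rule corner_is_hereditary[OF her])
  obtain N :: nat and u v where uv: "\<And>i. i < N \<Longrightarrow> u i \<in> I"
      "\<And>i x. i < N \<Longrightarrow> x \<in> I \<Longrightarrow> d dvd v i * x" "(\<Sum>i<N. u i * v i) = d"
    by (rule invE[OF I d]) blast
  show ?thesis by (rule invertible_image[OF I d(1) regular_nzd[OF d(2)] uv])
qed

end

section \<open>The stacked bases property\<close>

text \<open>Places 1 to \<open>n\<close> hold the purification of \<open>H\<close>, the next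
  \<open>n\<close> its complement. Some of the ideals may be 0, which the stacked bases property
  permits.\<close>

lemma (in hereditary_corner_module) stacked_decomposition_family:
  assumes c: "coords n x G" and fg: "fin_gen scale G" and fH: "fin_gen scale H" and HG: "H \<subseteq> G"
  shows "\<exists>d Z J I. regular d \<and>
    (\<forall>j\<in>{1..2 * n}. functional G (Z j) \<and> fin_gen (*) (J j) \<and> (\<forall>r\<in>J j. e * r = r)) \<and>
    (\<forall>y\<in>G. \<forall>j\<in>{1..2 * n}. Z j y \<in> J j) \<and>
    (\<forall>r. (\<forall>j\<in>{1..2 * n}. r j \<in> J j) \<longrightarrow> (\<exists>y\<in>G. \<forall>j\<in>{1..2 * n}. Z j y = r j)) \<and>
    (\<forall>y\<in>G. (\<forall>j\<in>{1..2 * n}. Z j y = 0) \<longrightarrow> y = 0) \<and>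
    (\<forall>j\<in>{1..n}. rideal (I j) \<and> d \<in> I j) \<and> (\<forall>i\<in>{1..n}. \<forall>j\<in>{1..n}. i \<le> j \<longrightarrow> I j \<subseteq> I i) \<and>
    (\<forall>y\<in>G. y \<in> H \<longleftrightarrow> (\<forall>j\<in>{1..2 * n}. Z j y \<in> (if j \<le> n then iprod (I j) (J j) else {0})))"
proof -
  obtain d \<phi> J q I \<psi> L w where d: "regular d" and rk: "ranked n J q" "ranked n L w"
    and lins: "\<forall>j<n. functional G (\<phi> j) \<and> functional G (\<psi> j)"
    and val: "\<forall>j<n. \<forall>y\<in>G. \<phi> j y \<in> J j \<and> \<psi> j y \<in> L j"
    and surj: "\<forall>r r'. (\<forall>j<n. r j \<in> J j \<and> r' j \<in> L j) \<longrightarrow> (\<exists>y\<in>G. \<forall>j<n. \<phi> j y = r j \<and> \<psi> j y = r' j)"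
    and inj: "\<forall>y\<in>G. (\<forall>j<n. \<phi> j y = 0 \<and> \<psi> j y = 0) \<longrightarrow> y = 0"
    and I: "\<forall>j<n. rideal (I j) \<and> d \<in> I j" and chain: "\<forall>i j. i \<le> j \<longrightarrow> j < n \<longrightarrow> I j \<subseteq> I i"
    and mem: "\<forall>y\<in>G. y \<in> H \<longleftrightarrow> (\<forall>j<n. \<phi> j y \<in> iprod (I j) (J j) \<and> \<psi> j y = 0)"
    using stacked_decomposition[OF assms] by (elim exE conjE) (rule that)
  define Z where "Z j = (if j \<le> n then \<phi> (j - 1) else \<psi> (j - 1 - n))" for j
  define J' where "J' j = (if j \<le> n then J (j - 1) else L (j - 1 - n))" for j
  have split: "(\<forall>j\<in>{1..2 * n}. Q j) \<longleftrightarrow> (\<forall>j<n. Q (Suc j) \<and> Q (Suc (j + n)))" for Q :: "nat \<Rightarrow> bool"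
  proof
    assume "\<forall>j<n. Q (Suc j) \<and> Q (Suc (j + n))"
    moreover have "(\<exists>i<n. j = Suc i) \<or> (\<exists>i<n. j = Suc (i + n))" if "j \<in> {1..2 * n}" for j
    proof (cases "j \<le> n")
      case True
      then have "j - 1 < n \<and> j = Suc (j - 1)" using that by auto
      then show ?thesis by blast
    next
      case False
      then have "j - 1 - n < n \<and> j = Suc (j - 1 - n + n)" using that by auto
      then show ?thesis by blast
    qed
    ultimately show "\<forall>j\<in>{1..2 * n}. Q j" by blast
  qed auto
  have simps: "Z (Suc j) = \<phi> j" "J' (Suc j) = J j" "Z (Suc (j + n)) = \<psi> j" "J' (Suc (j + n)) = L j"
    if "j < n" for j using that by (auto simp: Z_def J'_def)
  have "\<forall>j\<in>{1..2 * n}. functional G (Z j) \<and> fin_gen (*) (J' j) \<and> (\<forall>r\<in>J' j. e * r = r)"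
    unfolding split using lins rk by (simp add: simps ranked_def)
  moreover have "\<forall>y\<in>G. \<forall>j\<in>{1..2 * n}. Z j y \<in> J' j"
    unfolding split using val by (simp add: simps)
  moreover have "\<exists>y\<in>G. \<forall>j\<in>{1..2 * n}. Z j y = r j" if "\<forall>j\<in>{1..2 * n}. r j \<in> J' j" for r
    using surj[rule_format, of "\<lambda>j. r (Suc j)" "\<lambda>j. r (Suc (j + n))"] that unfolding split by (simp add: simps)
  moreover have "y = 0" if "y \<in> G" "\<forall>j\<in>{1..2 * n}. Z j y = 0" for y
    using inj that unfolding split by (simp add: simps)
  moreover have "rideal (I (j - 1)) \<and> d \<in> I (j - 1)" if "j \<in> {1..n}" for j using I that by auto
  moreover have "I (j - 1) \<subseteq> I (i - 1)" if "i \<in> {1..n}" "j \<in> {1..n}" "i \<le> j" for i j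
    by (rule chain[rule_format]) (use that in auto)
  moreover have "y \<in> H \<longleftrightarrow> (\<forall>j\<in>{1..2 * n}. Z j y \<in> (if j \<le> n then iprod (I (j - 1)) (J' j) else {0}))"
    if "y \<in> G" for y
    using mem that unfolding split by (simp add: simps)
  ultimately show ?thesis
    using d by (intro exI[of _ d] exI[of _ Z] exI[of _ J'] exI[of _ "\<lambda>j. I (j - 1)"]) simp
qed

lemma direct_sum_simps:
  "carrier (direct_sum S M) = {x \<in> \<Pi>\<^sub>E i\<in>S. carrier (M i). finite {i \<in> S. x i \<noteq> \<zero>\<^bsub>M i\<^esub>}}"
  "x \<oplus>\<^bsub>direct_sum S M\<^esub> y = (\<lambda>i\<in>S. x i \<oplus>\<^bsub>M i\<^esub> y i)"
  "a \<odot>\<^bsub>direct_sum S M\<^esub> x = (\<lambda>i\<in>S. a \<odot>\<^bsub>M i\<^esub> x i)"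
  by (simp_all add: direct_sum_def)

lemma ideal_module_simps:
  "carrier (ideal_module R I) = I"
  "x \<oplus>\<^bsub>ideal_module R I\<^esub> y = x \<oplus>\<^bsub>R\<^esub> y"
  "a \<odot>\<^bsub>ideal_module R I\<^esub> x = a \<otimes>\<^bsub>R\<^esub> x"
  by (simp_all add: ideal_module_def)

lemma module_hom_zero:
  assumes M: "module R M" and N: "module R N" and f: "f \<in> module_homs R M N"
  shows "f \<zero>\<^bsub>M\<^esub> = \<zero>\<^bsub>N\<^esub>"
proof -
  interpret R: cring R using M by (simp add: module_def)
  interpret M: abelian_group M using M by (simp add: module_def)
  interpret N: abelian_group N using N by (simp add: module_def)
  have "f (\<zero>\<^bsub>R\<^esub> \<odot>\<^bsub>M\<^esub> \<zero>\<^bsub>M\<^esub>) = \<zero>\<^bsub>R\<^esub> \<odot>\<^bsub>N\<^esub> f \<zero>\<^bsub>M\<^esub>" "f \<zero>\<^bsub>M\<^esub> \<in> carrier N"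
    using f by (auto simp: module_homs_def)
  then show ?thesis using module.smult_l_null[OF M] module.smult_l_null[OF N] by simp
qed

section \<open>Transfer to modules over the given ring\<close>

context corner_embedding
begin

lemma semihereditary: "hereditary R \<Longrightarrow> semihereditary R"
  unfolding hereditary_def semihereditary_def fg_ideal_def using genideal_ideal by auto

text \<open>The decomposition requires \<open>H\<close> to be finitely generated. Finite
  presentation says this for the kernel of some other presentation of \<open>M\<close>, and the
  lemma of Schanuel transfers it to \<open>\<pi>\<close>.\<close>

lemma stacked_bases:
  fixes M :: "('a, 'm) module" and F :: "('a, 'f) module"
  assumes her: "hereditary R" and M: "module R M" "finitely_presented R M"
    and F: "module R F" "fg_free R F" and H: "submodule H R F"
    and \<pi>: "\<pi> \<in> module_homs R F M" "\<pi> ` carrier F = carrier M" and ker: "a_kernel F M \<pi> = H"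
  shows "\<exists>(n::nat) (m::nat) J I \<phi>.
    m \<le> n \<and> (\<forall>j\<in>{1..n}. fg_ideal R (J j)) \<and>
    (\<forall>j\<in>{1..m}. invertible_ideal R (I j)) \<and>
    (\<forall>i\<in>{1..m}. \<forall>j\<in>{1..m}. i \<le> j \<longrightarrow> I j \<subseteq> I i) \<and>
    \<phi> \<in> module_iso R F (direct_sum {1..n} (\<lambda>j. ideal_module R (J j))) \<and>
    \<phi> ` H = {x \<in> carrier (direct_sum {1..n} (\<lambda>j. ideal_module R (J j))).
               \<forall>j\<in>{1..n}. x j \<in> (if j \<le> m then I j \<cdot> J j else {\<zero>})}"
proof -
  interpret F: Module.module R F by (rule F(1))
  interpret M: Module.module R M by (rule M(1))
  interpret hereditary_corner_module e "vscale :: 't \<Rightarrow> (nat \<Rightarrow> 't) \<Rightarrow> nat \<Rightarrow> 't" by (rule vscale_module[OF her])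
  obtain k :: nat and \<psi> where "\<psi> \<in> module_iso R F (free_module R {1..k})"
    using F(2) by (auto simp: fg_free_def module_isomorphic_def)
  then have \<psi>: "bij_betw \<psi> (carrier F) (carrier (free_module R {1..k}))"
    and \<psi>_add: "\<And>x y. x \<in> carrier F \<Longrightarrow> y \<in> carrier F \<Longrightarrow> \<psi> (x \<oplus>\<^bsub>F\<^esub> y) = \<psi> x \<oplus>\<^bsub>free_module R {1..k}\<^esub> \<psi> y"
    and \<psi>_smult: "\<And>a x. a \<in> carrier R \<Longrightarrow> x \<in> carrier F \<Longrightarrow> \<psi> (a \<odot>\<^bsub>F\<^esub> x) = a \<odot>\<^bsub>free_module R {1..k}\<^esub> \<psi> x"
    by (auto simp: module_iso_def module_homs_def)
  have \<psi>c: "\<psi> x \<in> carrier (free_module R {1..k})" if "x \<in> carrier F" for x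
    using \<psi> that by (auto simp: bij_betw_def)
  define \<alpha> where "\<alpha> x = vec {1..k} (\<psi> x)" for x
  have \<alpha>_add: "\<alpha> (x \<oplus>\<^bsub>F\<^esub> y) = \<alpha> x + \<alpha> y" if "x \<in> carrier F" "y \<in> carrier F" for x y
    unfolding \<alpha>_def using that by (simp only: \<psi>_add vec_add \<psi>c)
  have \<alpha>_scale: "\<alpha> (\<kappa> c \<odot>\<^bsub>F\<^esub> x) = vscale c (\<alpha> x)" if "x \<in> carrier F" for c x
    unfolding \<alpha>_def using that by (simp only: \<psi>_smult vec_scale \<psi>c \<kappa>_closed)
  have \<alpha>_inj: "inj_on \<alpha> (carrier F)"
    unfolding \<alpha>_def using \<psi> vec_inj[of "{1..k}"] \<psi>c
    by (intro comp_inj_on[of \<psi> _ "vec {1..k}", unfolded comp_def]) (auto simp: bij_betw_def)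
  have \<alpha>_im: "\<alpha> ` carrier F = std k"
    unfolding std_def bij_betw_imp_surj_on[OF \<psi>, symmetric] by (simp add: \<alpha>_def image_image)
  have \<alpha>_zero: "\<alpha> \<zero>\<^bsub>F\<^esub> = 0" using \<alpha>_add[of "\<zero>\<^bsub>F\<^esub>" "\<zero>\<^bsub>F\<^esub>"] by simp
  obtain l k' :: nat and f g where f: "f \<in> module_homs R (free_module R {1..l}) (free_module R {1..k'})"
    and g: "g \<in> module_homs R (free_module R {1..k'}) M"
    and fg: "f ` carrier (free_module R {1..l}) = a_kernel (free_module R {1..k'}) M g"
    and g_surj: "g ` carrier (free_module R {1..k'}) = carrier M"
    using M(2) unfolding finitely_presented_def by (elim exE bexE conjE) (rule that)
  let ?F' = "free_module R {1..k'}"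
  \<comment> \<open>The fibre product of \<open>\<pi>\<close> and \<open>g\<close>, transported to
    functions with values in the type.\<close>
  define N where "N = {(\<alpha> x, vec {1..k'} y) | x y. x \<in> carrier F \<and> y \<in> carrier ?F' \<and> \<pi> x = g y}"
  have Hc: "H \<subseteq> carrier F" using subgroup.subset[OF submodule.axioms(1)[OF H]] by simp
  have H_iff: "x \<in> H \<longleftrightarrow> \<pi> x = \<zero>\<^bsub>M\<^esub>" if "x \<in> carrier F" for x
    unfolding ker[symmetric] using that by (simp add: a_kernel_def')
  have \<pi>c: "\<pi> x \<in> carrier M" if "x \<in> carrier F" for x using \<pi>(2) that by blast
  have gc: "g y \<in> carrier M" if "y \<in> carrier ?F'" for y using g_surj that by blast
  have N_zero: "(\<alpha> x, 0) \<in> N \<longleftrightarrow> x \<in> H" if x: "x \<in> carrier F" for x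
  proof -
    have F'z: "\<zero>\<^bsub>?F'\<^esub> \<in> carrier ?F'" by (simp add: free_module_simps)
    have gz: "g \<zero>\<^bsub>?F'\<^esub> = \<zero>\<^bsub>M\<^esub>"
    proof -
      have "g (\<zero> \<odot>\<^bsub>?F'\<^esub> \<zero>\<^bsub>?F'\<^esub>) = \<zero> \<odot>\<^bsub>M\<^esub> g \<zero>\<^bsub>?F'\<^esub>" using g F'z by (simp add: module_homs_def)
      moreover have "\<zero> \<odot>\<^bsub>?F'\<^esub> \<zero>\<^bsub>?F'\<^esub> = \<zero>\<^bsub>?F'\<^esub>" by (auto simp: free_module_simps)
      ultimately show ?thesis using gc[OF F'z] by simp
    qed
    have "(\<alpha> x, 0) \<in> N \<longleftrightarrow> \<pi> x = g \<zero>\<^bsub>?F'\<^esub>"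
    proof
      assume "(\<alpha> x, 0) \<in> N"
      then obtain x' y where xy: "\<alpha> x = \<alpha> x'" "0 = vec {1..k'} y" "x' \<in> carrier F" "y \<in> carrier ?F'" "\<pi> x' = g y"
        unfolding N_def by blast
      have "x = x'" using inj_onD[OF \<alpha>_inj xy(1) x xy(3)] .
      moreover have "y = \<zero>\<^bsub>?F'\<^esub>" using inj_onD[OF vec_inj _ xy(4) F'z] xy(2) vec_zero by metis
      ultimately show "\<pi> x = g \<zero>\<^bsub>?F'\<^esub>" using xy by simp
    next
      assume "\<pi> x = g \<zero>\<^bsub>?F'\<^esub>"
      then show "(\<alpha> x, 0) \<in> N" unfolding N_def using x F'z vec_zero by (metis (mono_tags, lifting) mem_Collect_eq)
    qed
    then show ?thesis using H_iff[OF x] gz by simp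
  qed
  have fgK: "fin_gen vscale {y. (0, y) \<in> N}"
  proof -
    have "{y. (0, y) \<in> N} = vec {1..k'} ` f ` carrier (free_module R {1..l})"
    proof (intro equalityI subsetI)
      fix v assume "v \<in> {y. (0, y) \<in> N}"
      then obtain x y where xy: "0 = \<alpha> x" "v = vec {1..k'} y" "x \<in> carrier F" "y \<in> carrier ?F'" "\<pi> x = g y"
        unfolding N_def by blast
      have "x = \<zero>\<^bsub>F\<^esub>" using inj_onD[OF \<alpha>_inj _ xy(3)] xy(1) \<alpha>_zero by simp
      then have "g y = \<zero>\<^bsub>M\<^esub>" using module_hom_zero[OF F(1) M(1) \<pi>(1)] xy by simp
      then have "y \<in> f ` carrier (free_module R {1..l})" unfolding fg using xy by (simp add: a_kernel_def')
      then show "v \<in> vec {1..k'} ` f ` carrier (free_module R {1..l})" using xy by blast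
    next
      fix v assume "v \<in> vec {1..k'} ` f ` carrier (free_module R {1..l})"
      then obtain y where y: "y \<in> carrier ?F'" "g y = \<zero>\<^bsub>M\<^esub>" "v = vec {1..k'} y"
        unfolding fg by (auto simp: a_kernel_def')
      then have "\<pi> \<zero>\<^bsub>F\<^esub> = g y" using module_hom_zero[OF F(1) M(1) \<pi>(1)] by simp
      then have "(\<alpha> \<zero>\<^bsub>F\<^esub>, vec {1..k'} y) \<in> N" unfolding N_def using y by blast
      then show "v \<in> {y. (0, y) \<in> N}" using y \<alpha>_zero by simp
    qed
    moreover have "fin_gen vscale (vec {1..k'} ` f ` carrier (free_module R {1..l}))"
      by (rule fin_gen_hom_image[OF f]; (rule vec_add vec_scale)?)
    ultimately show ?thesis by simp
  qed
  have subs: "subspace (std i)" for i by (rule fin_gen_subspace[OF fin_gen_std])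
  obtain L1 where L1: "dual_list vscale (std k) L1" using dual_list_exists[OF coords_std[OF her] fin_gen_std] ..
  obtain L2 where L2: "dual_list vscale (std k') L2" using dual_list_exists[OF coords_std[OF her] fin_gen_std] ..
  have N_scale: "(vscale c v, vscale c w) \<in> N" if vw: "(v, w) \<in> N" for c v w
  proof -
    obtain x y where xy: "v = \<alpha> x" "w = vec {1..k'} y" "x \<in> carrier F" "y \<in> carrier ?F'" "\<pi> x = g y"
      using vw unfolding N_def by blast
    have "\<pi> (\<kappa> c \<odot>\<^bsub>F\<^esub> x) = g (\<kappa> c \<odot>\<^bsub>?F'\<^esub> y)" using xy \<pi>(1) g by (simp add: module_homs_def)
    moreover have "\<kappa> c \<odot>\<^bsub>?F'\<^esub> y \<in> carrier ?F'" by (intro free_closed finite_atLeastAtMost xy \<kappa>_closed)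
    moreover have "\<kappa> c \<odot>\<^bsub>F\<^esub> x \<in> carrier F" using xy by simp
    ultimately have "(\<alpha> (\<kappa> c \<odot>\<^bsub>F\<^esub> x), vec {1..k'} (\<kappa> c \<odot>\<^bsub>?F'\<^esub> y)) \<in> N" unfolding N_def by blast
    then show ?thesis using xy \<alpha>_scale vec_scale by metis
  qed
  have N_add: "(v + v', w + w') \<in> N" if vw: "(v, w) \<in> N" "(v', w') \<in> N" for v w v' w'
  proof -
    obtain x y where xy: "v = \<alpha> x" "w = vec {1..k'} y" "x \<in> carrier F" "y \<in> carrier ?F'" "\<pi> x = g y"
      using vw(1) unfolding N_def by blast
    obtain x' y' where xy': "v' = \<alpha> x'" "w' = vec {1..k'} y'" "x' \<in> carrier F" "y' \<in> carrier ?F'" "\<pi> x' = g y'"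
      using vw(2) unfolding N_def by blast
    have "\<pi> (x \<oplus>\<^bsub>F\<^esub> x') = g (y \<oplus>\<^bsub>?F'\<^esub> y')" using xy xy' \<pi>(1) g by (simp add: module_homs_def)
    moreover have "y \<oplus>\<^bsub>?F'\<^esub> y' \<in> carrier ?F'" by (intro free_closed finite_atLeastAtMost xy xy')
    moreover have "x \<oplus>\<^bsub>F\<^esub> x' \<in> carrier F" using xy xy' by simp
    ultimately have "(\<alpha> (x \<oplus>\<^bsub>F\<^esub> x'), vec {1..k'} (y \<oplus>\<^bsub>?F'\<^esub> y')) \<in> N" unfolding N_def by blast
    then show ?thesis using xy xy' \<alpha>_add vec_add by metis
  qed
  have N_fst: "\<exists>w. (v, w) \<in> N" if v: "v \<in> std k" for v
  proof -
    obtain x where x: "x \<in> carrier F" "v = \<alpha> x" using v unfolding \<alpha>_im[symmetric] by blast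
    then obtain y where "y \<in> carrier ?F'" "\<pi> x = g y" using \<pi>c g_surj by (metis imageE)
    then show ?thesis using x unfolding N_def by blast
  qed
  have N_snd: "\<exists>v. (v, w) \<in> N" if w: "w \<in> std k'" for w
  proof -
    obtain y where y: "y \<in> carrier ?F'" "w = vec {1..k'} y" using w unfolding std_def by blast
    then obtain x where "x \<in> carrier F" "\<pi> x = g y" using gc \<pi>(2) by (metis imageE)
    then show ?thesis using y unfolding N_def by blast
  qed
  have N_sub: "N \<subseteq> std k \<times> std k'" unfolding N_def \<alpha>_im[symmetric] std_def[of k'] by blast
  have N_00: "(0, 0) \<in> N"
  proof -
    obtain w where "(0, w) \<in> N" using N_fst subspace_0[OF subs] by blast
    from N_scale[OF this, of 0] show ?thesis by (simp add: vscale_def zero_fun_def)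
  qed
  have "fin_gen vscale {v. (v, 0) \<in> N}"
    by (rule schanuel[OF subs L1 fin_gen_std subs L2 N_sub N_00 N_add N_scale N_fst N_snd fgK])
  moreover have "{v. (v, 0) \<in> N} = \<alpha> ` H"
  proof (intro equalityI subsetI)
    fix v assume v: "v \<in> {v. (v, 0) \<in> N}"
    then have "v \<in> std k" using N_sub by blast
    then obtain x where "x \<in> carrier F" "v = \<alpha> x" unfolding \<alpha>_im[symmetric] by blast
    then show "v \<in> \<alpha> ` H" using v N_zero by blast
  qed (use N_zero Hc in blast)
  ultimately have fH: "fin_gen vscale (\<alpha> ` H)" by simp
  have HG: "\<alpha> ` H \<subseteq> std k" unfolding \<alpha>_im[symmetric] using Hc by blast
  obtain d Z J I where d: "regular d"
    and ZJ: "\<forall>j\<in>{1..2 * k}. functional (std k) (Z j) \<and> fin_gen (*) (J j) \<and> (\<forall>r\<in>J j. e * r = r)"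
    and val: "\<forall>y\<in>std k. \<forall>j\<in>{1..2 * k}. Z j y \<in> J j"
    and surj: "\<forall>r. (\<forall>j\<in>{1..2 * k}. r j \<in> J j) \<longrightarrow> (\<exists>y\<in>std k. \<forall>j\<in>{1..2 * k}. Z j y = r j)"
    and inj: "\<forall>y\<in>std k. (\<forall>j\<in>{1..2 * k}. Z j y = 0) \<longrightarrow> y = 0"
    and I: "\<forall>j\<in>{1..k}. rideal (I j) \<and> d \<in> I j"
    and chain: "\<forall>i\<in>{1..k}. \<forall>j\<in>{1..k}. i \<le> j \<longrightarrow> I j \<subseteq> I i"
    and mem: "\<forall>y\<in>std k. y \<in> \<alpha> ` H \<longleftrightarrow> (\<forall>j\<in>{1..2 * k}. Z j y \<in> (if j \<le> k then iprod (I j) (J j) else {0}))"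
    using stacked_decomposition_family[OF coords_std[OF her] fin_gen_std fH HG] by (elim exE conjE) (rule that)
  let ?D = "direct_sum {1..2 * k} (\<lambda>j. ideal_module R (\<kappa> ` J j))"
  define \<Phi> where "\<Phi> x = (\<lambda>j\<in>{1..2 * k}. \<kappa> (Z j (\<alpha> x)))" for x
  have \<alpha>c: "\<alpha> x \<in> std k" if "x \<in> carrier F" for x using that \<alpha>_im by blast
  have D_carrier: "carrier ?D = (\<Pi>\<^sub>E j\<in>{1..2 * k}. \<kappa> ` J j)"
    by (simp add: direct_sum_simps ideal_module_simps)
  have \<Phi>c: "\<Phi> x \<in> carrier ?D" if "x \<in> carrier F" for x
    unfolding D_carrier \<Phi>_def restrict_PiE_iff using val \<alpha>c[OF that] by blast
  \<comment> \<open>The values lie in the corner, and \<open>\<kappa>\<close> is injective there;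
    every comparison of \<open>\<Phi>\<close> with \<open>Z\<close> rests on this.\<close>
  have eZ: "e * Z j (\<alpha> x) = Z j (\<alpha> x)" if "j \<in> {1..2 * k}" "x \<in> carrier F" for j x
    using ZJ val \<alpha>c that by blast
  have hom: "\<Phi> \<in> module_homs R F ?D"
    unfolding module_homs_def
  proof (intro CollectI conjI ballI)
    show "\<Phi> \<in> carrier F \<rightarrow> carrier ?D" using \<Phi>c by blast
    fix x y assume xy: "x \<in> carrier F" "y \<in> carrier F"
    have "\<kappa> (Z j (\<alpha> (x \<oplus>\<^bsub>F\<^esub> y))) = \<kappa> (Z j (\<alpha> x)) \<oplus> \<kappa> (Z j (\<alpha> y))" if "j \<in> {1..2 * k}" for j
    proof -
      have "functional (std k) (Z j)" using ZJ that by blast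
      from lin_on_add[OF this \<alpha>c[OF xy(1)] \<alpha>c[OF xy(2)]] show ?thesis
        by (simp add: \<alpha>_add[OF xy] \<kappa>_add)
    qed
    then show "\<Phi> (x \<oplus>\<^bsub>F\<^esub> y) = \<Phi> x \<oplus>\<^bsub>?D\<^esub> \<Phi> y"
      unfolding direct_sum_simps ideal_module_simps \<Phi>_def by (intro restrict_ext) simp
  next
    fix a x assume a: "a \<in> carrier R" and x: "x \<in> carrier F"
    have "\<kappa> (Z j (\<alpha> (a \<odot>\<^bsub>F\<^esub> x))) = a \<otimes> \<kappa> (Z j (\<alpha> x))" if "j \<in> {1..2 * k}" for j
    proof -
      have "functional (std k) (Z j)" using ZJ that by blast
      from lin_on_scale[OF this \<alpha>c[OF x], of "\<iota> a"] show ?thesis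
        using \<alpha>_scale[OF x, of "\<iota> a"] a by (simp add: \<kappa>_\<iota> \<kappa>_mult)
    qed
    then show "\<Phi> (a \<odot>\<^bsub>F\<^esub> x) = a \<odot>\<^bsub>?D\<^esub> \<Phi> x"
      unfolding direct_sum_simps ideal_module_simps \<Phi>_def by (intro restrict_ext) simp
  qed
  have \<Phi>_inj: "inj_on \<Phi> (carrier F)"
  proof (rule inj_onI)
    fix x y assume xy: "x \<in> carrier F" "y \<in> carrier F" "\<Phi> x = \<Phi> y"
    have "Z j (\<alpha> x - \<alpha> y) = 0" if j: "j \<in> {1..2 * k}" for j
    proof -
      have "\<kappa> (Z j (\<alpha> x)) = \<kappa> (Z j (\<alpha> y))" using fun_cong[OF xy(3), of j] j by (simp add: \<Phi>_def)
      then have "Z j (\<alpha> x) = Z j (\<alpha> y)" by (rule \<kappa>_inj[OF eZ[OF j xy(1)] eZ[OF j xy(2)]])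
      moreover have Zj: "functional (std k) (Z j)" using ZJ j by blast
      ultimately show ?thesis by (simp add: functional_diff[OF subs Zj \<alpha>c[OF xy(1)] \<alpha>c[OF xy(2)]])
    qed
    moreover have "\<alpha> x - \<alpha> y \<in> std k" by (rule subspace_diff[OF subs \<alpha>c[OF xy(1)] \<alpha>c[OF xy(2)]])
    ultimately have "\<alpha> x - \<alpha> y = 0" using inj by blast
    then show "x = y" using inj_onD[OF \<alpha>_inj _ xy(1,2)] by simp
  qed
  have \<Phi>_surj: "\<exists>x\<in>carrier F. \<Phi> x = y" if y: "y \<in> carrier ?D" for y
  proof -
    have "\<forall>j\<in>{1..2 * k}. \<exists>t. t \<in> J j \<and> y j = \<kappa> t" using y unfolding D_carrier PiE_iff by blast
    from bchoice[OF this] obtain t where t: "\<forall>j\<in>{1..2 * k}. t j \<in> J j \<and> y j = \<kappa> (t j)" ..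
    then obtain v where v: "v \<in> std k" "\<forall>j\<in>{1..2 * k}. Z j v = t j" using surj by blast
    then obtain x where x: "x \<in> carrier F" "v = \<alpha> x" unfolding \<alpha>_im[symmetric] by blast
    have "\<Phi> x = restrict y {1..2 * k}" unfolding \<Phi>_def using t v x by (intro restrict_ext) simp
    also have "\<dots> = y" using y unfolding D_carrier by (rule PiE_restrict)
    finally show ?thesis using x by blast
  qed
  have iso: "\<Phi> \<in> module_iso R F ?D"
    using hom \<Phi>_inj \<Phi>_surj \<Phi>c by (auto simp: module_iso_def bij_betw_def)
  have H_mem: "x \<in> H \<longleftrightarrow> (\<forall>j\<in>{1..2 * k}. \<Phi> x j \<in> (if j \<le> k then \<kappa> ` I j \<cdot> \<kappa> ` J j else {\<zero>}))"
    if x: "x \<in> carrier F" for x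
  proof -
    have "x \<in> H \<longleftrightarrow> \<alpha> x \<in> \<alpha> ` H" using inj_on_image_mem_iff[OF \<alpha>_inj x Hc] by simp
    also have "\<dots> \<longleftrightarrow> (\<forall>j\<in>{1..2 * k}. Z j (\<alpha> x) \<in> (if j \<le> k then iprod (I j) (J j) else {0}))"
      using mem \<alpha>c[OF x] by blast
    also have "\<dots> \<longleftrightarrow> (\<forall>j\<in>{1..2 * k}. \<Phi> x j \<in> (if j \<le> k then \<kappa> ` I j \<cdot> \<kappa> ` J j else {\<zero>}))"
    proof (intro ball_cong refl)
      fix j assume j: "j \<in> {1..2 * k}"
      have J: "rideal (J j)" using ZJ j module.fin_gen_subspace[OF module_mult] by blast
      show "Z j (\<alpha> x) \<in> (if j \<le> k then iprod (I j) (J j) else {0}) \<longleftrightarrow>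
          \<Phi> x j \<in> (if j \<le> k then \<kappa> ` I j \<cdot> \<kappa> ` J j else {\<zero>})"
      proof (cases "j \<le> k")
        case True
        then have Ij: "rideal (I j)" using I j by auto
        have "\<kappa> (Z j (\<alpha> x)) \<in> \<kappa> ` I j \<cdot> \<kappa> ` J j \<longleftrightarrow> Z j (\<alpha> x) \<in> iprod (I j) (J j)"
          unfolding iprod_image[OF Ij J, symmetric] by (rule \<kappa>_mem_iff[OF iprod_rideal eZ[OF j x]])
        then show ?thesis using True j by (simp add: \<Phi>_def)
      next
        case False
        have "\<kappa> (Z j (\<alpha> x)) = \<zero> \<longleftrightarrow> Z j (\<alpha> x) = 0"
          using \<kappa>_inj[OF eZ[OF j x], of 0] by (auto simp: \<kappa>_zero)
        then show ?thesis using False j by (simp add: \<Phi>_def)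
      qed
    qed
    finally show ?thesis .
  qed
  have "\<Phi> ` H = {y \<in> carrier ?D. \<forall>j\<in>{1..2 * k}. y j \<in> (if j \<le> k then \<kappa> ` I j \<cdot> \<kappa> ` J j else {\<zero>})}"
    (is "_ = ?X")
  proof
    show "\<Phi> ` H \<subseteq> ?X" using H_mem Hc \<Phi>c by blast
    show "?X \<subseteq> \<Phi> ` H"
    proof
      fix y assume y: "y \<in> ?X"
      then obtain x where x: "x \<in> carrier F" "\<Phi> x = y" using \<Phi>_surj by blast
      then have "x \<in> H" using H_mem[OF x(1)] y by simp
      then show "y \<in> \<Phi> ` H" using x by blast
    qed
  qed
  moreover have "\<forall>j\<in>{1..2 * k}. fg_ideal R (\<kappa> ` J j)" using ZJ fg_image by blast
  moreover have "\<forall>j\<in>{1..k}. invertible_ideal R (\<kappa> ` I j)"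
    using I invertible_regular_image[OF her _ _ d] by blast
  moreover have "\<forall>i\<in>{1..k}. \<forall>j\<in>{1..k}. i \<le> j \<longrightarrow> \<kappa> ` I j \<subseteq> \<kappa> ` I i" using chain by blast
  ultimately show ?thesis
    using iso by (intro exI[of _ "2 * k"] exI[of _ k] exI[of _ "\<lambda>j. \<kappa> ` J j"] exI[of _ "\<lambda>j. \<kappa> ` I j"] exI[of _ \<Phi>]) simp
qed

lemma stacked_bases_property:
  "hereditary R \<Longrightarrow> stacked_bases_property TYPE('f) TYPE('m) R"
  unfolding stacked_bases_property_def
  by (intro conjI allI impI semihereditary; (elim conjE)?; (rule stacked_bases)?)

end

section \<open>Finitely presented modules\<close>

lemma direct_sum2_simps:
  "carrier (direct_sum2 M N) = carrier M \<times> carrier N"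
  "(x, y) \<oplus>\<^bsub>direct_sum2 M N\<^esub> (x', y') = (x \<oplus>\<^bsub>M\<^esub> x', y \<oplus>\<^bsub>N\<^esub> y')"
  "a \<odot>\<^bsub>direct_sum2 M N\<^esub> (x, y) = (a \<odot>\<^bsub>M\<^esub> x, a \<odot>\<^bsub>N\<^esub> y)"
  by (simp_all add: direct_sum2_def)

lemma (in ring) quotient_module_simps:
  assumes I: "ideal I R"
  shows "carrier (quotient_module R I) = {I +> r | r. r \<in> carrier R}"
    and "a \<in> carrier R \<Longrightarrow> b \<in> carrier R \<Longrightarrow>
      (I +> a) \<oplus>\<^bsub>quotient_module R I\<^esub> (I +> b) = I +> (a \<oplus> b)"
    and "a \<in> carrier R \<Longrightarrow> b \<in> carrier R \<Longrightarrow>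
      a \<odot>\<^bsub>quotient_module R I\<^esub> (I +> b) = I +> (a \<otimes> b)"
  by (auto simp: quotient_module_def FactRing_def A_RCOSETS_def' ideal.a_rcos_sum[OF I]
      ideal.rcoset_mult_add[OF I])

section \<open>From a presentation to the decomposition of the module\<close>

context corner_embedding
begin

text \<open>\<open>\<Psi>\<close> and \<open>g\<close> are onto with the same kernel, so
  \<open>\<Psi>\<close> evaluated at any preimage under \<open>g\<close> induces the
  isomorphism.\<close>

lemma presented_isomorphic:
  fixes k :: nat
  assumes M: "module R M" and g: "g \<in> module_homs R (free_module R {1..k}) M"
    and g_surj: "g ` carrier (free_module R {1..k}) = carrier M"
    and \<Psi>: "\<And>v. v \<in> std k \<Longrightarrow> \<Psi> v \<in> carrier D"
    and \<Psi>_add: "\<And>v v'. v \<in> std k \<Longrightarrow> v' \<in> std k \<Longrightarrow> \<Psi> (v + v') = \<Psi> v \<oplus>\<^bsub>D\<^esub> \<Psi> v'"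
    and \<Psi>_scale: "\<And>c v. v \<in> std k \<Longrightarrow> \<Psi> (vscale c v) = \<kappa> c \<odot>\<^bsub>D\<^esub> \<Psi> v"
    and \<Psi>_surj: "\<And>x. x \<in> carrier D \<Longrightarrow> \<exists>v\<in>std k. \<Psi> v = x"
    and \<Psi>_eq: "\<And>v v'. v \<in> std k \<Longrightarrow> v' \<in> std k \<Longrightarrow>
      \<Psi> v = \<Psi> v' \<longleftrightarrow> v - v' \<in> vec {1..k} ` a_kernel (free_module R {1..k}) M g"
  shows "module_isomorphic R M D"
proof -
  interpret M: Module.module R M by (rule M)
  let ?A = "free_module R {1..k}" and ?v = "vec {1..k}"
  have A_add: "y \<oplus>\<^bsub>?A\<^esub> y' \<in> carrier ?A" if "y \<in> carrier ?A" "y' \<in> carrier ?A" for y y'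
    by (intro free_closed finite_atLeastAtMost that)
  have A_smult: "a \<odot>\<^bsub>?A\<^esub> y \<in> carrier ?A" if "a \<in> carrier R" "y \<in> carrier ?A" for a y
    by (intro free_closed finite_atLeastAtMost that)
  have vc: "?v y \<in> std k" if "y \<in> carrier ?A" for y using that unfolding std_def by blast
  have gc: "g y \<in> carrier M" if "y \<in> carrier ?A" for y using g_surj that by blast
  have g_add: "g (y \<oplus>\<^bsub>?A\<^esub> y') = g y \<oplus>\<^bsub>M\<^esub> g y'" if "y \<in> carrier ?A" "y' \<in> carrier ?A" for y y'
    using g that by (simp add: module_homs_def)
  have g_smult: "g (a \<odot>\<^bsub>?A\<^esub> y) = a \<odot>\<^bsub>M\<^esub> g y" if "a \<in> carrier R" "y \<in> carrier ?A" for a y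
    using g that by (simp add: module_homs_def)
  have ker: "?v y - ?v y' \<in> ?v ` a_kernel ?A M g \<longleftrightarrow> g y = g y'"
    if y: "y \<in> carrier ?A" "y' \<in> carrier ?A" for y y'
  proof
    assume "?v y - ?v y' \<in> ?v ` a_kernel ?A M g"
    then obtain a where a: "a \<in> carrier ?A" "g a = \<zero>\<^bsub>M\<^esub>" "?v y - ?v y' = ?v a"
      by (auto simp: a_kernel_def')
    then have "?v y = ?v (y' \<oplus>\<^bsub>?A\<^esub> a)" using vec_add[OF y(2) a(1)] by (simp add: algebra_simps)
    then have "y = y' \<oplus>\<^bsub>?A\<^esub> a" using inj_onD[OF vec_inj _ y(1) A_add[OF y(2) a(1)]] by blast
    then show "g y = g y'" using g_add[OF y(2) a(1)] a(2) gc[OF y(2)] by simp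
  next
    assume eq: "g y = g y'"
    \<comment> \<open>The difference of \<open>y\<close> and \<open>y'\<close>, written with
      addition and the scalar -1, the operations that both \<open>vec\<close> and \<open>g\<close>
      respect.\<close>
    define a where "a = y \<oplus>\<^bsub>?A\<^esub> (\<kappa> (- 1) \<odot>\<^bsub>?A\<^esub> y')"
    have s: "\<kappa> (- 1) \<odot>\<^bsub>?A\<^esub> y' \<in> carrier ?A" by (rule A_smult[OF \<kappa>_closed y(2)])
    have "g a = g y \<oplus>\<^bsub>M\<^esub> (\<ominus> \<one>) \<odot>\<^bsub>M\<^esub> g y'"
      unfolding a_def using g_add[OF y(1) s] g_smult[OF \<kappa>_closed[of "- 1"] y(2)] by (simp add: \<kappa>_uminus \<kappa>_one)
    also have "\<dots> = \<zero>\<^bsub>M\<^esub>" using eq gc[OF y(2)] by (simp add: M.smult_l_minus M.r_neg)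
    finally have "a \<in> a_kernel ?A M g" using A_add[OF y(1) s] by (simp add: a_kernel_def' a_def)
    moreover have "vscale (- 1) (?v y') = - ?v y'" by (simp add: vscale_def fun_eq_iff)
    then have "?v a = ?v y - ?v y'" unfolding a_def using vec_add[OF y(1) s] vec_scale[OF y(2), of "- 1"] by simp
    ultimately show "?v y - ?v y' \<in> ?v ` a_kernel ?A M g" by (metis imageI)
  qed
  have \<Psi>_iff: "\<Psi> (?v y) = \<Psi> (?v y') \<longleftrightarrow> g y = g y'" if "y \<in> carrier ?A" "y' \<in> carrier ?A" for y y'
    using \<Psi>_eq[OF vc vc] ker that by simp
  define \<Theta> where "\<Theta> u = \<Psi> (?v (inv_into (carrier ?A) g u))" for u
  have \<Theta>: "\<Theta> (g y) = \<Psi> (?v y)" if y: "y \<in> carrier ?A" for y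
  proof -
    have "g y \<in> g ` carrier ?A" using y by blast
    then have "inv_into (carrier ?A) g (g y) \<in> carrier ?A" "g (inv_into (carrier ?A) g (g y)) = g y"
      by (rule inv_into_into, rule f_inv_into_f)
    then show ?thesis unfolding \<Theta>_def using \<Psi>_iff y by blast
  qed
  have pre: "\<exists>y\<in>carrier ?A. u = g y" if "u \<in> carrier M" for u using that g_surj by blast
  have "\<Theta> \<in> module_homs R M D"
    unfolding module_homs_def
  proof (intro CollectI conjI ballI Pi_I)
    fix u assume "u \<in> carrier M"
    then obtain y where y: "y \<in> carrier ?A" "u = g y" using pre by blast
    show "\<Theta> u \<in> carrier D" using y \<Theta> \<Psi> vc by simp
    show "\<Theta> (a \<odot>\<^bsub>M\<^esub> u) = a \<odot>\<^bsub>D\<^esub> \<Theta> u" if a: "a \<in> carrier R" for a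
    proof -
      have "\<Theta> (a \<odot>\<^bsub>M\<^esub> u) = \<Psi> (?v (\<kappa> (\<iota> a) \<odot>\<^bsub>?A\<^esub> y))"
        using \<Theta>[OF A_smult[OF a y(1)]] g_smult[OF a y(1)] y a by (simp add: \<kappa>_\<iota>)
      also have "\<dots> = a \<odot>\<^bsub>D\<^esub> \<Psi> (?v y)"
        using vec_scale[OF y(1), of "\<iota> a"] \<Psi>_scale[OF vc[OF y(1)], of "\<iota> a"] a by (simp add: \<kappa>_\<iota>)
      finally show ?thesis using \<Theta> y by simp
    qed
    fix u' assume "u' \<in> carrier M"
    then obtain y' where y': "y' \<in> carrier ?A" "u' = g y'" using pre by blast
    have "\<Theta> (u \<oplus>\<^bsub>M\<^esub> u') = \<Psi> (?v (y \<oplus>\<^bsub>?A\<^esub> y'))"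
      using \<Theta>[OF A_add[OF y(1) y'(1)]] g_add[OF y(1) y'(1)] y y' by simp
    then show "\<Theta> (u \<oplus>\<^bsub>M\<^esub> u') = \<Theta> u \<oplus>\<^bsub>D\<^esub> \<Theta> u'"
      using vec_add[OF y(1) y'(1)] \<Psi>_add[OF vc[OF y(1)] vc[OF y'(1)]] \<Theta> y y' by simp
  qed
  moreover have "bij_betw \<Theta> (carrier M) (carrier D)"
    unfolding bij_betw_def
  proof
    show "inj_on \<Theta> (carrier M)"
    proof (rule inj_onI)
      fix u u' assume u: "u \<in> carrier M" "u' \<in> carrier M" "\<Theta> u = \<Theta> u'"
      then obtain y y' where "y \<in> carrier ?A" "u = g y" "y' \<in> carrier ?A" "u' = g y'" using pre by meson
      then show "u = u'" using u(3) \<Theta> \<Psi>_iff by simp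
    qed
    show "\<Theta> ` carrier M = carrier D"
    proof (intro equalityI subsetI)
      fix x assume "x \<in> \<Theta> ` carrier M"
      then obtain y where "y \<in> carrier ?A" "x = \<Theta> (g y)" using pre by blast
      then show "x \<in> carrier D" using \<Theta> \<Psi> vc by simp
    next
      fix x assume "x \<in> carrier D"
      then obtain y where "y \<in> carrier ?A" "x = \<Psi> (?v y)" using \<Psi>_surj unfolding std_def by blast
      then show "x \<in> \<Theta> ` carrier M" using \<Theta> gc by (metis imageI)
    qed
  qed
  ultimately show ?thesis by (auto simp: module_isomorphic_def module_iso_def)
qed

text \<open>On the locus of rank \<open>i\<close> the first \<open>i\<close> supports are 1, so for
  k < i the ideal \<open>L k\<close> has full support there. Filling up the complement of
  \<open>\<delta>\<close> gives an ideal of the whole type with a regular element, whose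
  invertibility passes to the smaller corner.\<close>

lemma invertible_rank_part:
  assumes her: "hereditary R" and rk: "hereditary_corner.ranked e n L w" and ki: "k < i" "i \<le> n"
  defines "\<delta> \<equiv> rank_idem n w i"
  shows "invertible_ideal (idem_ring R (\<kappa> \<delta>)) (\<kappa> ` ((*) \<delta> ` L k))"
proof -
  interpret hereditary_corner e by (rule corner_is_hereditary[OF her])
  have qq: "\<And>i j. i \<le> j \<Longrightarrow> j < n \<Longrightarrow> w i * w j = w j" and ew: "\<And>j. j < n \<Longrightarrow> e * w j = w j"
    and "fin_gen (*) (L k)"
    using rk ki unfolding ranked_def by auto
  then have Lk: "rideal (L k)" by (intro module.fin_gen_subspace[OF module_mult])
  have "k < n" using ki by simp
  then obtain a where a: "a \<in> L k" "is_supp (w k) a" using rk unfolding ranked_def by blast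
  have \<delta>\<delta>: "\<delta> * \<delta> = \<delta>" unfolding \<delta>_def using rank_idem_orth[OF qq, where r = i and s = i] ki by simp
  have \<delta>w: "\<delta> * w k = \<delta>" unfolding \<delta>_def using rank_idem_mult_q[OF qq, where i = k and r = i] ki by simp
  have e\<delta>: "e * \<delta> = \<delta>" using ew[of "i - 1"] ew[of i] ki by (auto simp: \<delta>_def rank_idem_def right_diff_distrib)
  have ann: "\<And>r. r * a = 0 \<Longrightarrow> r * w k = 0" using a by (auto simp: is_supp_def)
  have "is_supp \<delta> (\<delta> * a)"
    unfolding is_supp_def
  proof (intro conjI allI impI)
    show "\<delta> * \<delta> = \<delta>" by (rule \<delta>\<delta>)
    show "\<delta> * (\<delta> * a) = \<delta> * a" using \<delta>\<delta> by (simp flip: mult.assoc)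
    fix r assume "r * (\<delta> * a) = 0"
    then have "(r * \<delta>) * w k = 0" using ann[of "r * \<delta>"] by (simp add: mult.assoc)
    then show "r * \<delta> = 0" using \<delta>w by (simp add: mult.assoc)
  qed
  then have reg: "regular (\<delta> * a + (1 - \<delta>))" by (rule regular_supp[OF _ e\<delta>])
  define J where "J = {x. \<delta> * x \<in> L k}"
  have J: "rideal J"
    using rideal_0[OF Lk] rideal_add[OF Lk] rideal_mult[OF Lk]
    by (auto simp: rideal_def J_def distrib_left mult.left_commute[of \<delta>])
  have "\<delta> * (\<delta> * a + (1 - \<delta>)) = \<delta> * a" using \<delta>\<delta> by (simp add: distrib_left right_diff_distrib flip: mult.assoc)
  then have dJ: "\<delta> * a + (1 - \<delta>) \<in> J" using rideal_mult[OF Lk a(1)] by (simp add: J_def)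
  obtain N :: nat and u v where uv: "\<And>i. i < N \<Longrightarrow> u i \<in> J"
      "\<And>i x. i < N \<Longrightarrow> x \<in> J \<Longrightarrow> \<delta> * a + (1 - \<delta>) dvd v i * x" "(\<Sum>i<N. u i * v i) = \<delta> * a + (1 - \<delta>)"
    by (rule invE[OF J dJ reg]) blast
  interpret S: corner_embedding "idem_ring R (\<kappa> \<delta>)" \<iota> "\<lambda>t. \<kappa> (\<delta> * t)" \<delta> by (rule sub_corner[OF e\<delta> \<delta>\<delta>])
  have "invertible_ideal (idem_ring R (\<kappa> \<delta>)) ((\<lambda>t. \<kappa> (\<delta> * t)) ` J)"
    by (rule S.invertible_image[OF J dJ regular_nzd[OF reg] uv])
  moreover have "(\<lambda>t. \<kappa> (\<delta> * t)) ` J = \<kappa> ` ((*) \<delta> ` L k)"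
  proof (intro equalityI subsetI)
    fix y assume "y \<in> (\<lambda>t. \<kappa> (\<delta> * t)) ` J"
    then obtain x where x: "\<delta> * x \<in> L k" "y = \<kappa> (\<delta> * x)" by (auto simp: J_def)
    moreover have "\<delta> * x = \<delta> * (\<delta> * x)" using \<delta>\<delta> by (simp flip: mult.assoc)
    ultimately show "y \<in> \<kappa> ` ((*) \<delta> ` L k)" by (metis imageI)
  next
    fix y assume "y \<in> \<kappa> ` ((*) \<delta> ` L k)"
    then show "y \<in> (\<lambda>t. \<kappa> (\<delta> * t)) ` J" using rideal_mult[OF Lk] by (auto simp: J_def)
  qed
  ultimately show ?thesis by simp
qed

lemma coset_eq_iff:
  assumes I: "rideal I" and st: "e * s = s" "e * t = t"
  shows "\<kappa> ` I +> \<kappa> s = \<kappa> ` I +> \<kappa> t \<longleftrightarrow> s - t \<in> I"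
proof -
  have "\<kappa> ` I +> \<kappa> s = \<kappa> ` I +> \<kappa> t \<longleftrightarrow> \<kappa> s \<ominus> \<kappa> t \<in> \<kappa> ` I"
    using quotient_eq_iff_same_a_r_cos[OF \<kappa>_image_ideal[OF I]] by simp
  also have "\<kappa> s \<ominus> \<kappa> t = \<kappa> (s - t)" using \<kappa>_add[of s "- t"] by (simp add: \<kappa>_uminus minus_eq)
  also have "\<kappa> (s - t) \<in> \<kappa> ` I \<longleftrightarrow> s - t \<in> I"
    using st by (intro \<kappa>_mem_iff[OF I]) (simp add: right_diff_distrib)
  finally show ?thesis .
qed

text \<open>The kernel of the presentation in the definition is finitely generated at once, being
  the image of a free module. The quotient by it is read off from the torsion coordinates
  \<open>z\<close> modulo the chain \<open>I'\<close> and from the coordinates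
  \<open>\<psi>\<close>, regrouped by rank.\<close>

lemma finitely_presented_decomposition:
  assumes her: "hereditary R" and M: "module R M" "finitely_presented R M"
  shows "\<exists>(m::nat) (p::nat) (I :: nat \<Rightarrow> 'a set) (\<epsilon> :: nat \<Rightarrow> 'a) (n :: nat \<Rightarrow> nat)
          (J :: nat \<Rightarrow> nat \<Rightarrow> 'a set).
        (\<forall>j\<in>{1..m}. invertible_ideal R (I j) \<and> I j \<noteq> carrier R) \<and>
        (\<forall>i\<in>{1..m}. \<forall>j\<in>{1..m}. i \<le> j \<longrightarrow> I j \<subseteq> I i) \<and>
        (\<forall>i\<in>{1..p}. \<epsilon> i \<in> carrier R \<and> \<epsilon> i \<noteq> \<zero> \<and> \<epsilon> i \<otimes> \<epsilon> i = \<epsilon> i) \<and>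
        (\<forall>i\<in>{1..p}. \<forall>j\<in>{1..p}. i \<noteq> j \<longrightarrow> \<epsilon> i \<otimes> \<epsilon> j = \<zero>) \<and>
        (\<forall>i\<in>{1..p}. 0 < n i) \<and> strict_mono_on {1..p} n \<and>
        (\<forall>i\<in>{1..p}. \<forall>k\<in>{1..n i}. invertible_ideal (idem_ring R (\<epsilon> i)) (J i k)) \<and>
        module_isomorphic R M
          (direct_sum2
            (direct_sum {1..m} (\<lambda>j. quotient_module R (I j)))
            (direct_sum {1..p} (\<lambda>i. direct_sum {1..n i} (\<lambda>k. ideal_module R (J i k #> \<epsilon> i)))))"
proof -
  interpret hereditary_corner_module e "vscale :: 't \<Rightarrow> (nat \<Rightarrow> 't) \<Rightarrow> nat \<Rightarrow> 't" by (rule vscale_module[OF her])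
  obtain l k :: nat and f g where f: "f \<in> module_homs R (free_module R {1..l}) (free_module R {1..k})"
    and g: "g \<in> module_homs R (free_module R {1..k}) M"
    and fg: "f ` carrier (free_module R {1..l}) = a_kernel (free_module R {1..k}) M g"
    and g_surj: "g ` carrier (free_module R {1..k}) = carrier M"
    using M(2) unfolding finitely_presented_def by (elim exE bexE conjE) (rule that)
  define H where "H = vec {1..k} ` a_kernel (free_module R {1..k}) M g"
  have fH: "fin_gen vscale H"
    unfolding H_def fg[symmetric] by (rule fin_gen_hom_image[OF f]; (rule vec_add vec_scale)?)
  have HG: "H \<subseteq> std k" unfolding H_def std_def by (auto simp: a_kernel_def')
  obtain d \<phi> J q I \<psi> L w where d: "regular d" and rk: "ranked k J q" and rkL: "ranked k L w"
    and lins: "\<forall>j<k. functional (std k) (\<phi> j) \<and> functional (std k) (\<psi> j)"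
    and val: "\<forall>j<k. \<forall>y\<in>std k. \<phi> j y \<in> J j \<and> \<psi> j y \<in> L j"
    and surj: "\<forall>r r'. (\<forall>j<k. r j \<in> J j \<and> r' j \<in> L j) \<longrightarrow> (\<exists>y\<in>std k. \<forall>j<k. \<phi> j y = r j \<and> \<psi> j y = r' j)"
    and "\<forall>y\<in>std k. (\<forall>j<k. \<phi> j y = 0 \<and> \<psi> j y = 0) \<longrightarrow> y = 0"
    and I: "\<forall>j<k. rideal (I j) \<and> d \<in> I j" and chain: "\<forall>i j. i \<le> j \<longrightarrow> j < k \<longrightarrow> I j \<subseteq> I i"
    and mem: "\<forall>y\<in>std k. y \<in> H \<longleftrightarrow> (\<forall>j<k. \<phi> j y \<in> iprod (I j) (J j) \<and> \<psi> j y = 0)"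
    using stacked_decomposition[OF coords_std[OF her] fin_gen_std fH HG] by (elim exE conjE) (rule that)
  have \<phi>f: "\<forall>j<k. functional (std k) (\<phi> j)" "\<forall>j<k. \<forall>y\<in>std k. \<phi> j y \<in> J j" using lins val by blast+
  obtain I' z where I': "\<forall>j<k. rideal (I' j) \<and> d \<in> I' j"
    and chain': "\<forall>i j. i \<le> j \<longrightarrow> j < k \<longrightarrow> I' j \<subseteq> I' i" and zf: "\<forall>j<k. functional (std k) (z j)"
    and kerz: "\<forall>y\<in>std k. (\<forall>j<k. \<phi> j y \<in> iprod (I j) (J j)) \<longleftrightarrow> (\<forall>j<k. z j y \<in> I' j)"
    and surjz: "\<forall>c. \<exists>r. (\<forall>j<k. r j \<in> J j) \<and>
      (\<forall>y\<in>std k. (\<forall>j<k. \<phi> j y = r j) \<longrightarrow> (\<forall>j<k. z j y - c j \<in> I' j))"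
    using cyclic_torsion[OF rk d \<phi>f I chain] by (elim exE conjE) (rule that)
  have G: "subspace (std k)" by (rule fin_gen_subspace[OF fin_gen_std])
  have K1: "y \<in> H \<longleftrightarrow> (\<forall>j<k. z j y \<in> I' j) \<and> (\<forall>j<k. \<psi> j y = 0)" if "y \<in> std k" for y
    using mem kerz that by blast
  have K2: "\<exists>y\<in>std k. \<forall>j<k. z j y - c j \<in> I' j \<and> \<psi> j y = r' j" if r': "\<forall>j<k. r' j \<in> L j" for c r'
  proof -
    obtain r where r: "\<forall>j<k. r j \<in> J j"
      and rz: "\<forall>y\<in>std k. (\<forall>j<k. \<phi> j y = r j) \<longrightarrow> (\<forall>j<k. z j y - c j \<in> I' j)"
      using surjz[rule_format, of c] by (elim exE conjE) (rule that)
    have "\<exists>y\<in>std k. \<forall>j<k. \<phi> j y = r j \<and> \<psi> j y = r' j"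
      by (rule surj[rule_format]) (use r r' in simp)
    then obtain y where y: "y \<in> std k" "\<forall>j<k. \<phi> j y = r j \<and> \<psi> j y = r' j" ..
    then have "\<forall>j<k. z j y - c j \<in> I' j" using rz by simp
    then show ?thesis using y by (intro bexI[of _ y]) simp_all
  qed
  have ev: "vscale e y = y" if "y \<in> std k" for y using that by (auto simp: std_eq vscale_def)
  have ez: "e * z j y = z j y" if "j < k" "y \<in> std k" for j y
    using lin_on_scale[OF zf[rule_format, OF that(1)] that(2), of e] ev[OF that(2)] by simp

  \<comment> \<open>Places where the ideal is the whole ring contribute zero quotients. As the
    ideals form a chain, these are the first \<open>j0\<close> places; dropping them makes all
    ideals proper.\<close>
  obtain j0 where j0: "j0 \<le> k" "\<And>j. j < k \<Longrightarrow> \<kappa> ` I' j \<noteq> carrier R \<longleftrightarrow> j0 \<le> j"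
  proof -
    have up: "\<kappa> ` I' j' \<noteq> carrier R" if "\<kappa> ` I' j \<noteq> carrier R" "j \<le> j'" "j' < k" for j j'
    proof -
      have "\<kappa> ` I' j' \<subseteq> \<kappa> ` I' j" using chain' that by blast
      then show ?thesis using that(1) by auto
    qed
    define j0 where "j0 = (LEAST j. j = k \<or> \<kappa> ` I' j \<noteq> carrier R)"
    have "j0 \<le> k" unfolding j0_def by (rule Least_le) simp
    moreover have least: "j0 = k \<or> \<kappa> ` I' j0 \<noteq> carrier R"
      unfolding j0_def by (rule LeastI[of _ k]) simp
    moreover have "\<kappa> ` I' j \<noteq> carrier R \<longleftrightarrow> j0 \<le> j" if "j < k" for j
    proof
      assume "\<kappa> ` I' j \<noteq> carrier R"
      then show "j0 \<le> j" unfolding j0_def by (intro Least_le) simp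
    next
      assume "j0 \<le> j"
      then show "\<kappa> ` I' j \<noteq> carrier R" using least up[of j0 j] that by auto
    qed
    ultimately show ?thesis using that by blast
  qed
  define m where "m = k - j0"
  \<comment> \<open>Summand \<open>j\<close>, counted from 1, is place j0 + j - 1, counted from
    0.\<close>
  define Io where "Io j = \<kappa> ` I' (j0 + j - 1)" for j
  have idx: "j0 + j - 1 < k" "j0 \<le> j0 + j - 1" if "j \<in> {1..m}" for j using that j0(1) by (auto simp: m_def)
  have Io_ideal: "ideal (Io j) R" if "j \<in> {1..m}" for j
    unfolding Io_def using I' idx[OF that] by (intro \<kappa>_image_ideal) blast
  define \<Psi>1 where "\<Psi>1 y = (\<lambda>j\<in>{1..m}. Io j +> \<kappa> (z (j0 + j - 1) y))" for y
  let ?D1 = "direct_sum {1..m} (\<lambda>j. quotient_module R (Io j))"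
  have D1: "carrier ?D1 = (\<Pi>\<^sub>E j\<in>{1..m}. {Io j +> r | r. r \<in> carrier R})"
  proof -
    have "carrier ?D1 = (\<Pi>\<^sub>E j\<in>{1..m}. carrier (quotient_module R (Io j)))"
      by (simp add: direct_sum_simps)
    also have "\<dots> = (\<Pi>\<^sub>E j\<in>{1..m}. {Io j +> r | r. r \<in> carrier R})"
      by (intro PiE_cong quotient_module_simps(1) Io_ideal)
    finally show ?thesis .
  qed
  have \<Psi>1_in: "\<Psi>1 y \<in> carrier ?D1" for y
    unfolding D1 \<Psi>1_def restrict_PiE_iff
    by (intro ballI CollectI exI conjI) (rule refl, rule \<kappa>_closed)
  have \<Psi>1_add: "\<Psi>1 (y + y') = \<Psi>1 y \<oplus>\<^bsub>?D1\<^esub> \<Psi>1 y'" if y: "y \<in> std k" "y' \<in> std k" for y y'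
  proof -
    have "Io j +> \<kappa> (z (j0 + j - 1) (y + y')) =
        (Io j +> \<kappa> (z (j0 + j - 1) y)) \<oplus>\<^bsub>quotient_module R (Io j)\<^esub> (Io j +> \<kappa> (z (j0 + j - 1) y'))"
      if j: "j \<in> {1..m}" for j
      using lin_on_add[OF zf[rule_format, OF idx(1)[OF j]] y]
      by (simp add: quotient_module_simps[OF Io_ideal[OF j]] \<kappa>_add)
    then show ?thesis unfolding direct_sum_simps \<Psi>1_def by (intro restrict_ext) simp
  qed
  have \<Psi>1_scale: "\<Psi>1 (vscale c y) = \<kappa> c \<odot>\<^bsub>?D1\<^esub> \<Psi>1 y" if y: "y \<in> std k" for c y
  proof -
    have "Io j +> \<kappa> (z (j0 + j - 1) (vscale c y)) =
        \<kappa> c \<odot>\<^bsub>quotient_module R (Io j)\<^esub> (Io j +> \<kappa> (z (j0 + j - 1) y))"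
      if j: "j \<in> {1..m}" for j
      using lin_on_scale[OF zf[rule_format, OF idx(1)[OF j]] y]
      by (simp add: quotient_module_simps[OF Io_ideal[OF j]] \<kappa>_mult)
    then show ?thesis unfolding direct_sum_simps \<Psi>1_def by (intro restrict_ext) simp
  qed
  have \<Psi>1_eq: "\<Psi>1 y = \<Psi>1 y' \<longleftrightarrow> (\<forall>j<k. z j (y - y') \<in> I' j)" if y: "y \<in> std k" "y' \<in> std k" for y y'
  proof -
    have diff: "z j (y - y') = z j y - z j y'" if "j < k" for j
      by (rule functional_diff[OF G zf[rule_format, OF that] y])
    have coset: "\<kappa> ` I' j +> \<kappa> (z j y) = \<kappa> ` I' j +> \<kappa> (z j y') \<longleftrightarrow> z j (y - y') \<in> I' j" if "j < k" for j
      unfolding diff[OF that] using I' that ez[OF that] y by (intro coset_eq_iff) auto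
    have "\<Psi>1 y = \<Psi>1 y' \<longleftrightarrow> (\<forall>j\<in>{1..m}. Io j +> \<kappa> (z (j0 + j - 1) y) = Io j +> \<kappa> (z (j0 + j - 1) y'))"
    proof
      assume eq: "\<Psi>1 y = \<Psi>1 y'"
      show "\<forall>j\<in>{1..m}. Io j +> \<kappa> (z (j0 + j - 1) y) = Io j +> \<kappa> (z (j0 + j - 1) y')"
      proof
        fix j assume "j \<in> {1..m}"
        then show "Io j +> \<kappa> (z (j0 + j - 1) y) = Io j +> \<kappa> (z (j0 + j - 1) y')"
          using fun_cong[OF eq, of j] unfolding \<Psi>1_def restrict_def by simp
      qed
    next
      assume "\<forall>j\<in>{1..m}. Io j +> \<kappa> (z (j0 + j - 1) y) = Io j +> \<kappa> (z (j0 + j - 1) y')"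
      then show "\<Psi>1 y = \<Psi>1 y'" unfolding \<Psi>1_def by (intro restrict_ext) blast
    qed
    also have "\<dots> \<longleftrightarrow> (\<forall>j\<in>{1..m}. z (j0 + j - 1) (y - y') \<in> I' (j0 + j - 1))"
      using coset idx(1) unfolding Io_def by blast
    also have "\<dots> \<longleftrightarrow> (\<forall>j<k. z j (y - y') \<in> I' j)"
    proof
      assume a: "\<forall>j\<in>{1..m}. z (j0 + j - 1) (y - y') \<in> I' (j0 + j - 1)"
      show "\<forall>j<k. z j (y - y') \<in> I' j"
      proof (intro allI impI)
        fix j assume j: "j < k"
        show "z j (y - y') \<in> I' j"
        proof (cases "j0 \<le> j")
          case True
          then have "j + 1 - j0 \<in> {1..m}" "j0 + (j + 1 - j0) - 1 = j" using j by (auto simp: m_def)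
          then show ?thesis using a by metis
        next
          case False
          then have "\<kappa> ` I' j = carrier R" using j0(2)[OF j] by blast
          then have "\<kappa> (z j (y - y')) \<in> \<kappa> ` I' j" by simp
          moreover have "y - y' \<in> std k" by (rule subspace_diff[OF G y])
          ultimately show ?thesis using \<kappa>_mem_iff[OF _ ez[OF j]] I' j by blast
        qed
      qed
    qed (use idx in blast)
    finally show ?thesis .
  qed

  define \<delta> where "\<delta> = rank_idem k w"
  have ww: "\<And>i j. i \<le> j \<Longrightarrow> j < k \<Longrightarrow> w i * w j = w j" and ew: "\<And>j. j < k \<Longrightarrow> e * w j = w j"
    and wL: "\<And>j r. j < k \<Longrightarrow> r \<in> L j \<Longrightarrow> w j * r = r" and "\<And>j. j < k \<Longrightarrow> fin_gen (*) (L j)"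
    using rkL unfolding ranked_def by auto
  then have L: "rideal (L j)" if "j < k" for j using that by (intro module.fin_gen_subspace[OF module_mult])
  have \<delta>\<delta>: "\<delta> r * \<delta> s = (if r = s then \<delta> r else 0)" if "r \<le> k" "s \<le> k" for r s
    unfolding \<delta>_def by (rule rank_idem_orth[OF ww that])
  have w_sum: "w i = (\<Sum>r\<in>{i<..k}. \<delta> r)" if "i < k" for i
    unfolding \<delta>_def by (rule q_eq_sum_rank_idem[OF ww that])
  have e\<delta>: "e * \<delta> i = \<delta> i" if "1 \<le> i" "i \<le> k" for i
    using ew[of "i - 1"] ew[of i] that by (auto simp: \<delta>_def rank_idem_def right_diff_distrib)
  \<comment> \<open>The ranks that occur on a nonempty locus. In increasing order they are the
    numbers n_1 < ... < n_p themselves: where the rank is n_i, exactly the first n_i of the ideals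
    \<open>L j\<close> survive.\<close>
  define P where "P = {i \<in> {1..k}. \<delta> i \<noteq> 0}"
  define p where "p = card P"
  have finP: "finite P" by (simp add: P_def)
  obtain h where h: "bij_betw h {..<p} P" "strict_mono_on {..<p} h"
    unfolding p_def by (rule ex_bij_betw_strict_mono_card[OF finP])
  define n where "n i = h (i - 1)" for i
  have nP: "n i \<in> P" if "i \<in> {1..p}" for i
    unfolding n_def by (rule bij_betwE[OF h(1), rule_format]) (use that in auto)
  have n_ex: "\<exists>i'\<in>{1..p}. n i' = i" if i: "i \<in> P" for i
  proof -
    obtain i' where "i' < p" "h i' = i" using h(1) i by (auto simp: bij_betw_def)
    then show ?thesis by (intro bexI[of _ "Suc i'"]) (auto simp: n_def)
  qed
  have n_mono: "strict_mono_on {1..p} n"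
    unfolding strict_mono_on_def n_def
    by (intro allI impI strict_mono_onD[OF h(2)]) auto
  have n_inj: "n i \<noteq> n j" if "i \<in> {1..p}" "j \<in> {1..p}" "i \<noteq> j" for i j
    using strict_mono_on_imp_inj_on[OF n_mono] that by (auto dest: inj_onD)
  have n_bounds: "1 \<le> n i" "n i \<le> k" "\<delta> (n i) \<noteq> 0" if "i \<in> {1..p}" for i
    using nP[OF that] by (auto simp: P_def)
  define \<epsilon> where "\<epsilon> i = \<kappa> (\<delta> (n i))" for i
  define Jo where "Jo i k' = \<kappa> ` ((*) (\<delta> (n i)) ` L (k' - 1))" for i k'
  have idx2: "k' - 1 < n i" "k' - 1 < k" if "i \<in> {1..p}" "k' \<in> {1..n i}" for i k'
    using that n_bounds[of i] by auto
  \<comment> \<open>The ideals already lie in \<open>Re\<close>, so multiplication by the idempotent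
    leaves them unchanged.\<close>
  have Jo_eq: "Jo i k' #> \<epsilon> i = Jo i k'" if i: "i \<in> {1..p}" for i k'
  proof -
    have "\<kappa> (\<delta> (n i) * t) \<otimes> \<kappa> (\<delta> (n i)) = \<kappa> (\<delta> (n i) * t)" for t
    proof -
      have "\<delta> (n i) * t * \<delta> (n i) = (\<delta> (n i) * \<delta> (n i)) * t" by (simp only: mult_ac)
      also have "\<dots> = \<delta> (n i) * t" using \<delta>\<delta>[of "n i" "n i"] n_bounds[OF i] by simp
      finally show ?thesis by (simp flip: \<kappa>_mult)
    qed
    then show ?thesis by (auto simp: Jo_def \<epsilon>_def r_coset_def)
  qed
  define \<Psi>2 where "\<Psi>2 y = (\<lambda>i\<in>{1..p}. \<lambda>k'\<in>{1..n i}. \<kappa> (\<delta> (n i) * \<psi> (k' - 1) y))" for y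
  let ?E = "\<lambda>i. direct_sum {1..n i} (\<lambda>k'. ideal_module R (Jo i k' #> \<epsilon> i))"
  let ?D2 = "direct_sum {1..p} ?E"
  have E: "carrier (?E i) = (\<Pi>\<^sub>E k'\<in>{1..n i}. Jo i k' #> \<epsilon> i)" for i
    by (simp add: direct_sum_simps ideal_module_simps)
  have D2: "carrier ?D2 = (\<Pi>\<^sub>E i\<in>{1..p}. carrier (?E i))" unfolding direct_sum_simps(1)[of "{1..p}"] by simp
  have \<psi>f: "functional (std k) (\<psi> j)" "\<And>y. y \<in> std k \<Longrightarrow> \<psi> j y \<in> L j" if "j < k" for j
    using lins val that by blast+
  have \<Psi>2_in: "\<Psi>2 y \<in> carrier ?D2" if y: "y \<in> std k" for y
    unfolding D2 E \<Psi>2_def restrict_PiE_iff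
  proof (intro ballI)
    fix i k' assume i: "i \<in> {1..p}" and k': "k' \<in> {1..n i}"
    show "\<kappa> (\<delta> (n i) * \<psi> (k' - 1) y) \<in> Jo i k' #> \<epsilon> i"
      unfolding Jo_eq[OF i] unfolding Jo_def using \<psi>f(2)[OF idx2(2)[OF i k'] y] by blast
  qed
  have \<Psi>2_add: "\<Psi>2 (y + y') = \<Psi>2 y \<oplus>\<^bsub>?D2\<^esub> \<Psi>2 y'" if y: "y \<in> std k" "y' \<in> std k" for y y'
  proof -
    have comp: "(\<lambda>k'\<in>{1..n i}. \<kappa> (\<delta> (n i) * \<psi> (k' - 1) (y + y'))) = \<Psi>2 y i \<oplus>\<^bsub>?E i\<^esub> \<Psi>2 y' i" if i: "i \<in> {1..p}" for i
      unfolding direct_sum_simps ideal_module_simps \<Psi>2_def restrict_apply'[OF i]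
    proof (rule restrict_ext)
      fix k' assume k': "k' \<in> {1..n i}"
      have "\<kappa> (\<delta> (n i) * \<psi> (k' - 1) (y + y')) = \<kappa> (\<delta> (n i) * \<psi> (k' - 1) y) \<oplus> \<kappa> (\<delta> (n i) * \<psi> (k' - 1) y')"
        by (simp only: lin_on_add[OF \<psi>f(1)[OF idx2(2)[OF i k']] y] distrib_left \<kappa>_add)
      then show "\<kappa> (\<delta> (n i) * \<psi> (k' - 1) (y + y')) =
          (\<lambda>k'\<in>{1..n i}. \<kappa> (\<delta> (n i) * \<psi> (k' - 1) y)) k' \<oplus> (\<lambda>k'\<in>{1..n i}. \<kappa> (\<delta> (n i) * \<psi> (k' - 1) y')) k'"
        unfolding restrict_apply'[OF k'] .
    qed
    show ?thesis
      unfolding direct_sum_simps(2)[of "{1..p}"] \<Psi>2_def[of "y + y'"] by (rule restrict_ext) (rule comp)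
  qed
  have \<Psi>2_scale: "\<Psi>2 (vscale c y) = \<kappa> c \<odot>\<^bsub>?D2\<^esub> \<Psi>2 y" if y: "y \<in> std k" for c y
  proof -
    have comp: "(\<lambda>k'\<in>{1..n i}. \<kappa> (\<delta> (n i) * \<psi> (k' - 1) (vscale c y))) = \<kappa> c \<odot>\<^bsub>?E i\<^esub> \<Psi>2 y i" if i: "i \<in> {1..p}" for i
      unfolding direct_sum_simps ideal_module_simps \<Psi>2_def restrict_apply'[OF i]
    proof (rule restrict_ext)
      fix k' assume k': "k' \<in> {1..n i}"
      have "\<kappa> (\<delta> (n i) * \<psi> (k' - 1) (vscale c y)) = \<kappa> c \<otimes> \<kappa> (\<delta> (n i) * \<psi> (k' - 1) y)"
        by (simp only: lin_on_scale[OF \<psi>f(1)[OF idx2(2)[OF i k']] y] mult.left_commute[of _ c] \<kappa>_mult[of c])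
      then show "\<kappa> (\<delta> (n i) * \<psi> (k' - 1) (vscale c y)) =
          \<kappa> c \<otimes> (\<lambda>k'\<in>{1..n i}. \<kappa> (\<delta> (n i) * \<psi> (k' - 1) y)) k'"
        unfolding restrict_apply'[OF k'] .
    qed
    show ?thesis
      unfolding direct_sum_simps(3)[of "{1..p}"] \<Psi>2_def[of "vscale c y"] by (rule restrict_ext) (rule comp)
  qed
  have \<Psi>2_eq: "\<Psi>2 y = \<Psi>2 y' \<longleftrightarrow> (\<forall>j<k. \<psi> j (y - y') = 0)" if y: "y \<in> std k" "y' \<in> std k" for y y'
  proof -
    have diff: "\<psi> j (y - y') = \<psi> j y - \<psi> j y'" if "j < k" for j
      by (rule functional_diff[OF G \<psi>f(1)[OF that] y])
    show ?thesis
    proof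
      assume eq: "\<Psi>2 y = \<Psi>2 y'"
      show "\<forall>j<k. \<psi> j (y - y') = 0"
      proof (intro allI impI)
        fix j assume j: "j < k"
        \<comment> \<open>\<open>\<Psi>2\<close> sees only the ranks in \<open>P\<close>; the other
          idempotents are 0. Summing over all ranks above \<open>j\<close> gives \<open>w j\<close>,
          which acts as the identity on \<open>L j\<close>.\<close>
        have "\<delta> i * \<psi> j y = \<delta> i * \<psi> j y'" if i: "i \<in> {j<..k}" for i
        proof (cases "\<delta> i = 0")
          case False
          then have "i \<in> P" using i by (auto simp: P_def)
          then obtain i' where i': "i' \<in> {1..p}" "n i' = i" using n_ex by blast
          have j': "Suc j \<in> {1..n i'}" using i i' by auto
          have "\<Psi>2 y i' (Suc j) = \<Psi>2 y' i' (Suc j)" using eq by simp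
          then have "\<kappa> (\<delta> i * \<psi> j y) = \<kappa> (\<delta> i * \<psi> j y')"
            unfolding \<Psi>2_def restrict_apply'[OF i'(1)] restrict_apply'[OF j'] using i' by simp
          moreover have "e * (\<delta> i * t) = \<delta> i * t" for t using e\<delta>[of i] i by (simp flip: mult.assoc)
          ultimately show ?thesis using \<kappa>_inj by blast
        qed simp
        then have "(\<Sum>i\<in>{j<..k}. \<delta> i) * \<psi> j y = (\<Sum>i\<in>{j<..k}. \<delta> i) * \<psi> j y'"
          unfolding sum_distrib_right by (rule sum.cong[OF refl])
        then have "w j * \<psi> j y = w j * \<psi> j y'" using w_sum[OF j] by simp
        then have "\<psi> j y = \<psi> j y'" using wL[OF j \<psi>f(2)[OF j y(1)]] wL[OF j \<psi>f(2)[OF j y(2)]] by simp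
        then show "\<psi> j (y - y') = 0" using diff[OF j] by simp
      qed
    next
      assume a: "\<forall>j<k. \<psi> j (y - y') = 0"
      have eq: "\<psi> j y = \<psi> j y'" if "j < k" for j using a diff that by simp
      show "\<Psi>2 y = \<Psi>2 y'"
        unfolding \<Psi>2_def by (intro restrict_ext) (simp only: eq idx2(2))
    qed
  qed

  define \<Psi> where "\<Psi> y = (\<Psi>1 y, \<Psi>2 y)" for y
  have iso: "module_isomorphic R M (direct_sum2 ?D1 ?D2)"
  proof (rule presented_isomorphic[OF M(1) g g_surj, where \<Psi> = \<Psi>])
    fix y assume y: "y \<in> std k"
    show "\<Psi> y \<in> carrier (direct_sum2 ?D1 ?D2)"
      using \<Psi>1_in \<Psi>2_in[OF y] by (simp only: \<Psi>_def direct_sum2_simps mem_Times_iff fst_conv snd_conv)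
    show "\<Psi> (vscale c y) = \<kappa> c \<odot>\<^bsub>direct_sum2 ?D1 ?D2\<^esub> \<Psi> y" for c
      by (simp only: \<Psi>_def direct_sum2_simps \<Psi>1_scale[OF y] \<Psi>2_scale[OF y])
    fix y' assume y': "y' \<in> std k"
    show "\<Psi> (y + y') = \<Psi> y \<oplus>\<^bsub>direct_sum2 ?D1 ?D2\<^esub> \<Psi> y'"
      by (simp only: \<Psi>_def direct_sum2_simps \<Psi>1_add[OF y y'] \<Psi>2_add[OF y y'])
    show "\<Psi> y = \<Psi> y' \<longleftrightarrow> y - y' \<in> vec {1..k} ` a_kernel (free_module R {1..k}) M g"
      unfolding H_def[symmetric] K1[OF subspace_diff[OF G y y']]
      by (simp only: \<Psi>_def prod.inject \<Psi>1_eq[OF y y'] \<Psi>2_eq[OF y y'])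
  next
    fix X assume "X \<in> carrier (direct_sum2 ?D1 ?D2)"
    then obtain X1 X2 where X: "X = (X1, X2)" "X1 \<in> carrier ?D1" "X2 \<in> carrier ?D2"
      unfolding direct_sum2_simps by blast
    have "\<forall>j\<in>{1..m}. \<exists>r. r \<in> carrier R \<and> X1 j = Io j +> r" using X(2) unfolding D1 PiE_iff by blast
    from bchoice[OF this] obtain r where r: "\<forall>j\<in>{1..m}. r j \<in> carrier R \<and> X1 j = Io j +> r j" ..
    \<comment> \<open>For places below \<open>j0\<close> the truncated subtraction gives the
      arbitrary value \<open>r 0\<close>; these places were dropped, so any value is admissible
      there.\<close>
    define c where "c j = \<iota> (r (j + 1 - j0))" for j
    \<comment> \<open>Glues the components for the different ranks: they are supported by orthogonal
      idempotents, so each is recovered by multiplying with its own.\<close>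
    define \<rho> where "\<rho> j = (\<Sum>i\<in>{i \<in> {1..p}. j < n i}. \<iota> (X2 i (Suc j)))" for j
    have X2_in: "\<exists>t\<in>L j. \<iota> (X2 i (Suc j)) = \<delta> (n i) * t" if i: "i \<in> {1..p}" "j < n i" for i j
    proof -
      have "X2 i \<in> carrier (?E i)" using X(3) i(1) unfolding D2 PiE_iff by blast
      then have "X2 i (Suc j) \<in> Jo i (Suc j) #> \<epsilon> i" using i(2) unfolding E PiE_iff by auto
      then obtain t where t: "t \<in> L j" "X2 i (Suc j) = \<kappa> (\<delta> (n i) * t)"
        unfolding Jo_eq[OF i(1)] by (auto simp: Jo_def)
      have "\<iota> (X2 i (Suc j)) = \<delta> (n i) * t"
        using t(2) e\<delta>[of "n i"] n_bounds[OF i(1)] by (simp add: \<iota>_\<kappa> flip: mult.assoc)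
      then show ?thesis using t by blast
    qed
    have "\<rho> j \<in> L j" if j: "j < k" for j
      unfolding \<rho>_def
    proof (rule rideal_sum[OF L[OF j]])
      fix i assume "i \<in> {i \<in> {1..p}. j < n i}"
      then obtain t where "t \<in> L j" "\<iota> (X2 i (Suc j)) = \<delta> (n i) * t" using X2_in by blast
      then show "\<iota> (X2 i (Suc j)) \<in> L j" using rideal_mult[OF L[OF j]] by simp
    qed
    then have "\<forall>j<k. \<rho> j \<in> L j" by blast
    from K2[OF this, of c] obtain y where y: "y \<in> std k" "\<forall>j<k. z j y - c j \<in> I' j \<and> \<psi> j y = \<rho> j" by blast
    have "\<Psi>1 y = restrict X1 {1..m}"
      unfolding \<Psi>1_def
    proof (rule restrict_ext)
      fix j assume j: "j \<in> {1..m}"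
      have c: "c (j0 + j - 1) = \<iota> (r j)" using j by (simp add: c_def)
      have "\<kappa> ` I' (j0 + j - 1) +> \<kappa> (z (j0 + j - 1) y) = \<kappa> ` I' (j0 + j - 1) +> \<kappa> (c (j0 + j - 1))"
      proof (subst coset_eq_iff)
        show "rideal (I' (j0 + j - 1))" using I' idx[OF j] by blast
        show "e * z (j0 + j - 1) y = z (j0 + j - 1) y" by (rule ez[OF idx(1)[OF j] y(1)])
        show "e * c (j0 + j - 1) = c (j0 + j - 1)" using r j unfolding c by (intro e_\<iota>) blast
        show "z (j0 + j - 1) y - c (j0 + j - 1) \<in> I' (j0 + j - 1)" using y(2) idx[OF j] by blast
      qed
      moreover have "\<kappa> (c (j0 + j - 1)) = r j" unfolding c using r j by (intro \<kappa>_\<iota>) blast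
      moreover have "X1 j = Io j +> r j" using r j by blast
      ultimately show "Io j +> \<kappa> (z (j0 + j - 1) y) = X1 j" by (simp only: Io_def)
    qed
    also have "\<dots> = X1" using X(2) unfolding D1 by (rule PiE_restrict)
    finally have 1: "\<Psi>1 y = X1" .
    have "\<Psi>2 y = restrict X2 {1..p}"
      unfolding \<Psi>2_def
    proof (rule restrict_ext)
      fix i assume i: "i \<in> {1..p}"
      have X2i: "X2 i \<in> carrier (?E i)" using X(3) i unfolding D2 PiE_iff by blast
      have "(\<lambda>k'\<in>{1..n i}. \<kappa> (\<delta> (n i) * \<psi> (k' - 1) y)) = restrict (X2 i) {1..n i}"
      proof (rule restrict_ext)
        fix k' assume k': "k' \<in> {1..n i}"
        define j where "j = k' - 1"
        have j: "j < n i" "j < k" "k' = Suc j" using idx2[OF i k'] k' by (auto simp: j_def)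
        obtain t where t: "t \<in> L j" "\<iota> (X2 i (Suc j)) = \<delta> (n i) * t" using X2_in[OF i j(1)] by blast
        have orth: "\<delta> (n i) * \<iota> (X2 i' (Suc j)) = (if i' = i then \<iota> (X2 i (Suc j)) else 0)"
          if i': "i' \<in> {i \<in> {1..p}. j < n i}" for i'
        proof -
          obtain t' where t': "\<iota> (X2 i' (Suc j)) = \<delta> (n i') * t'" using X2_in[of i' j] i' by blast
          then have "\<delta> (n i) * \<iota> (X2 i' (Suc j)) = (\<delta> (n i) * \<delta> (n i')) * t'" by (simp add: mult.assoc)
          also have "\<delta> (n i) * \<delta> (n i') = (if i' = i then \<delta> (n i') else 0)"
            using \<delta>\<delta>[of "n i" "n i'"] n_bounds[OF i] n_bounds[of i'] n_inj[OF i, of i'] i' by auto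
          also have "\<dots> * t' = (if i' = i then \<iota> (X2 i (Suc j)) else 0)" using t' by auto
          finally show ?thesis .
        qed
        have "\<delta> (n i) * \<rho> j = (\<Sum>i'\<in>{i \<in> {1..p}. j < n i}. if i' = i then \<iota> (X2 i (Suc j)) else 0)"
          unfolding \<rho>_def sum_distrib_left by (rule sum.cong[OF refl orth])
        also have "\<dots> = \<iota> (X2 i (Suc j))" using i j by simp
        finally have "\<kappa> (\<delta> (n i) * \<psi> j y) = \<kappa> (\<iota> (X2 i (Suc j)))" using y(2) j(2) by simp
        also have "\<dots> = X2 i (Suc j)"
        proof (rule \<kappa>_\<iota>)
          have "X2 i (Suc j) \<in> Jo i (Suc j)" using X2i k' j(3) Jo_eq[OF i] unfolding E PiE_iff by blast
          then show "X2 i (Suc j) \<in> carrier R" by (auto simp: Jo_def)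
        qed
        finally show "\<kappa> (\<delta> (n i) * \<psi> (k' - 1) y) = X2 i k'" using j by simp
      qed
      also have "\<dots> = X2 i" using X2i unfolding E by (rule PiE_restrict)
      finally show "(\<lambda>k'\<in>{1..n i}. \<kappa> (\<delta> (n i) * \<psi> (k' - 1) y)) = X2 i" .
    qed
    also have "\<dots> = X2" using X(3) unfolding D2 by (rule PiE_restrict)
    finally have "\<Psi>2 y = X2" .
    then show "\<exists>v\<in>std k. \<Psi> v = X" using 1 y(1) X(1) by (auto simp: \<Psi>_def)
  qed

  have "invertible_ideal R (Io j) \<and> Io j \<noteq> carrier R" if j: "j \<in> {1..m}" for j
    using j0(2)[OF idx(1)[OF j]] idx(2)[OF j] I' idx(1)[OF j] invertible_regular_image[OF her _ _ d]
    unfolding Io_def by blast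
  moreover have "Io j \<subseteq> Io i" if "i \<in> {1..m}" "j \<in> {1..m}" "i \<le> j" for i j
    unfolding Io_def by (intro image_mono chain'[rule_format] idx(1) that) (use that in simp)
  moreover have "\<epsilon> i \<in> carrier R \<and> \<epsilon> i \<noteq> \<zero> \<and> \<epsilon> i \<otimes> \<epsilon> i = \<epsilon> i" if i: "i \<in> {1..p}" for i
  proof (intro conjI)
    show "\<epsilon> i \<noteq> \<zero>"
      using \<kappa>_inj[OF e\<delta>[OF n_bounds(1,2)[OF i]], of 0] n_bounds(3)[OF i] by (auto simp: \<epsilon>_def \<kappa>_zero)
    show "\<epsilon> i \<otimes> \<epsilon> i = \<epsilon> i" using \<delta>\<delta>[of "n i" "n i"] n_bounds[OF i] by (simp add: \<epsilon>_def flip: \<kappa>_mult)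
  qed (simp add: \<epsilon>_def)
  moreover have "\<epsilon> i \<otimes> \<epsilon> j = \<zero>" if ij: "i \<in> {1..p}" "j \<in> {1..p}" "i \<noteq> j" for i j
    using \<delta>\<delta>[of "n i" "n j"] n_bounds[OF ij(1)] n_bounds[OF ij(2)] n_inj[OF ij]
    by (simp add: \<epsilon>_def \<kappa>_zero flip: \<kappa>_mult)
  moreover have "0 < n i" if "i \<in> {1..p}" for i using n_bounds(1)[OF that] by simp
  moreover have "invertible_ideal (idem_ring R (\<epsilon> i)) (Jo i k')" if "i \<in> {1..p}" "k' \<in> {1..n i}" for i k'
    unfolding \<epsilon>_def Jo_def \<delta>_def by (intro invertible_rank_part[OF her rkL] idx2(1) n_bounds(2) that)
  ultimately show ?thesis
    using n_mono iso
    by (intro exI[of _ m] exI[of _ p] exI[of _ Io] exI[of _ \<epsilon>] exI[of _ n] exI[of _ Jo] conjI ballI impI)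
      blast+
qed

end

section \<open>A product of all commutative rings on a type\<close>

text \<open>
  No type can depend on the given ring \<open>R\<close>, but the product of all commutative rings with carrier
  inside a given type is a type, and \<open>R\<close> is a corner of it. The factor \<open>int\<close> ensures \<open>0 \<noteq> 1\<close>.
\<close>

typedef 'a ring_product =
  "{f :: int \<times> ('a ring \<Rightarrow> 'a). \<forall>S. (cring S \<longrightarrow> snd f S \<in> carrier S) \<and> (\<not> cring S \<longrightarrow> snd f S = undefined)}"
proof
  have "\<zero>\<^bsub>S\<^esub> \<in> carrier S" if "cring S" for S :: "'a ring"
    using that by (simp add: cring.cring_simprules(2))
  then show "(0, \<lambda>S. if cring S then \<zero>\<^bsub>S\<^esub> else undefined) \<in>
      {f :: int \<times> ('a ring \<Rightarrow> 'a). \<forall>S. (cring S \<longrightarrow> snd f S \<in> carrier S) \<and> (\<not> cring S \<longrightarrow> snd f S = undefined)}"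
    by simp
qed

setup_lifting type_definition_ring_product

instantiation ring_product :: (type) comm_ring_1
begin

lift_definition zero_ring_product :: "'a ring_product"
  is "(0, \<lambda>S. if cring S then \<zero>\<^bsub>S\<^esub> else undefined)"
  by (simp add: cring.cring_simprules)

lift_definition one_ring_product :: "'a ring_product"
  is "(1, \<lambda>S. if cring S then \<one>\<^bsub>S\<^esub> else undefined)"
  by (simp add: cring.cring_simprules)

lift_definition plus_ring_product :: "'a ring_product \<Rightarrow> 'a ring_product \<Rightarrow> 'a ring_product"
  is "\<lambda>f g. (fst f + fst g, \<lambda>S. if cring S then snd f S \<oplus>\<^bsub>S\<^esub> snd g S else undefined)"
  by (simp add: cring.cring_simprules split: if_splits)

lift_definition times_ring_product :: "'a ring_product \<Rightarrow> 'a ring_product \<Rightarrow> 'a ring_product"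
  is "\<lambda>f g. (fst f * fst g, \<lambda>S. if cring S then snd f S \<otimes>\<^bsub>S\<^esub> snd g S else undefined)"
  by (simp add: cring.cring_simprules split: if_splits)

lift_definition uminus_ring_product :: "'a ring_product \<Rightarrow> 'a ring_product"
  is "\<lambda>f. (- fst f, \<lambda>S. if cring S then \<ominus>\<^bsub>S\<^esub> snd f S else undefined)"
  by (simp add: cring.cring_simprules split: if_splits)

definition minus_ring_product :: "'a ring_product \<Rightarrow> 'a ring_product \<Rightarrow> 'a ring_product"
  where "minus_ring_product f g = f + - g"

instance
proof
  fix a b c :: "'a ring_product"
  show "a * b * c = a * (b * c)"
    by transfer (auto simp: fun_eq_iff cring.cring_simprules split: if_splits)
  show "a * b = b * a"
    by transfer (auto simp: fun_eq_iff cring.cring_simprules split: if_splits)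
  show "1 * a = a"
    by transfer (auto simp: prod_eq_iff fun_eq_iff cring.cring_simprules split: if_splits)
  show "a + b + c = a + (b + c)"
    by transfer (auto simp: fun_eq_iff cring.cring_simprules split: if_splits)
  show "a + b = b + a"
    by transfer (auto simp: fun_eq_iff cring.cring_simprules split: if_splits)
  show "0 + a = a"
    by transfer (auto simp: prod_eq_iff fun_eq_iff cring.cring_simprules split: if_splits)
  show "- a + a = 0"
    by transfer (auto simp: fun_eq_iff cring.cring_simprules split: if_splits)
  show "a - b = a + - b" by (simp add: minus_ring_product_def)
  show "(a + b) * c = a * c + b * c"
    by transfer (auto simp: fun_eq_iff distrib_right cring.cring_simprules split: if_splits)
  show "(0 :: 'a ring_product) \<noteq> 1" by transfer simp
qed

end

section \<open>The given ring as a factor of the product\<close>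

lift_definition component :: "'a ring \<Rightarrow> 'a ring_product \<Rightarrow> 'a" is "\<lambda>R f. snd f R" .

text \<open>All other factors, including \<open>int\<close>, receive 0. The test
  \<open>a \<in> carrier R\<close> keeps the result in the product for arbitrary
  \<open>a\<close>.\<close>

lift_definition single :: "'a ring \<Rightarrow> 'a \<Rightarrow> 'a ring_product"
  is "\<lambda>R a. (0, \<lambda>S. if cring S then if S = R \<and> a \<in> carrier R then a else \<zero>\<^bsub>S\<^esub> else undefined)"
  by (auto simp: cring.cring_simprules)

text \<open>The factors of the product are records without extension fields, so a ring scheme is
  stripped of them before it can index a factor.\<close>

definition plain_ring :: "('a, 'r) ring_scheme \<Rightarrow> 'a ring" where
  "plain_ring R = \<lparr>carrier = carrier R, mult = mult R, one = \<one>\<^bsub>R\<^esub>, zero = \<zero>\<^bsub>R\<^esub>, add = add R\<rparr>"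

lemma plain_ring_simps [simp]:
  "carrier (plain_ring R) = carrier R" "x \<otimes>\<^bsub>plain_ring R\<^esub> y = x \<otimes>\<^bsub>R\<^esub> y"
  "x \<oplus>\<^bsub>plain_ring R\<^esub> y = x \<oplus>\<^bsub>R\<^esub> y" "\<zero>\<^bsub>plain_ring R\<^esub> = \<zero>\<^bsub>R\<^esub>" "\<one>\<^bsub>plain_ring R\<^esub> = \<one>\<^bsub>R\<^esub>"
  by (simp_all add: plain_ring_def)

lemma cring_plain_ring:
  assumes "cring R"
  shows "cring (plain_ring R)"
proof -
  interpret cring R by (rule assms)
  show ?thesis
  proof (rule cringI)
    show "abelian_group (plain_ring R)"
    proof (rule abelian_groupI)
      fix x assume "x \<in> carrier (plain_ring R)"
      then have "\<ominus>\<^bsub>R\<^esub> x \<in> carrier R" "\<ominus>\<^bsub>R\<^esub> x \<oplus>\<^bsub>R\<^esub> x = \<zero>\<^bsub>R\<^esub>" by (simp_all add: l_neg)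
      then show "\<exists>y\<in>carrier (plain_ring R). y \<oplus>\<^bsub>plain_ring R\<^esub> x = \<zero>\<^bsub>plain_ring R\<^esub>" by auto
    qed (simp_all add: a_ac)
    show "comm_monoid (plain_ring R)" by (rule comm_monoidI) (simp_all add: m_ac)
  qed (simp add: l_distr)
qed

lemma corner_embedding_single:
  assumes R: "cring R"
  shows "corner_embedding R (single (plain_ring R)) (component (plain_ring R)) (single (plain_ring R) \<one>\<^bsub>R\<^esub>)"
proof -
  interpret cring R by (rule R)
  have P: "cring (plain_ring R)" by (rule cring_plain_ring[OF R])
  show ?thesis
  proof
    fix s t :: "'a ring_product"
    show "component (plain_ring R) t \<in> carrier R"
      using P by (transfer fixing: R) (auto split: if_splits dest!: spec[of _ "plain_ring R"])
    show "component (plain_ring R) (s + t) = component (plain_ring R) s \<oplus>\<^bsub>R\<^esub> component (plain_ring R) t"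
      using P by (transfer fixing: R) simp
    show "component (plain_ring R) (s * t) = component (plain_ring R) s \<otimes>\<^bsub>R\<^esub> component (plain_ring R) t"
      using P by (transfer fixing: R) simp
    show "component (plain_ring R) 1 = \<one>\<^bsub>R\<^esub>"
      using P by (transfer fixing: R) simp
    show "single (plain_ring R) (component (plain_ring R) t) = single (plain_ring R) \<one>\<^bsub>R\<^esub> * t"
    proof (transfer fixing: R)
      fix f :: "int \<times> ('a ring \<Rightarrow> 'a)"
      assume f: "\<forall>S. (cring S \<longrightarrow> snd f S \<in> carrier S) \<and> (\<not> cring S \<longrightarrow> snd f S = undefined)"
      have "snd f (plain_ring R) \<in> carrier R" using f[rule_format, of "plain_ring R"] P by simp
      \<comment> \<open>In every factor other than the one for \<open>R\<close>, both sides are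
        0.\<close>
      moreover have "\<zero>\<^bsub>S\<^esub> \<otimes>\<^bsub>S\<^esub> snd f S = \<zero>\<^bsub>S\<^esub>" if "cring S" for S
        using f[rule_format, of S] that by (simp add: cring.cring_simprules)
      ultimately show "(0, \<lambda>S. if cring S then if S = plain_ring R \<and> snd f (plain_ring R) \<in> carrier (plain_ring R)
            then snd f (plain_ring R) else \<zero>\<^bsub>S\<^esub> else undefined) =
        (fst (0, \<lambda>S. if cring S then if S = plain_ring R \<and> \<one>\<^bsub>R\<^esub> \<in> carrier (plain_ring R) then \<one>\<^bsub>R\<^esub> else \<zero>\<^bsub>S\<^esub> else undefined) * fst f,
         \<lambda>S. if cring S then snd (0, \<lambda>S. if cring S then if S = plain_ring R \<and> \<one>\<^bsub>R\<^esub> \<in> carrier (plain_ring R) then \<one>\<^bsub>R\<^esub> else \<zero>\<^bsub>S\<^esub> else undefined) S \<otimes>\<^bsub>S\<^esub> snd f S else undefined)"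
        by (auto simp: fun_eq_iff)
    qed
    show "component (plain_ring R) (single (plain_ring R) a) = a" if "a \<in> carrier R" for a
      using that P by (transfer fixing: R) simp
  qed
qed

theorem corollary4:
  fixes R :: "('a, 'r) ring_scheme"
  assumes "hereditary R"
  shows "stacked_bases_property TYPE('f) TYPE('k) R \<and>
    (\<forall>M :: ('a, 'm, 'x) module_scheme. module R M \<and> finitely_presented R M \<longrightarrow>
      (\<exists>(m::nat) (p::nat) (I :: nat \<Rightarrow> 'a set) (e :: nat \<Rightarrow> 'a) (n :: nat \<Rightarrow> nat)
          (J :: nat \<Rightarrow> nat \<Rightarrow> 'a set).
        (\<forall>j\<in>{1..m}. invertible_ideal R (I j) \<and> I j \<noteq> carrier R) \<and>
        (\<forall>i\<in>{1..m}. \<forall>j\<in>{1..m}. i \<le> j \<longrightarrow> I j \<subseteq> I i) \<and>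
        (\<forall>i\<in>{1..p}. e i \<in> carrier R \<and> e i \<noteq> \<zero>\<^bsub>R\<^esub> \<and> e i \<otimes>\<^bsub>R\<^esub> e i = e i) \<and>
        (\<forall>i\<in>{1..p}. \<forall>j\<in>{1..p}. i \<noteq> j \<longrightarrow> e i \<otimes>\<^bsub>R\<^esub> e j = \<zero>\<^bsub>R\<^esub>) \<and>
        (\<forall>i\<in>{1..p}. 0 < n i) \<and> strict_mono_on {1..p} n \<and>
        (\<forall>i\<in>{1..p}. \<forall>k\<in>{1..n i}. invertible_ideal (idem_ring R (e i)) (J i k)) \<and>
        module_isomorphic R M
          (direct_sum2
            (direct_sum {1..m} (\<lambda>j. quotient_module R (I j)))
            (direct_sum {1..p} (\<lambda>i.
              direct_sum {1..n i} (\<lambda>k. ideal_module R (J i k #>\<^bsub>R\<^esub> e i)))))))"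
proof -
  have "cring R" using assms by (simp add: hereditary_def)
  then interpret corner_embedding R "single (plain_ring R)" "component (plain_ring R)"
    "single (plain_ring R) \<one>\<^bsub>R\<^esub>" by (rule corner_embedding_single)
  show ?thesis
    by (intro conjI allI impI stacked_bases_property[OF assms])
      (elim conjE, rule finitely_presented_decomposition[OF assms])
qed

end
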